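(* Let $0<p<\infty$ and $\omega\in B_\infty$. Let $Z$ be a zero set for $A^p_\omega$ such that $Z$ is a finite union of separated sequences. Let $0<\gamma<1$ and suppose that there exist another set $Z'\subset\mathbb{D}$ and a one-to-one correspondence $\sigma:Z\to Z'$ such that $1-|\sigma(a)|^2=\gamma(1-|a|^2)$ for all $a\in Z$, and $\rho_p(a,\sigma(a))$ is uniformly bounded away from $1$ on $Z$. Then $Z'$ is a zero set for $A^{p/\gamma}_\omega$.
   Context: $\mathbb{D}=\{z\in\mathbb{C}:|z|<1\}$, $\mathcal{H}(\mathbb{D})$ is the space of analytic functions in $\mathbb{D}$, and $dA(z)=\frac{dx\,dy}{\pi}$. A weight is a function $\omega:\mathbb{D}\to[0,\infty)$ integrable over $\mathbb{D}$ (with respect to $dA$). $A^p_\omega$ consists of $f\in\mathcal{H}(\mathbb{D})$ with $\|f\|_{A^p_\omega}^p=\int_{\mathbb{D}}|f|^p\omega\,dA<\infty$. Carleson squares are the sets $S(z)=\{re^{i\theta}\in\mathbb{D}:|z|<r<1,\ |\arg(ze^{-i\theta})|<\frac{1-|z|}{2}\}$, $z\in\mathbb{D}\setminus\{0\}$; $|S|$ denotes Euclidean area. For $1<q<\infty$, $\omega\in B_q$ means that the weight $\omega$ is strictly positive almost everywhere and $$\sup_S\left(\frac1{|S|^2}\int_S\omega(z)(1-|z|^2)^{2q}\,dA(z)\right)\left(\frac1{|S|^2}\int_S\omega(z)^{-\frac1{q-1}}\,dA(z)\right)^{q-1}<\infty,$$ the supremum being over all Carleson squares $S$. $B_\infty=\bigcup_{q>1}B_q$.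 Zero sets are sequences with points repeated according to multiplicity: for $f\not\equiv0$, $\mathcal{Z}(f)$ is the sequence of all zeros of $f$ counted with multiplicities. $Z$ is a zero set for $A^p_\omega$ if $Z=\mathcal{Z}(f)$ for some nonzero $f\in A^p_\omega$. $\varphi_a(z)=\frac{a-z}{1-\overline az}$, and $\rho_p(a,z)=|\varphi_a(z)|$ is the pseudohyperbolic distance (the subscript in $\rho_p$ is unrelated to the exponent $p$). A sequence $(z_n)$ in $\mathbb{D}$ is separated if $\inf_{k\neq n}\rho_p(z_k,z_n)>0$. *)

theory Defs
  imports "HOL-Complex_Analysis.Complex_Analysis"
begin

abbreviation unit_disc :: "complex set" where
  "unit_disc \<equiv> ball 0 1"

text \<open>The measure \<open>dA = dx dy / \<pi>\<close> on the unit disc.\<close>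

definition disc_measure :: "complex measure" where
  "disc_measure = density (lebesgue_on unit_disc) (\<lambda>_. ennreal (1 / pi))"

text \<open>Functions on the disc are total functions on the complex plane; their values outside
  the disc are irrelevant.\<close>

definition weight :: "(complex \<Rightarrow> real) \<Rightarrow> bool" where
  "weight \<omega> \<longleftrightarrow> (\<forall>z\<in>unit_disc. 0 \<le> \<omega> z) \<and> integrable disc_measure \<omega>"

definition bergman :: "real \<Rightarrow> (complex \<Rightarrow> real) \<Rightarrow> (complex \<Rightarrow> complex) set" where
  "bergman p \<omega> = {f. f holomorphic_on unit_disc \<and>
     integrable disc_measure (\<lambda>z. cmod (f z) powr p * \<omega> z)}"

definition carleson_square :: "complex \<Rightarrow> complex set" where
  "carleson_square z = {of_real r * cis \<theta> | r \<theta>.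
     cmod z < r \<and> r < 1 \<and> \<bar>Arg (z * cis (- \<theta>))\<bar> < (1 - cmod z) / 2}"

text \<open>The library's integral of a non-integrable function is \<open>0\<close>, so finiteness of the second
  integral is demanded explicitly: since the first one is positive, an infinite second integral
  would make the supremum infinite. The first integral is automatically finite for a weight.\<close>

definition B_class :: "real \<Rightarrow> (complex \<Rightarrow> real) set" where
  "B_class q = {\<omega>. weight \<omega> \<and> (AE z in disc_measure. 0 < \<omega> z) \<and>
     (\<forall>c\<in>unit_disc - {0}.
        set_integrable disc_measure (carleson_square c) (\<lambda>z. \<omega> z powr (- (1 / (q - 1))))) \<and>
     bdd_above ((\<lambda>S.
        (1 / (measure lebesgue S)\<^sup>2 *
           set_lebesgue_integral disc_measure S (\<lambda>z. \<omega> z * (1 - (cmod z)\<^sup>2) powr (2 * q))) *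
        (1 / (measure lebesgue S)\<^sup>2 *
           set_lebesgue_integral disc_measure S (\<lambda>z. \<omega> z powr (- (1 / (q - 1))))) powr (q - 1))
      ` carleson_square ` (unit_disc - {0}))}"

definition B_infinity :: "(complex \<Rightarrow> real) set" where
  "B_infinity = (\<Union>q\<in>{1<..}. B_class q)"

text \<open>A finite or infinite sequence of points is a family \<open>a\<close> indexed by a set \<open>I\<close> of natural
  numbers; a point is repeated according to the number of its indices. The family is the sequence
  of zeros of \<open>f\<close> (in some order) if every point of the disc is listed as often as its
  order as a zero, where \<open>zorder f w = 0\<close> at points \<open>w\<close> with \<open>f w \<noteq> 0\<close>. This is meant for
  holomorphic \<open>f\<close> that do not vanish identically, as \<open>zorder\<close> is not meaningful otherwise.\<close>

definition zero_sequence_of ::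
    "(complex \<Rightarrow> complex) \<Rightarrow> nat set \<Rightarrow> (nat \<Rightarrow> complex) \<Rightarrow> bool" where
  "zero_sequence_of f I a \<longleftrightarrow> (\<forall>n\<in>I. a n \<in> unit_disc) \<and>
     (\<forall>w\<in>unit_disc. finite {n\<in>I. a n = w} \<and> int (card {n\<in>I. a n = w}) = zorder f w)"

definition bergman_zero_set ::
    "real \<Rightarrow> (complex \<Rightarrow> real) \<Rightarrow> nat set \<Rightarrow> (nat \<Rightarrow> complex) \<Rightarrow> bool" where
  "bergman_zero_set p \<omega> I a \<longleftrightarrow>
     (\<exists>f\<in>bergman p \<omega>. (\<exists>z\<in>unit_disc. f z \<noteq> 0) \<and> zero_sequence_of f I a)"

definition disc_involution :: "complex \<Rightarrow> complex \<Rightarrow> complex" where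
  "disc_involution a z = (a - z) / (1 - cnj a * z)"

definition pseudohyperbolic_dist :: "complex \<Rightarrow> complex \<Rightarrow> real" where
  "pseudohyperbolic_dist a z = cmod (disc_involution a z)"

definition separated_sequence :: "nat set \<Rightarrow> (nat \<Rightarrow> complex) \<Rightarrow> bool" where
  "separated_sequence I a \<longleftrightarrow> (\<forall>n\<in>I. a n \<in> unit_disc) \<and>
     (\<exists>\<delta>>0. \<forall>k\<in>I. \<forall>n\<in>I. k \<noteq> n \<longrightarrow> \<delta> \<le> pseudohyperbolic_dist (a k) (a n))"

text \<open>The index sets of the constituent sequences need not be disjoint: as subsequences of
  separated sequences are separated, this is no more general than a partition of \<open>I\<close>.\<close>

definition finite_union_of_separated :: "nat set \<Rightarrow> (nat \<Rightarrow> complex) \<Rightarrow> bool" where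
  "finite_union_of_separated I a \<longleftrightarrow>
     (\<exists>\<J>. finite \<J> \<and> \<Union>\<J> = I \<and> (\<forall>J\<in>\<J>. separated_sequence J a))"

end

theory Submission
  imports Defs
begin

text \<open>
  Let \<open>f\<close> be a function in the space with zeros \<open>a\<close>. One constructs a holomorphic \<open>F\<close> with zeros
  \<open>b = \<sigma>(a)\<close> and \<open>\<bar>F\<bar> = \<bar>f\<bar>\<^sup>\<gamma> \<Prod> \<bar>\<phi>\<^sub>b\<bar> / \<bar>\<phi>\<^sub>a\<bar>\<^sup>\<gamma>\<close>, using canonical products for the zeros and the
  logarithm of the zero-free quotient. Since \<open>log \<bar>\<phi>\<^sub>a(z)\<bar>\<close> is about
  \<open>-(1 - \<bar>a\<bar>\<^sup>2)(1 - \<bar>z\<bar>\<^sup>2) / (2 \<bar>1 - a\<^sup>* z\<bar>\<^sup>2)\<close>, the hypothesis \<open>1 - \<bar>b\<bar>\<^sup>2 = \<gamma> (1 - \<bar>a\<bar>\<^sup>2)\<close> cancels the main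
  terms, and separation bounds the sum of the remainders uniformly in \<open>z\<close>, except for the boundedly many
  \<open>a\<close> close to \<open>z\<close>. These are treated by the maximum principle, whence \<open>\<bar>F(z)\<bar>\<^sup>1\<^sup>/\<^sup>\<gamma> \<le> C \<bar>f(u)\<bar>\<close> for some
  \<open>u\<close> at hyperbolically bounded distance from \<open>z\<close>. On discs \<open>B(z, c (1 - \<bar>z\<bar>))\<close> the weight satisfies a
  Muckenhoupt condition, because such a disc fills a fixed part of a Carleson square; by Hoelder's
  inequality and subharmonicity \<open>\<bar>f(u)\<bar>\<^sup>p\<close> is controlled by the integral of \<open>\<bar>f\<bar>\<^sup>p \<omega>\<close> over such a disc,
  and Tonelli's theorem gives the claim.
\<close>

section \<open>Sums over separated sequences\<close>

text \<open>Zeros of functions in weighted Bergman spaces may violate the Blaschke condition;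
  separation only makes the squares (1 - |a|)^2 summable. The product of the |\<phi>_a| can then
  diverge to 0, so numerator and denominator of the formula for |F| have no meaning separately.
  Hence the exponentials in the canonical factors: passing from \<open>a\<close> to \<open>b\<close>
  adds to the exponent a series of differences, and these are of second order. The comparison of F
  with f must be uniform up to the boundary, so convergence at each \<open>z\<close> is not enough
  and the sums of \<open>sep_kernel\<close> are bounded over all \<open>z\<close>. At a zero of f
  that is not a zero of F no bound of |F(z)| by |f(z)|^\<gamma> is possible, which forces the
  auxiliary point \<open>u\<close>. The weight has no pointwise regularity, so |f(u)|^p \<omega>(z)
  is reached only through averages. The resulting double integral is of Schur type, and the supremum
  in the B_q condition enters only through one kernel integral.\<close>

lemma cmod_one_minus_cnj_mult_sq:
  "(cmod (1 - cnj a * z))\<^sup>2 - (cmod (a - z))\<^sup>2 = (1 - (cmod a)\<^sup>2) * (1 - (cmod z)\<^sup>2)"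
  by (simp only: cmod_power2) (simp add: algebra_simps power2_eq_square)

lemma cmod_one_minus_cnj_mult_commute: "cmod (1 - cnj a * z) = cmod (1 - cnj z * a)"
proof -
  have "cnj (1 - cnj a * z) = 1 - cnj z * a"
    by (simp add: mult.commute)
  then show ?thesis
    by (metis complex_mod_cnj)
qed

lemma one_minus_cmod_le:
  assumes "cmod z \<le> 1"
  shows "1 - cmod a \<le> cmod (1 - cnj a * z)"
proof -
  have "cmod (cnj a * z) \<le> cmod a"
    using assms by (simp add: norm_mult mult_left_le)
  then show ?thesis
    using norm_triangle_ineq2[of 1 "cnj a * z"] by simp
qed

lemma one_minus_cnj_mult_pos:
  assumes "cmod a < 1" "cmod z \<le> 1"
  shows "0 < cmod (1 - cnj a * z)"
  using one_minus_cmod_le[of z a] assms by linarith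

lemma one_minus_sq_bounds:
  fixes x :: real
  assumes "0 \<le> x" "x \<le> 1"
  shows "1 - x \<le> 1 - x\<^sup>2" "1 - x\<^sup>2 \<le> 2 * (1 - x)"
proof -
  have eq: "1 - x\<^sup>2 = (1 - x) * (1 + x)"
    by (simp add: algebra_simps power2_eq_square)
  have "(1 - x) * 1 \<le> (1 - x) * (1 + x)" "(1 - x) * (1 + x) \<le> (1 - x) * 2"
    by (intro mult_left_mono; use assms in simp)+
  then show "1 - x \<le> 1 - x\<^sup>2" "1 - x\<^sup>2 \<le> 2 * (1 - x)"
    unfolding eq by (simp_all add: mult.commute)
qed

lemma pseudohyperbolic_dist_eq:
  "pseudohyperbolic_dist a z = cmod (a - z) / cmod (1 - cnj a * z)"
  by (simp add: pseudohyperbolic_dist_def disc_involution_def norm_divide)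

lemma one_minus_pseudohyperbolic_dist_sq:
  assumes "cmod a < 1" "cmod z < 1"
  shows "1 - (pseudohyperbolic_dist a z)\<^sup>2
    = (1 - (cmod a)\<^sup>2) * (1 - (cmod z)\<^sup>2) / (cmod (1 - cnj a * z))\<^sup>2"
proof -
  have "0 < cmod (1 - cnj a * z)"
    using one_minus_cnj_mult_pos assms by simp
  then show ?thesis
    unfolding pseudohyperbolic_dist_eq power_divide
    using cmod_one_minus_cnj_mult_sq[of a z] by (simp add: field_simps)
qed

text \<open>Both \<open>(1 - \<rho>\<^sup>2)\<^sup>2\<close>, with \<open>\<rho>\<close> the pseudohyperbolic distance of \<open>a\<close> and \<open>z\<close>, and the cost of
  replacing a zero \<open>a\<close> by a zero \<open>b\<close> as in the theorem are bounded by a multiple of this kernel.\<close>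

definition sep_kernel :: "complex \<Rightarrow> complex \<Rightarrow> real" where
  "sep_kernel a z = (1 - (cmod a)\<^sup>2)\<^sup>2 * (1 - (cmod z)\<^sup>2) / cmod (1 - cnj a * z) ^ 3"

lemma measure_lebesgue_ball_complex:
  assumes "0 \<le> r"
  shows "measure lebesgue (ball (c::complex) r) = pi * r\<^sup>2"
  using assms content_ball[of r c] by (simp add: unit_ball_vol_2)

text \<open>Packing argument: the discs \<open>B n\<close> are disjoint, their areas are comparable
  to (1 - |a_n|^2)^2, and the selected ones lie in one disc of radius 3 r. The constant 36 is 9 from
  that radius times 4 from (1 - x^2)^2 <= 4 (1 - x)^2.\<close>

lemma separated_carleson_mass:
  assumes sep: "separated_sequence J a"
  obtains C where "0 \<le> C" "\<And>A z r. \<lbrakk>finite A; A \<subseteq> J; z \<in> unit_disc; 0 < r\<rbrakk> \<Longrightarrow>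
    (\<Sum>n\<in>{n\<in>A. cmod (1 - cnj (a n) * z) < r}. (1 - (cmod (a n))\<^sup>2)\<^sup>2) \<le> C * r\<^sup>2"
proof -
  obtain \<delta> where \<delta>: "\<delta> > 0" and
    sep\<delta>: "\<And>k n. k \<in> J \<Longrightarrow> n \<in> J \<Longrightarrow> k \<noteq> n \<Longrightarrow> \<delta> \<le> pseudohyperbolic_dist (a k) (a n)"
    using sep unfolding separated_sequence_def by blast
  have disc: "\<And>n. n \<in> J \<Longrightarrow> cmod (a n) < 1"
    using sep unfolding separated_sequence_def by auto
  \<comment> \<open>Half of \<delta>, because intersecting discs have centres at distance less than
    2 \<epsilon> |1 - cnj a_n a_k|. The bound 1 keeps every disc inside the unit disc.\<close>
  define \<epsilon> where "\<epsilon> = min (\<delta> / 2) 1"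
  have \<epsilon>: "0 < \<epsilon>" "\<epsilon> \<le> 1" "2 * \<epsilon> \<le> \<delta>"
    using \<delta> by (auto simp: \<epsilon>_def min_def)
  define B where "B n = ball (a n) (\<epsilon> * (1 - cmod (a n)))" for n
  have disjoint: "B n \<inter> B k = {}" if "n \<in> J" "k \<in> J" "n \<noteq> k" for n k
  proof (rule ccontr)
    assume "B n \<inter> B k \<noteq> {}"
    then obtain u where u: "dist (a n) u < \<epsilon> * (1 - cmod (a n))" "dist (a k) u < \<epsilon> * (1 - cmod (a k))"
      by (auto simp: B_def)
    let ?A = "cmod (1 - cnj (a n) * a k)"
    have A: "1 - cmod (a n) \<le> ?A" "1 - cmod (a k) \<le> ?A" "0 < ?A"
      using one_minus_cmod_le[of "a k" "a n"] one_minus_cmod_le[of "a n" "a k"] disc that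
        cmod_one_minus_cnj_mult_commute[of "a n" "a k"] one_minus_cnj_mult_pos[of "a n" "a k"]
      by force+
    have "cmod (a n - a k) \<le> dist (a n) u + dist (a k) u"
      by (metis dist_norm dist_triangle2 dist_commute)
    also have "\<dots> < \<epsilon> * (1 - cmod (a n)) + \<epsilon> * (1 - cmod (a k))"
      using u by linarith
    also have "\<dots> \<le> \<epsilon> * ?A + \<epsilon> * ?A"
      by (intro add_mono mult_left_mono) (use A \<epsilon> in auto)
    also have "\<dots> = 2 * \<epsilon> * ?A"
      by simp
    also have "\<dots> \<le> \<delta> * ?A"
      by (intro mult_right_mono) (use A \<epsilon> in auto)
    finally have "pseudohyperbolic_dist (a n) (a k) < \<delta>"
      using A by (simp add: pseudohyperbolic_dist_eq divide_less_eq)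
    with sep\<delta>[OF that] show False
      by linarith
  qed
  have "(\<Sum>n\<in>{n\<in>A. cmod (1 - cnj (a n) * z) < r}. (1 - (cmod (a n))\<^sup>2)\<^sup>2) \<le> 36 / \<epsilon>\<^sup>2 * r\<^sup>2"
    if A: "finite A" "A \<subseteq> J" and z: "z \<in> unit_disc" and r: "0 < r" for A z r
  proof -
    define A' where "A' = {n\<in>A. cmod (1 - cnj (a n) * z) < r}"
    have A': "finite A'" "A' \<subseteq> J" and r': "\<And>n. n \<in> A' \<Longrightarrow> cmod (1 - cnj (a n) * z) < r"
      using A by (auto simp: A'_def)
    have z1: "cmod z < 1"
      using z by simp
    have small: "1 - cmod (a n) < r" if "n \<in> A'" for n
      using one_minus_cmod_le[of z "a n"] r'[OF that] z1 by linarith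
    \<comment> \<open>Since |1 - cnj a z| = |z| |a - 1 / cnj z|, the selected points lie near the
      reflection 1 / cnj z of \<open>z\<close>. For |z| < 1/2 the reflection is of no use, but then
      a selected point exists only if r > 1/2, and the centre 0 serves.\<close>
    obtain c where cover: "(\<Union>n\<in>A'. B n) \<subseteq> ball c (3 * r)"
    proof (cases "cmod z < 1 / 2")
      case True
      have "B n \<subseteq> ball 0 (3 * r)" if n: "n \<in> A'" for n
      proof -
        have "cmod (cnj (a n) * z) \<le> 1 / 2"
        proof -
          have "cmod (a n) * cmod z \<le> 1 * (1 / 2)"
            using True disc n A' by (intro mult_mono) (auto simp: less_imp_le subset_iff)
          then show ?thesis
            by (simp add: norm_mult)
        qed
        then have "1 / 2 < r"
          using r'[OF n] norm_triangle_ineq2[of 1 "cnj (a n) * z"] by simp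
        moreover have "B n \<subseteq> ball 0 1"
        proof
          fix u assume "u \<in> B n"
          then have "dist (a n) u < \<epsilon> * (1 - cmod (a n))"
            by (simp add: B_def)
          moreover have "\<epsilon> * (1 - cmod (a n)) \<le> 1 * (1 - cmod (a n))"
            using \<epsilon> disc n A' by (intro mult_right_mono) (auto simp: less_imp_le subset_iff)
          ultimately have "dist (a n) u < 1 - cmod (a n)"
            by simp
          then show "u \<in> ball 0 1"
            using norm_triangle_ineq2[of u "a n"] by (simp add: dist_norm norm_minus_commute)
        qed
        ultimately show ?thesis
          by (auto simp: subset_iff)
      qed
      then show ?thesis
        using that by blast
    next
      case False
      define c where "c = 1 / cnj z"
      have zpos: "0 < cmod z"
        using False by linarith
      have "B n \<subseteq> ball c (3 * r)" if n: "n \<in> A'" for n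
      proof
        fix u assume u: "u \<in> B n"
        have "c - a n = (1 - cnj z * a n) / cnj z"
          using zpos by (auto simp: c_def field_simps)
        then have "cmod (c - a n) = cmod (1 - cnj (a n) * z) / cmod z"
          by (simp add: norm_divide cmod_one_minus_cnj_mult_commute)
        also have "\<dots> \<le> cmod (1 - cnj (a n) * z) / (1 / 2)"
          by (rule divide_left_mono) (use False zpos in auto)
        also have "\<dots> \<le> 2 * r"
          using r'[OF n] by simp
        finally have 1: "dist c (a n) \<le> 2 * r"
          by (simp add: dist_norm)
        have "\<epsilon> * (1 - cmod (a n)) \<le> 1 * (1 - cmod (a n))"
          using \<epsilon> disc n A' by (intro mult_right_mono) (auto simp: less_imp_le subset_iff)
        then have "dist (a n) u < r"
          using u small[OF n] by (simp add: B_def)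
        with 1 show "u \<in> ball c (3 * r)"
          using dist_triangle[of c u "a n"] by simp
      qed
      then show ?thesis
        using that by blast
    qed
    have "(\<Sum>n\<in>A'. pi * (\<epsilon> * (1 - cmod (a n)))\<^sup>2) = (\<Sum>n\<in>A'. measure lebesgue (B n))"
      unfolding B_def using \<epsilon> disc A'
      by (intro sum.cong refl measure_lebesgue_ball_complex[symmetric]) (auto simp: less_imp_le subset_iff)
    also have "\<dots> = measure lebesgue (\<Union>n\<in>A'. B n)"
      using A' disjoint
      by (intro measure_finite_Union[symmetric])
         (auto simp: B_def disjoint_family_on_def subset_iff less_imp_neq[OF emeasure_lborel_ball_finite, simplified])
    also have "\<dots> \<le> measure lebesgue (ball c (3 * r))"
      using A' cover by (intro measure_mono_fmeasurable) (auto simp: B_def)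
    also have "\<dots> = pi * (3 * r)\<^sup>2"
      using r by (intro measure_lebesgue_ball_complex) simp
    finally have "(\<Sum>n\<in>A'. pi * (\<epsilon> * (1 - cmod (a n)))\<^sup>2) \<le> pi * (3 * r)\<^sup>2" .
    then have "pi * (\<epsilon>\<^sup>2 * (\<Sum>n\<in>A'. (1 - cmod (a n))\<^sup>2)) \<le> pi * (9 * r\<^sup>2)"
      by (simp add: power_mult_distrib sum_distrib_left)
    then have "\<epsilon>\<^sup>2 * (\<Sum>n\<in>A'. (1 - cmod (a n))\<^sup>2) \<le> 9 * r\<^sup>2"
      by simp
    then have main: "(\<Sum>n\<in>A'. (1 - cmod (a n))\<^sup>2) \<le> 9 / \<epsilon>\<^sup>2 * r\<^sup>2"
      using \<epsilon> by (simp add: field_simps)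
    have "(\<Sum>n\<in>A'. (1 - (cmod (a n))\<^sup>2)\<^sup>2) \<le> (\<Sum>n\<in>A'. 4 * (1 - cmod (a n))\<^sup>2)"
    proof (intro sum_mono)
      fix n assume "n \<in> A'"
      then have "cmod (a n) < 1"
        using A' disc by auto
      then have "(1 - (cmod (a n))\<^sup>2)\<^sup>2 \<le> (2 * (1 - cmod (a n)))\<^sup>2"
        by (intro power_mono one_minus_sq_bounds) (auto simp: power_le_one)
      then show "(1 - (cmod (a n))\<^sup>2)\<^sup>2 \<le> 4 * (1 - cmod (a n))\<^sup>2"
        by (simp only: power_mult_distrib) simp
    qed
    also have "\<dots> \<le> 4 * (9 / \<epsilon>\<^sup>2 * r\<^sup>2)"
      using main by (simp add: sum_distrib_left[symmetric])
    finally show ?thesis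
      by (simp add: A'_def)
  qed
  moreover have "0 \<le> 36 / \<epsilon>\<^sup>2"
    by simp
  ultimately show ?thesis
    using that by blast
qed

text \<open>The terms with \<open>L * 2 ^ j \<le> t n < L * 2 ^ Suc j\<close> contribute at most \<open>4 * C / (L * 2 ^ j)\<close>.\<close>

lemma dyadic_sum_le:
  fixes m t :: "'a \<Rightarrow> real"
  assumes "finite A" "0 < L" "0 \<le> C"
    and m: "\<And>n. n \<in> A \<Longrightarrow> 0 \<le> m n" and t: "\<And>n. n \<in> A \<Longrightarrow> L \<le> t n"
    and mass: "\<And>r. 0 < r \<Longrightarrow> (\<Sum>n\<in>{n\<in>A. t n < r}. m n) \<le> C * r\<^sup>2"
  shows "(\<Sum>n\<in>A. m n / t n ^ 3) \<le> 8 * C / L"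
proof -
  define k where "k n = (LEAST j. t n < L * 2 ^ Suc j)" for n
  have k: "t n < L * 2 ^ Suc (k n)" "L * 2 ^ k n \<le> t n" if n: "n \<in> A" for n
  proof -
    obtain j where "t n / L < 2 ^ j"
      using real_arch_pow[of 2 "t n / L"] by auto
    moreover have "(2::real) ^ j \<le> 2 ^ Suc j"
      by simp
    ultimately have "t n / L < 2 ^ Suc j"
      by linarith
    then have "t n < L * 2 ^ Suc j"
      using \<open>0 < L\<close> by (simp add: divide_less_eq mult.commute)
    then show "t n < L * 2 ^ Suc (k n)"
      unfolding k_def by (rule LeastI)
    show "L * 2 ^ k n \<le> t n"
    proof (cases "k n")
      case 0
      then show ?thesis
        using t[OF n] by simp
    next
      case (Suc i)
      then have "\<not> t n < L * 2 ^ Suc i"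
        unfolding k_def using not_less_Least[of i "\<lambda>j. t n < L * 2 ^ Suc j"] by simp
      then show ?thesis
        using Suc by simp
    qed
  qed
  define K where "K = Suc (Max (insert 0 (k ` A)))"
  have K: "k n < K" if "n \<in> A" for n
    using that \<open>finite A\<close> by (auto simp: K_def less_Suc_eq_le intro: Max_ge)
  \<comment> \<open>Only the summand j = k n is needed. Keeping every j with
    \<open>t n < L * 2 ^ Suc j\<close> turns the inner sum, after the exchange, into the mass of a
    sublevel set of \<open>t\<close>.\<close>
  have "(\<Sum>n\<in>A. m n / t n ^ 3) \<le> (\<Sum>n\<in>A. \<Sum>j<K. if t n < L * 2 ^ Suc j then m n / (L * 2 ^ j) ^ 3 else 0)"
  proof (rule sum_mono)
    fix n assume n: "n \<in> A"
    have "m n / t n ^ 3 \<le> m n / (L * 2 ^ k n) ^ 3"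
      using k[OF n] m[OF n] \<open>0 < L\<close> t[OF n]
      by (intro divide_left_mono power_mono mult_pos_pos zero_less_power) auto
    also have "\<dots> = (if t n < L * 2 ^ Suc (k n) then m n / (L * 2 ^ k n) ^ 3 else 0)"
      using k[OF n] by simp
    also have "\<dots> \<le> (\<Sum>j<K. if t n < L * 2 ^ Suc j then m n / (L * 2 ^ j) ^ 3 else 0)"
      by (rule member_le_sum) (use K n m \<open>0 < L\<close> in auto)
    finally show "m n / t n ^ 3 \<le> (\<Sum>j<K. if t n < L * 2 ^ Suc j then m n / (L * 2 ^ j) ^ 3 else 0)" .
  qed
  also have "\<dots> = (\<Sum>j<K. (\<Sum>n\<in>{n\<in>A. t n < L * 2 ^ Suc j}. m n) / (L * 2 ^ j) ^ 3)"
    using \<open>finite A\<close>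
    by (subst sum.swap) (auto simp: sum.inter_filter sum_divide_distrib intro!: sum.cong)
  also have "\<dots> \<le> (\<Sum>j<K. C * (L * 2 ^ Suc j)\<^sup>2 / (L * 2 ^ j) ^ 3)"
    using \<open>0 < L\<close> by (intro sum_mono divide_right_mono mass) auto
  also have "\<dots> = (\<Sum>j<K. 4 * C / L * (1 / 2) ^ j)"
    using \<open>0 < L\<close> by (intro sum.cong refl) (simp add: field_simps power2_eq_square power3_eq_cube power_divide)
  also have "\<dots> = 4 * C / L * (\<Sum>j<K. (1 / 2) ^ j)"
    by (simp add: sum_distrib_left)
  also have "\<dots> \<le> 4 * C / L * 2"
  proof (rule mult_left_mono)
    have "(\<Sum>j<K. (1 / 2) ^ j :: real) \<le> (\<Sum>j. (1 / 2) ^ j)"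
      by (intro sum_le_suminf) auto
    then show "(\<Sum>j<K. (1 / 2) ^ j :: real) \<le> 2"
      by (simp add: suminf_geometric)
  qed (use assms in auto)
  finally show ?thesis
    by simp
qed

lemma sep_kernel_nonneg:
  assumes "cmod a < 1" "cmod z < 1"
  shows "0 \<le> sep_kernel a z"
proof -
  have "(cmod z)\<^sup>2 \<le> 1"
    using assms by (simp add: power_le_one)
  then show ?thesis
    by (auto simp: sep_kernel_def intro!: divide_nonneg_nonneg mult_nonneg_nonneg)
qed

text \<open>The mass grows like r^2 and the kernel decays like the cube of t = |1 - cnj a z|, so the
  dyadic sum is governed by the lower bound L = 1 - |z| of t. The factor 1 - |z|^2 <= 2 L of the
  kernel cancels the resulting 1 / L, which makes the bound uniform in \<open>z\<close>.\<close>

lemma separated_sum_kernel_le: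
  assumes sep: "separated_sequence J a"
  obtains C where "\<And>A z. \<lbrakk>finite A; A \<subseteq> J; z \<in> unit_disc\<rbrakk> \<Longrightarrow> (\<Sum>n\<in>A. sep_kernel (a n) z) \<le> C"
proof -
  obtain C where C: "0 \<le> C" "\<And>A z r. \<lbrakk>finite A; A \<subseteq> J; z \<in> unit_disc; 0 < r\<rbrakk> \<Longrightarrow>
      (\<Sum>n\<in>{n\<in>A. cmod (1 - cnj (a n) * z) < r}. (1 - (cmod (a n))\<^sup>2)\<^sup>2) \<le> C * r\<^sup>2"
    by (rule separated_carleson_mass[OF sep]) (rule that)
  have disc: "\<And>n. n \<in> J \<Longrightarrow> cmod (a n) < 1"
    using sep unfolding separated_sequence_def by auto
  have "(\<Sum>n\<in>A. sep_kernel (a n) z) \<le> 16 * C" if A: "finite A" "A \<subseteq> J" "z \<in> unit_disc" for A z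
  proof -
    have z: "cmod z < 1"
      using A by simp
    have "(\<Sum>n\<in>A. (1 - (cmod (a n))\<^sup>2)\<^sup>2 / cmod (1 - cnj (a n) * z) ^ 3) \<le> 8 * C / (1 - cmod z)"
    proof (rule dyadic_sum_le)
      fix n assume "n \<in> A"
      then show "1 - cmod z \<le> cmod (1 - cnj (a n) * z)"
        using one_minus_cmod_le[of "a n" z] disc A cmod_one_minus_cnj_mult_commute[of z "a n"]
        by force
    qed (use A z C in auto)
    then have "(1 - (cmod z)\<^sup>2) * (\<Sum>n\<in>A. (1 - (cmod (a n))\<^sup>2)\<^sup>2 / cmod (1 - cnj (a n) * z) ^ 3)
        \<le> (2 * (1 - cmod z)) * (8 * C / (1 - cmod z))"
      using z one_minus_sq_bounds[of "cmod z"] C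
      by (intro mult_mono) (auto intro: sum_nonneg)
    also have "\<dots> = 16 * C"
      using z by (simp add: field_simps)
    finally show ?thesis
      by (simp add: sep_kernel_def sum_distrib_left mult.commute)
  qed
  then show ?thesis
    using that by blast
qed

lemma finite_union_sum_kernel_le:
  assumes "finite_union_of_separated I a"
  obtains C where "\<And>A z. \<lbrakk>finite A; A \<subseteq> I; z \<in> unit_disc\<rbrakk> \<Longrightarrow> (\<Sum>n\<in>A. sep_kernel (a n) z) \<le> C"
proof -
  obtain \<J> where \<J>: "finite \<J>" "\<Union>\<J> = I" "\<forall>J\<in>\<J>. separated_sequence J a"
    using assms unfolding finite_union_of_separated_def by blast
  have "\<exists>C. \<forall>A z. finite A \<longrightarrow> A \<subseteq> \<Union>\<J> \<longrightarrow> z \<in> unit_disc \<longrightarrow> (\<Sum>n\<in>A. sep_kernel (a n) z) \<le> C"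
    using \<J>(1,3)
  proof (induction \<J> rule: finite_induct)
    case empty
    then show ?case
      by (intro exI[of _ 0]) auto
  next
    case (insert J \<J>)
    then obtain C where C: "\<And>A z. finite A \<Longrightarrow> A \<subseteq> \<Union>\<J> \<Longrightarrow> z \<in> unit_disc \<Longrightarrow> (\<Sum>n\<in>A. sep_kernel (a n) z) \<le> C"
      by auto
    obtain C' where C': "\<And>A z. finite A \<Longrightarrow> A \<subseteq> J \<Longrightarrow> z \<in> unit_disc \<Longrightarrow> (\<Sum>n\<in>A. sep_kernel (a n) z) \<le> C'"
      by (rule separated_sum_kernel_le[of J a]) (use insert in auto)
    have "(\<Sum>n\<in>A. sep_kernel (a n) z) \<le> C' + C"
      if A: "finite A" "A \<subseteq> \<Union>(insert J \<J>)" "z \<in> unit_disc" for A z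
    proof -
      have "(\<Sum>n\<in>A. sep_kernel (a n) z) = (\<Sum>n\<in>A \<inter> J. sep_kernel (a n) z) + (\<Sum>n\<in>A - J. sep_kernel (a n) z)"
        using A(1) by (rule sum.Int_Diff)
      also have "\<dots> \<le> C' + C"
        using A by (intro add_mono C C') auto
      finally show ?thesis .
    qed
    then show ?case
      by blast
  qed
  then show ?thesis
    using \<J> that by blast
qed

text \<open>For the maximum principle, zeros close to \<open>z\<close> must stay away from the
  circle of radius s / 8, s = 1 - |z|. Since |1 - cnj a z| <= 2 s + |a - z|, the threshold 1/40
  gives |a - z| < s / 16. Then |a - u| >= s / 16 on the circle, while |1 - cnj a u| <= 3 s; hence
  1/48.\<close>

lemma pseudohyperbolic_near_circle:
  assumes a: "cmod a < 1" and z: "cmod z < 1"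
    and near: "pseudohyperbolic_dist a z < 1 / 40" and u: "cmod (u - z) = (1 - cmod z) / 8"
  shows "1 / 48 \<le> pseudohyperbolic_dist a u"
proof -
  define s where "s = 1 - cmod z"
  have s: "0 < s"
    using z by (simp add: s_def)
  define e where "e = cmod (a - z)"
  have Apos: "0 < cmod (1 - cnj a * z)"
    using one_minus_cnj_mult_pos a z by simp
  have "1 - cnj a * z = of_real (1 - (cmod z)\<^sup>2) - cnj (a - z) * z"
    unfolding of_real_diff of_real_1 complex_norm_square by (simp add: algebra_simps)
  then have "cmod (1 - cnj a * z) \<le> cmod (of_real (1 - (cmod z)\<^sup>2)) + cmod (cnj (a - z) * z)"
    by (metis norm_triangle_ineq4)
  also have "cmod (of_real (1 - (cmod z)\<^sup>2)) = 1 - (cmod z)\<^sup>2"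
    using z by (subst norm_of_real) (simp add: power_le_one)
  also have "1 - (cmod z)\<^sup>2 \<le> 2 * s"
    using z one_minus_sq_bounds[of "cmod z"] by (simp add: s_def)
  also have "cmod (cnj (a - z) * z) \<le> e"
    using z by (simp only: norm_mult complex_mod_cnj e_def) (simp add: mult_left_le)
  finally have "cmod (1 - cnj a * z) \<le> 2 * s + e"
    by simp
  moreover have "e < cmod (1 - cnj a * z) / 40"
    using near Apos by (simp add: pseudohyperbolic_dist_eq e_def field_simps)
  ultimately have e: "e < s / 16"
    using s by linarith
  have u': "cmod (u - z) = s / 8"
    using u by (simp add: s_def)
  have au: "s / 16 \<le> cmod (a - u)" "cmod (a - u) \<le> 3 / 16 * s"
    using norm_triangle_ineq2[of "u - z" "a - z"] norm_triangle_ineq4[of "a - z" "u - z"] e u'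
    by (simp_all add: e_def norm_minus_commute)
  have "cmod u < 1"
    using u' norm_triangle_ineq2[of u z] s s_def by linarith
  then have Bpos: "0 < cmod (1 - cnj a * u)"
    using one_minus_cnj_mult_pos a by simp
  have "1 - cnj a * u = of_real (1 - (cmod a)\<^sup>2) + cnj a * (a - u)"
    unfolding of_real_diff of_real_1 complex_norm_square by (simp add: algebra_simps)
  then have "cmod (1 - cnj a * u) \<le> cmod (of_real (1 - (cmod a)\<^sup>2)) + cmod (cnj a * (a - u))"
    by (metis norm_triangle_ineq)
  also have "cmod (of_real (1 - (cmod a)\<^sup>2)) = 1 - (cmod a)\<^sup>2"
    using a by (subst norm_of_real) (simp add: power_le_one)
  also have "1 - (cmod a)\<^sup>2 \<le> 2 * (1 - cmod a)"
    using a one_minus_sq_bounds[of "cmod a"] by simp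
  also have "cmod (cnj a * (a - u)) \<le> cmod (a - u)"
    using a by (simp add: norm_mult mult_right_le_one_le mult_left_le_one_le)
  also have "1 - cmod a \<le> s + e"
    using norm_triangle_ineq2[of z a] by (simp add: s_def e_def norm_minus_commute)
  finally have "cmod (1 - cnj a * u) \<le> 3 * s"
    using e au by simp
  then have "1 / 48 * cmod (1 - cnj a * u) \<le> cmod (a - u)"
    using au by linarith
  then show ?thesis
    using Bpos by (simp add: pseudohyperbolic_dist_eq field_simps)
qed

section \<open>Pointwise comparison of the factors belonging to \<open>a\<close> and to
  \<open>b\<close>\<close>

lemma one_minus_sq_le_cmod:
  assumes "cmod a < 1" "cmod z < 1"
  shows "1 - (cmod z)\<^sup>2 \<le> 2 * cmod (1 - cnj a * z)"
  using one_minus_sq_bounds[of "cmod z"] one_minus_cmod_le[of a z] assms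
    cmod_one_minus_cnj_mult_commute[of z a] by simp

lemma one_minus_sq_pos: "cmod z < 1 \<Longrightarrow> 0 < 1 - (cmod z)\<^sup>2"
  using one_minus_sq_bounds[of "cmod z"] by simp

lemma sep_kernel_ge_dist:
  assumes a: "cmod a < 1" and z: "cmod z < 1"
  shows "(1 - (pseudohyperbolic_dist a z)\<^sup>2)\<^sup>2 \<le> 2 * sep_kernel a z"
proof -
  let ?A = "cmod (1 - cnj a * z)"
  have A: "0 < ?A"
    using one_minus_cnj_mult_pos a z by simp
  have zz: "0 < 1 - (cmod z)\<^sup>2"
    using one_minus_sq_pos z by simp
  have "(1 - (pseudohyperbolic_dist a z)\<^sup>2)\<^sup>2
      = (1 - (cmod a)\<^sup>2)\<^sup>2 * (1 - (cmod z)\<^sup>2) / ?A ^ 3 * ((1 - (cmod z)\<^sup>2) / ?A)"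
    unfolding one_minus_pseudohyperbolic_dist_sq[OF a z]
    using A by (simp add: power2_eq_square power3_eq_cube mult_ac)
  also have "\<dots> \<le> (1 - (cmod a)\<^sup>2)\<^sup>2 * (1 - (cmod z)\<^sup>2) / ?A ^ 3 * 2"
    using one_minus_sq_le_cmod[OF a z] A zz
    by (intro mult_left_mono) (auto simp: divide_le_eq)
  finally show ?thesis
    by (simp add: sep_kernel_def mult_ac)
qed

text \<open>The identity for 1 - \<rho>^2 turns \<rho> <= \<delta> into an upper bound of order 1 -
  |a|^2 for |1 - cnj a b|, which dominates |a - b|.\<close>

lemma dist_le_of_pseudohyperbolic_dist_le:
  assumes a: "cmod a < 1" and b: "cmod b < 1"
    and \<gamma>: "1 - (cmod b)\<^sup>2 = \<gamma> * (1 - (cmod a)\<^sup>2)"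
    and \<delta>: "pseudohyperbolic_dist a b \<le> \<delta>" "\<delta> < 1"
  shows "cmod (a - b) \<le> sqrt (\<gamma> / (1 - \<delta>\<^sup>2)) * (1 - (cmod a)\<^sup>2)"
proof -
  let ?A = "cmod (1 - cnj a * b)"
  have A: "0 < ?A"
    using one_minus_cnj_mult_pos a b by simp
  have d0: "0 \<le> pseudohyperbolic_dist a b"
    by (simp add: pseudohyperbolic_dist_def)
  have "\<delta>\<^sup>2 < 1"
    using \<delta> d0 by (simp add: power_less_one_iff abs_square_less_1)
  have "1 - \<delta>\<^sup>2 \<le> 1 - (pseudohyperbolic_dist a b)\<^sup>2"
    using \<delta> d0 by (simp add: power_mono)
  also have "\<dots> = \<gamma> * (1 - (cmod a)\<^sup>2)\<^sup>2 / ?A\<^sup>2"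
    unfolding one_minus_pseudohyperbolic_dist_sq[OF a b] \<gamma> by (simp add: power2_eq_square)
  finally have "(1 - \<delta>\<^sup>2) * ?A\<^sup>2 \<le> \<gamma> * (1 - (cmod a)\<^sup>2)\<^sup>2"
    using A by (simp add: field_simps)
  then have *: "?A\<^sup>2 \<le> \<gamma> / (1 - \<delta>\<^sup>2) * (1 - (cmod a)\<^sup>2)\<^sup>2"
    using \<open>\<delta>\<^sup>2 < 1\<close> by (simp add: field_simps)
  have "(cmod (a - b))\<^sup>2 \<le> ?A\<^sup>2"
    using cmod_one_minus_cnj_mult_sq[of a b]
      mult_pos_pos[OF one_minus_sq_pos[OF a] one_minus_sq_pos[OF b]] by linarith
  with * have "(cmod (a - b))\<^sup>2 \<le> \<gamma> / (1 - \<delta>\<^sup>2) * (1 - (cmod a)\<^sup>2)\<^sup>2"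
    by linarith
  then have "cmod (a - b) \<le> sqrt (\<gamma> / (1 - \<delta>\<^sup>2) * (1 - (cmod a)\<^sup>2)\<^sup>2)"
    by (rule real_le_rsqrt)
  also have "\<dots> = sqrt (\<gamma> / (1 - \<delta>\<^sup>2)) * (1 - (cmod a)\<^sup>2)"
    using one_minus_sq_pos[OF a] by (simp only: real_sqrt_mult real_sqrt_abs)
  finally show ?thesis .
qed

text \<open>In logarithms: ln y <= (y^2 - 1) / 2 holds for every y > 0, so \<open>b\<close> may lie
  arbitrarily close to \<open>z\<close>. In contrast, - ln x exceeds (1 - x^2) / 2 by a term
  quadratic in 1 - x^2 with a constant that needs x >= c. The linear terms are \<gamma> \<alpha>
  \<zeta> / 2 times 1 / A^2 and 1 / B^2; their difference gains the factor |A - B| <= \<kappa>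
  \<alpha> and becomes a multiple of \<open>sep_kernel a z\<close>.\<close>

lemma involution_quotient_bound:
  assumes \<gamma>: "0 < \<gamma>" "\<gamma> < 1" and \<delta>: "\<delta> < 1" and c: "0 < c"
  obtains K where "\<And>a b z. \<lbrakk>cmod a < 1; cmod b < 1; cmod z < 1; 1 - (cmod b)\<^sup>2 = \<gamma> * (1 - (cmod a)\<^sup>2);
      pseudohyperbolic_dist a b \<le> \<delta>; c \<le> pseudohyperbolic_dist a z\<rbrakk> \<Longrightarrow>
      pseudohyperbolic_dist b z \<le> exp (K * sep_kernel a z) * pseudohyperbolic_dist a z powr \<gamma>"
proof -
  define \<kappa> where "\<kappa> = sqrt (\<gamma> / (1 - \<delta>\<^sup>2))"
  define \<kappa>' where "\<kappa>' = 1 + 2 * \<kappa> / \<gamma>"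
  define K where "K = \<gamma> / 2 * (\<kappa> * (\<kappa>' + \<kappa>'\<^sup>2)) + \<gamma> / c\<^sup>2"
  have "pseudohyperbolic_dist b z \<le> exp (K * sep_kernel a z) * pseudohyperbolic_dist a z powr \<gamma>"
    if a: "cmod a < 1" and b: "cmod b < 1" and z: "cmod z < 1"
      and ab: "1 - (cmod b)\<^sup>2 = \<gamma> * (1 - (cmod a)\<^sup>2)" "pseudohyperbolic_dist a b \<le> \<delta>"
      and far: "c \<le> pseudohyperbolic_dist a z" for a b z
  proof (cases "pseudohyperbolic_dist b z = 0")
    case True
    then show ?thesis
      by simp
  next
    case False
    define \<alpha> where "\<alpha> = 1 - (cmod a)\<^sup>2"
    define \<zeta> where "\<zeta> = 1 - (cmod z)\<^sup>2"
    define A where "A = cmod (1 - cnj a * z)"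
    define B where "B = cmod (1 - cnj b * z)"
    define x where "x = pseudohyperbolic_dist a z"
    define y where "y = pseudohyperbolic_dist b z"
    have pos: "0 < \<alpha>" "0 < \<zeta>" "0 < A" "0 < B"
      using one_minus_sq_pos a z one_minus_cnj_mult_pos b by (auto simp: \<alpha>_def \<zeta>_def A_def B_def)
    have "0 \<le> pseudohyperbolic_dist a b"
      by (simp add: pseudohyperbolic_dist_def)
    then have \<delta>0: "0 \<le> \<delta>"
      using ab by linarith
    then have "\<delta>\<^sup>2 < 1"
      using \<delta> by (simp add: abs_square_less_1)
    then have \<kappa>0: "0 \<le> \<kappa>"
      using \<gamma> by (simp add: \<kappa>_def)
    then have \<kappa>'0: "0 \<le> \<kappa>'"
      using \<gamma> by (simp add: \<kappa>'_def)
    have y: "0 < y" and x: "c \<le> x"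
      using False far by (auto simp: x_def y_def pseudohyperbolic_dist_def)
    have ab': "cmod (a - b) \<le> \<kappa> * \<alpha>"
      unfolding \<kappa>_def \<alpha>_def by (rule dist_le_of_pseudohyperbolic_dist_le[OF a b ab \<delta>])
    have "cmod ((1 - cnj a * z) - (1 - cnj b * z)) = cmod (cnj (a - b) * z)"
      by (simp add: algebra_simps norm_minus_commute)
    also have "\<dots> \<le> cmod (a - b)"
      using z by (simp only: norm_mult complex_mod_cnj) (simp add: mult_left_le)
    finally have AB: "\<bar>A - B\<bar> \<le> \<kappa> * \<alpha>"
      using ab' norm_triangle_ineq3[of "1 - cnj a * z" "1 - cnj b * z"] by (simp add: A_def B_def)
    \<comment> \<open>Leads to A <= \<kappa>' B, so that the difference of the main terms can be
      estimated by a power of A alone.\<close>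
    have "\<gamma> * \<alpha> \<le> 2 * (1 - cmod b)"
      using ab(1) one_minus_sq_bounds[of "cmod b"] b by (simp add: \<alpha>_def)
    also have "1 - cmod b \<le> B"
      using one_minus_cmod_le[of z b] z by (simp add: B_def)
    finally have "\<alpha> \<le> 2 * B / \<gamma>"
      using \<gamma> by (simp add: field_simps)
    then have "\<kappa> * \<alpha> \<le> \<kappa> * (2 * B / \<gamma>)"
      using \<kappa>0 by (rule mult_left_mono)
    then have "A \<le> \<kappa>' * B"
      using AB by (simp add: \<kappa>'_def algebra_simps)
    then have invB: "1 / B \<le> \<kappa>' / A"
      using pos by (simp add: field_simps)
    have invB2: "1 / B\<^sup>2 \<le> \<kappa>'\<^sup>2 / A\<^sup>2"
      using power_mono[OF invB, of 2] pos by (simp add: power_divide)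
    have "1 / A\<^sup>2 - 1 / B\<^sup>2 = (B - A) * (1 / A * (1 / B\<^sup>2) + 1 / A\<^sup>2 * (1 / B))"
      using pos by (simp add: field_simps power2_eq_square)
    also have "\<dots> \<le> (\<kappa> * \<alpha>) * (1 / A * (\<kappa>'\<^sup>2 / A\<^sup>2) + 1 / A\<^sup>2 * (\<kappa>' / A))"
      using AB pos \<kappa>0 invB invB2 by (intro mult_mono add_mono mult_left_mono) auto
    also have "\<dots> = \<kappa> * \<alpha> * (\<kappa>' + \<kappa>'\<^sup>2) / A ^ 3"
      using pos by (simp add: field_simps power2_eq_square power3_eq_cube)
    finally have diff: "1 / A\<^sup>2 - 1 / B\<^sup>2 \<le> \<kappa> * \<alpha> * (\<kappa>' + \<kappa>'\<^sup>2) / A ^ 3" .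
    have x2: "1 - x\<^sup>2 = \<alpha> * \<zeta> / A\<^sup>2"
      using one_minus_pseudohyperbolic_dist_sq[OF a z] by (simp add: x_def \<alpha>_def \<zeta>_def A_def)
    have y2: "1 - y\<^sup>2 = \<gamma> * \<alpha> * \<zeta> / B\<^sup>2"
      using one_minus_pseudohyperbolic_dist_sq[OF b z] ab by (simp add: y_def \<alpha>_def \<zeta>_def B_def)
    have "2 * ln y = ln (y\<^sup>2)"
      using y by (simp add: ln_realpow)
    also have "\<dots> \<le> y\<^sup>2 - 1"
      using y by (intro ln_le_minus_one) simp
    finally have lny: "ln y \<le> - (\<gamma> * \<alpha> * \<zeta> / B\<^sup>2) / 2"
      unfolding y2[symmetric] by (simp add: field_simps)
    have xpos: "0 < x"
      using x c by linarith
    have "2 * - ln x = ln (1 / x\<^sup>2)"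
      using xpos by (simp add: ln_realpow ln_div)
    also have "\<dots> \<le> 1 / x\<^sup>2 - 1"
      using xpos by (intro ln_le_minus_one) simp
    also have "\<dots> = (1 - x\<^sup>2) + (1 - x\<^sup>2)\<^sup>2 * (1 / x\<^sup>2)"
      using xpos by (simp add: field_simps power2_eq_square)
    also have "\<dots> \<le> (1 - x\<^sup>2) + (1 - x\<^sup>2)\<^sup>2 * (1 / c\<^sup>2)"
      using x c by (intro add_left_mono mult_left_mono divide_left_mono power_mono) auto
    also have "\<dots> \<le> (1 - x\<^sup>2) + (2 * sep_kernel a z) * (1 / c\<^sup>2)"
      using sep_kernel_ge_dist[OF a z] by (intro add_left_mono mult_right_mono) (auto simp: x_def)
    finally have lnx: "- ln x \<le> (\<alpha> * \<zeta> / A\<^sup>2) / 2 + sep_kernel a z / c\<^sup>2"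
      unfolding x2[symmetric] by (simp add: diff_divide_distrib)
    have "ln y - \<gamma> * ln x \<le> - (\<gamma> * \<alpha> * \<zeta> / B\<^sup>2) / 2 + \<gamma> * ((\<alpha> * \<zeta> / A\<^sup>2) / 2 + sep_kernel a z / c\<^sup>2)"
      using lny mult_left_mono[OF lnx, of \<gamma>] \<gamma> by simp
    also have "\<dots> = \<gamma> * \<alpha> * \<zeta> / 2 * (1 / A\<^sup>2 - 1 / B\<^sup>2) + \<gamma> / c\<^sup>2 * sep_kernel a z"
      by (simp add: field_simps)
    also have "\<dots> \<le> \<gamma> * \<alpha> * \<zeta> / 2 * (\<kappa> * \<alpha> * (\<kappa>' + \<kappa>'\<^sup>2) / A ^ 3) + \<gamma> / c\<^sup>2 * sep_kernel a z"
      using pos \<gamma> by (intro add_right_mono mult_left_mono diff) auto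
    also have "\<dots> = K * sep_kernel a z"
      unfolding sep_kernel_def \<alpha>_def[symmetric] \<zeta>_def[symmetric] A_def[symmetric] K_def
      using pos by (simp add: field_simps power2_eq_square)
    finally have "ln y \<le> K * sep_kernel a z + \<gamma> * ln x"
      by linarith
    then have "exp (ln y) \<le> exp (K * sep_kernel a z + \<gamma> * ln x)"
      by simp
    then have "y \<le> exp (K * sep_kernel a z) * x powr \<gamma>"
      using xpos y by (simp add: exp_add powr_def)
    then show ?thesis
      by (simp add: x_def y_def)
  qed
  then show ?thesis
    using that by blast
qed

section \<open>Area means of holomorphic functions\<close>

lemma measurable_Complex [measurable]:
  "(\<lambda>(x, y). Complex x y) \<in> borel_measurable (lborel \<Otimes>\<^sub>M lborel)"
  unfolding Complex_eq case_prod_unfold by measurable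

lemma lborel_complex_distr:
  "(lborel :: complex measure) = distr (lborel \<Otimes>\<^sub>M lborel) borel (\<lambda>(x, y). Complex x y)"
proof (rule lborel_eqI)
  fix l u :: complex
  assume le: "\<And>b. b \<in> Basis \<Longrightarrow> l \<bullet> b \<le> u \<bullet> b"
  have le': "Re l \<le> Re u" "Im l \<le> Im u"
    using le[of 1] le[of \<i>] by (simp_all add: Basis_complex_def)
  have "emeasure (distr (lborel \<Otimes>\<^sub>M lborel) borel (\<lambda>(x, y). Complex x y)) (box l u)
      = emeasure (lborel \<Otimes>\<^sub>M lborel) ((\<lambda>(x, y). Complex x y) -` box l u \<inter> space (lborel \<Otimes>\<^sub>M lborel))"
    by (intro emeasure_distr) auto
  also have "(\<lambda>(x, y). Complex x y) -` box l u \<inter> space (lborel \<Otimes>\<^sub>M lborel)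
      = {Re l<..<Re u} \<times> {Im l<..<Im u}"
    by (auto simp: in_box_complex_iff space_pair_measure)
  also have "emeasure (lborel \<Otimes>\<^sub>M lborel) ({Re l<..<Re u} \<times> {Im l<..<Im u})
      = ennreal (Re u - Re l) * ennreal (Im u - Im l)"
    using le' by (subst lborel.emeasure_pair_measure_Times) auto
  also have "\<dots> = (\<Prod>b\<in>Basis. (u - l) \<bullet> b)"
    using le' by (simp add: Basis_complex_def ennreal_mult')
  finally show "emeasure (distr (lborel \<Otimes>\<^sub>M lborel) borel (\<lambda>(x, y). Complex x y)) (box l u)
      = (\<Prod>b\<in>Basis. (u - l) \<bullet> b)" .
qed simp

lemma measurable_Complex' [measurable (raw)]:
  assumes [measurable]: "f \<in> borel_measurable M" "g \<in> borel_measurable M"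
  shows "(\<lambda>w. Complex (f w) (g w)) \<in> borel_measurable M"
  unfolding Complex_eq by measurable

lemma nn_integral_complex:
  assumes [measurable]: "F \<in> borel_measurable borel"
  shows "(\<integral>\<^sup>+w. F w \<partial>lborel) = (\<integral>\<^sup>+x. \<integral>\<^sup>+y. F (Complex x y) \<partial>lborel \<partial>lborel)"
    and "(\<integral>\<^sup>+w. F w \<partial>lborel) = (\<integral>\<^sup>+y. \<integral>\<^sup>+x. F (Complex x y) \<partial>lborel \<partial>lborel)"
proof -
  have m: "(\<lambda>(x, y). F (Complex x y)) \<in> borel_measurable (lborel \<Otimes>\<^sub>M lborel)"
    unfolding case_prod_unfold by measurable
  have "(\<integral>\<^sup>+w. F w \<partial>lborel) = (\<integral>\<^sup>+w. F w \<partial>distr (lborel \<Otimes>\<^sub>M lborel) borel (\<lambda>(x, y). Complex x y))"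
    by (simp only: lborel_complex_distr[symmetric])
  also have "\<dots> = (\<integral>\<^sup>+(x, y). F (Complex x y) \<partial>(lborel \<Otimes>\<^sub>M lborel))"
    by (subst nn_integral_distr) (auto simp: case_prod_unfold)
  finally have eq: "(\<integral>\<^sup>+w. F w \<partial>lborel) = (\<integral>\<^sup>+(x, y). F (Complex x y) \<partial>(lborel \<Otimes>\<^sub>M lborel))" .
  show "(\<integral>\<^sup>+w. F w \<partial>lborel) = (\<integral>\<^sup>+x. \<integral>\<^sup>+y. F (Complex x y) \<partial>lborel \<partial>lborel)"
    unfolding eq using lborel.nn_integral_fst[OF m] by simp
  show "(\<integral>\<^sup>+w. F w \<partial>lborel) = (\<integral>\<^sup>+y. \<integral>\<^sup>+x. F (Complex x y) \<partial>lborel \<partial>lborel)"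
    unfolding eq using lborel_pair.nn_integral_snd[OF m] by simp
qed

text \<open>The bound runs over the whole line traced by \<open>k\<close>, not over the segment
  alone, so that a later integration over parallel segments is plain Tonelli. The case y2 < y1 is
  included for the two sides of a square that are traversed backwards.\<close>

lemma contour_integral_linepath_le_nn_integral:
  fixes p q :: complex and y1 y2 :: real
  assumes path: "\<And>t. linepath p q t = k (y1 + (y2 - y1) * t)" and pq: "cmod (q - p) = \<bar>y2 - y1\<bar>" "y1 \<noteq> y2"
    and g: "continuous_on (closed_segment p q) g"
    and le: "\<And>t. t \<in> {0..1} \<Longrightarrow> ennreal (cmod (g (linepath p q t))) \<le> c * F (k (y1 + (y2 - y1) * t))"
    and F: "(\<lambda>y. F (k y)) \<in> borel_measurable borel"
  shows "ennreal (cmod (contour_integral (linepath p q) g)) \<le> c * (\<integral>\<^sup>+y. F (k y) \<partial>lborel)"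
proof -
  note [measurable] = F
  define G where "G t = g (linepath p q t)" for t
  have contG: "continuous_on {0..1} G"
    unfolding G_def using g
    by (intro continuous_on_compose2[OF g]) (auto intro!: continuous_intros simp: linepath_in_path)
  then have int: "integrable lborel (\<lambda>t. indicator {0..1} t *\<^sub>R G t)"
    by (intro borel_integrable_compact) auto
  then have "integral {0..1} G = (LINT t:{0..1}|lborel. G t)"
    by (intro set_borel_integral_eq_integral(2)[symmetric]) (simp add: set_integrable_def)
  then have "ennreal (cmod (integral {0..1} G)) = ennreal (cmod (LINT t|lborel. indicator {0..1} t *\<^sub>R G t))"
    by (simp add: set_lebesgue_integral_def)
  also have "\<dots> \<le> (\<integral>\<^sup>+t. ennreal (cmod (indicator {0..1} t *\<^sub>R G t)) \<partial>lborel)"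
    by (rule integral_norm_bound_ennreal[OF int])
  also have "\<dots> \<le> (\<integral>\<^sup>+t. c * F (k (y1 + (y2 - y1) * t)) \<partial>lborel)"
    using le by (intro nn_integral_mono) (auto simp: G_def indicator_def)
  also have "\<dots> = c * (\<integral>\<^sup>+t. F (k (y1 + (y2 - y1) * t)) \<partial>lborel)"
  proof (rule nn_integral_cmult)
    have "(\<lambda>t. (\<lambda>y. F (k y)) (y1 + (y2 - y1) * t)) \<in> borel_measurable lborel"
      by measurable
    then show "(\<lambda>t. F (k (y1 + (y2 - y1) * t))) \<in> borel_measurable lborel"
      by simp
  qed
  finally have *: "ennreal (cmod (integral {0..1} G)) \<le> c * (\<integral>\<^sup>+t. F (k (y1 + (y2 - y1) * t)) \<partial>lborel)" .
  have "contour_integral (linepath p q) g = (q - p) * integral {0..1} G"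
    unfolding contour_integral_integral G_def[abs_def] by simp
  then have "ennreal (cmod (contour_integral (linepath p q) g))
      = ennreal \<bar>y2 - y1\<bar> * ennreal (cmod (integral {0..1} G))"
    by (simp add: norm_mult pq ennreal_mult)
  also have "\<dots> \<le> ennreal \<bar>y2 - y1\<bar> * (c * (\<integral>\<^sup>+t. F (k (y1 + (y2 - y1) * t)) \<partial>lborel))"
    by (intro mult_left_mono *) auto
  also have "\<dots> = c * (ennreal \<bar>y2 - y1\<bar> * (\<integral>\<^sup>+t. F (k (y1 + (y2 - y1) * t)) \<partial>lborel))"
    by (simp add: mult_ac)
  also have "ennreal \<bar>y2 - y1\<bar> * (\<integral>\<^sup>+t. F (k (y1 + (y2 - y1) * t)) \<partial>lborel) = (\<integral>\<^sup>+y. F (k y) \<partial>lborel)"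
    using pq nn_integral_real_affine[OF F, of "y2 - y1" y1] by simp
  finally show ?thesis .
qed

text \<open>Cauchy's formula over the squares with centre \<open>z\<close> and half side \<open>r\<close>, integrated over \<open>r\<close>:
  each of the four sides sweeps out a part of the largest square.\<close>

lemma cmod_le_area_mean:
  fixes z :: complex
  assumes f: "f holomorphic_on ball z R" and R: "0 < R"
  shows "ennreal (cmod (f z)) \<le> ennreal (16 / R\<^sup>2) * (\<integral>\<^sup>+w. ennreal (cmod (f w)) * indicator (ball z R) w \<partial>lborel)"
proof -
  \<comment> \<open>The half side of the largest square: its half diagonal is R / sqrt 2, so the
    closed square lies in the open ball.\<close>
  define h where "h = R / 2"
  define x0 where "x0 = Re z"
  define y0 where "y0 = Im z"
  define Q where "Q = cbox (Complex (x0 - h) (y0 - h)) (Complex (x0 + h) (y0 + h))"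
  have Q_iff: "Complex x y \<in> Q \<longleftrightarrow> \<bar>x - x0\<bar> \<le> h \<and> \<bar>y - y0\<bar> \<le> h" for x y
    by (auto simp: Q_def in_cbox_complex_iff)
  have h: "0 < h"
    using R by (simp add: h_def)
  have Q_ball: "Q \<subseteq> ball z R"
  proof
    fix w assume "w \<in> Q"
    then have "\<bar>Re w - x0\<bar> \<le> h" "\<bar>Im w - y0\<bar> \<le> h"
      using Q_iff[of "Re w" "Im w"] by auto
    then have "(Re w - x0)\<^sup>2 \<le> h\<^sup>2" "(Im w - y0)\<^sup>2 \<le> h\<^sup>2"
      by (auto simp: abs_le_square_iff[symmetric] h less_imp_le)
    then have "(cmod (w - z))\<^sup>2 \<le> 2 * h\<^sup>2"
      by (simp add: cmod_power2 x0_def y0_def)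
    also have "\<dots> < R\<^sup>2"
      using R by (simp add: h_def power2_eq_square)
    finally have "cmod (w - z) < R"
      using R by (simp add: power2_less_imp_less)
    then show "w \<in> ball z R"
      by (simp add: dist_norm norm_minus_commute)
  qed
  have cont: "continuous_on (ball z R) f"
    using f by (rule holomorphic_on_imp_continuous_on)
  \<comment> \<open>Outside the ball \<open>f\<close> is arbitrary; the cut-off makes the function
    Borel on the plane and lets the integrals run over full lines.\<close>
  define F where "F w = ennreal (cmod (indicator Q w *\<^sub>R f w))" for w
  have contQ: "continuous_on Q f"
    using cont Q_ball by (rule continuous_on_subset)
  have [measurable]: "(\<lambda>w. indicator Q w *\<^sub>R f w) \<in> borel_measurable borel"
    using contQ by (intro borel_measurable_continuous_on_indicator) (simp add: Q_def)
  have F_meas [measurable]: "F \<in> borel_measurable borel"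
    unfolding F_def by measurable
  define A where "A x = (\<integral>\<^sup>+y. F (Complex x y) \<partial>lborel)" for x
  define B where "B y = (\<integral>\<^sup>+x. F (Complex x y) \<partial>lborel)" for y
  define J where "J = (\<integral>\<^sup>+w. F w \<partial>lborel)"
  have F_pair: "(\<lambda>(x, y). F (Complex x y)) \<in> borel_measurable (borel \<Otimes>\<^sub>M lborel)"
      "(\<lambda>(y, x). F (Complex x y)) \<in> borel_measurable (borel \<Otimes>\<^sub>M lborel)"
    unfolding case_prod_unfold by measurable
  have A_meas [measurable]: "A \<in> borel_measurable borel"
    unfolding A_def[abs_def] using lborel.borel_measurable_nn_integral_fst[OF F_pair(1)] by simp
  have B_meas [measurable]: "B \<in> borel_measurable borel"
    unfolding B_def[abs_def] using lborel.borel_measurable_nn_integral_fst[OF F_pair(2)] by simp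
  have AJ: "(\<integral>\<^sup>+x. A x \<partial>lborel) = J" and BJ: "(\<integral>\<^sup>+y. B y \<partial>lborel) = J"
    unfolding A_def B_def J_def using nn_integral_complex[OF F_meas] by auto
  \<comment> \<open>Half sides of at least h / 2 keep the Cauchy kernel 1 / |w - z| below 2 /
    h.\<close>
  have sides: "ennreal (2 * pi * cmod (f z)) \<le>
      ennreal (2 / h) * (A (x0 + r) + A (x0 + (-1) * r) + (B (y0 + r) + B (y0 + (-1) * r)))"
    if r: "h / 2 \<le> r" "r \<le> h" for r
  proof -
    have r0: "0 < r"
      using r h by linarith
    define a1 where "a1 = Complex (x0 - r) (y0 - r)"
    define a2 where "a2 = Complex (x0 + r) (y0 - r)"
    define a3 where "a3 = Complex (x0 + r) (y0 + r)"
    define a4 where "a4 = Complex (x0 - r) (y0 + r)"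
    define g where "g w = f w / (w - z)" for w
    let ?\<gamma> = "rectpath a1 a3"
    have \<gamma>: "?\<gamma> = linepath a1 a2 +++ linepath a2 a3 +++ linepath a3 a4 +++ linepath a4 a1"
      by (simp add: rectpath_def Let_def a1_def a2_def a3_def a4_def)
    have frame: "path_image ?\<gamma> \<subseteq> Q - {z}" and big: "\<And>w. w \<in> path_image ?\<gamma> \<Longrightarrow> r \<le> cmod (w - z)"
    proof -
      have "w \<in> Q \<and> r \<le> cmod (w - z)" if "w \<in> path_image ?\<gamma>" for w
      proof -
        have w: "\<bar>Re w - x0\<bar> = r \<and> \<bar>Im w - y0\<bar> \<le> r \<or> \<bar>Im w - y0\<bar> = r \<and> \<bar>Re w - x0\<bar> \<le> r"
          using that r0 by (subst (asm) path_image_rectpath) (auto simp: a1_def a3_def)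
        then have "w \<in> Q"
          using r Q_iff[of "Re w" "Im w"] by auto
        moreover have "r \<le> cmod (w - z)"
          using w abs_Re_le_cmod[of "w - z"] abs_Im_le_cmod[of "w - z"]
          by (auto simp: x0_def y0_def)
        ultimately show ?thesis
          by blast
      qed
      then show "path_image ?\<gamma> \<subseteq> Q - {z}" "\<And>w. w \<in> path_image ?\<gamma> \<Longrightarrow> r \<le> cmod (w - z)"
        using r0 by fastforce+
    qed
    have img: "path_image ?\<gamma> = closed_segment a1 a2 \<union> closed_segment a2 a3 \<union> closed_segment a3 a4 \<union> closed_segment a4 a1"
      by (simp add: \<gamma> path_image_join Un_assoc)
    have contg: "continuous_on (path_image ?\<gamma>) g"
      unfolding g_def using frame contQ
      by (intro continuous_intros continuous_on_subset[OF contQ]) auto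
    have contseg: "continuous_on (closed_segment a1 a2) g" "continuous_on (closed_segment a2 a3) g"
        "continuous_on (closed_segment a3 a4) g" "continuous_on (closed_segment a4 a1) g"
      using contg unfolding img by (auto intro: continuous_on_subset)
    have gF: "ennreal (cmod (g w)) \<le> ennreal (2 / h) * F w" if "w \<in> path_image ?\<gamma>" for w
    proof -
      have "cmod (g w) \<le> cmod (f w) / (h / 2)"
        unfolding g_def norm_divide using big[OF that] r h by (intro divide_left_mono mult_pos_pos) auto
      moreover have "w \<in> Q"
        using that frame by auto
      ultimately show ?thesis
        using h by (simp add: F_def ennreal_mult[symmetric] mult.commute)
    qed
    have winding: "winding_number ?\<gamma> z = 1"
      using r0 by (intro winding_number_rectpath) (simp add: in_box_complex_iff a1_def a3_def x0_def y0_def)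
    have "((\<lambda>w. f w / (w - z)) has_contour_integral (2 * pi * \<i> * winding_number ?\<gamma> z * f z)) ?\<gamma>"
      by (rule Cauchy_integral_formula_convex_simple[of "ball z R"])
         (use f R frame Q_ball in auto)
    then have "contour_integral ?\<gamma> g = 2 * pi * \<i> * f z"
      using winding by (simp add: contour_integral_unique g_def[abs_def])
    moreover have "contour_integral ?\<gamma> g = contour_integral (linepath a1 a2) g + contour_integral (linepath a2 a3) g
        + contour_integral (linepath a3 a4) g + contour_integral (linepath a4 a1) g"
      unfolding \<gamma> using contseg
      by (simp add: contour_integrable_continuous_linepath)
    ultimately have "2 * pi * cmod (f z) = cmod (contour_integral (linepath a1 a2) g + contour_integral (linepath a2 a3) g
        + contour_integral (linepath a3 a4) g + contour_integral (linepath a4 a1) g)"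
      by (metis (no_types, lifting) norm_mult norm_ii norm_of_real abs_of_nonneg mult.right_neutral
          norm_numeral pi_ge_zero of_real_mult of_real_numeral)
    also have "\<dots> \<le> cmod (contour_integral (linepath a1 a2) g) + cmod (contour_integral (linepath a2 a3) g)
        + cmod (contour_integral (linepath a3 a4) g) + cmod (contour_integral (linepath a4 a1) g)"
      by (intro order_trans[OF norm_triangle_ineq] add_mono order_refl)
    finally have "ennreal (2 * pi * cmod (f z)) \<le> ennreal (cmod (contour_integral (linepath a1 a2) g))
        + ennreal (cmod (contour_integral (linepath a2 a3) g))
        + ennreal (cmod (contour_integral (linepath a3 a4) g)) + ennreal (cmod (contour_integral (linepath a4 a1) g))"
      by (simp add: ennreal_plus[symmetric] ennreal_leI del: ennreal_plus)
    also have "\<dots> \<le> ennreal (2 / h) * B (y0 - r) + ennreal (2 / h) * A (x0 + r)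
        + ennreal (2 / h) * B (y0 + r) + ennreal (2 / h) * A (x0 - r)"
    proof (intro add_mono)
      note lin = linepath_def complex_eq_iff algebra_simps
      have sq: "sqrt (4 * r\<^sup>2) = 2 * r"
        using r0 by (simp add: real_sqrt_mult)
      show "ennreal (cmod (contour_integral (linepath a1 a2) g)) \<le> ennreal (2 / h) * B (y0 - r)"
        unfolding B_def
      proof (rule contour_integral_linepath_le_nn_integral[where k = "\<lambda>x. Complex x (y0 - r)"])
        show eq: "linepath a1 a2 t = Complex (x0 - r + (x0 + r - (x0 - r)) * t) (y0 - r)" for t
          by (simp add: a1_def a2_def lin)
        show "ennreal (cmod (g (linepath a1 a2 t)))
            \<le> ennreal (2 / h) * F (Complex (x0 - r + (x0 + r - (x0 - r)) * t) (y0 - r))" if "t \<in> {0..1}" for t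
          unfolding eq[symmetric] by (rule gF) (use that in \<open>simp add: img linepath_in_path\<close>)
      qed (use contseg r0 in \<open>auto simp: a1_def a2_def cmod_def sq\<close>)
      show "ennreal (cmod (contour_integral (linepath a2 a3) g)) \<le> ennreal (2 / h) * A (x0 + r)"
        unfolding A_def
      proof (rule contour_integral_linepath_le_nn_integral[where k = "\<lambda>y. Complex (x0 + r) y"])
        show eq: "linepath a2 a3 t = Complex (x0 + r) (y0 - r + (y0 + r - (y0 - r)) * t)" for t
          by (simp add: a2_def a3_def lin)
        show "ennreal (cmod (g (linepath a2 a3 t)))
            \<le> ennreal (2 / h) * F (Complex (x0 + r) (y0 - r + (y0 + r - (y0 - r)) * t))" if "t \<in> {0..1}" for t
          unfolding eq[symmetric] by (rule gF) (use that in \<open>simp add: img linepath_in_path\<close>)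
      qed (use contseg r0 in \<open>auto simp: a2_def a3_def cmod_def sq\<close>)
      show "ennreal (cmod (contour_integral (linepath a3 a4) g)) \<le> ennreal (2 / h) * B (y0 + r)"
        unfolding B_def
      proof (rule contour_integral_linepath_le_nn_integral[where k = "\<lambda>x. Complex x (y0 + r)"])
        show eq: "linepath a3 a4 t = Complex (x0 + r + (x0 - r - (x0 + r)) * t) (y0 + r)" for t
          by (simp add: a3_def a4_def lin)
        show "ennreal (cmod (g (linepath a3 a4 t)))
            \<le> ennreal (2 / h) * F (Complex (x0 + r + (x0 - r - (x0 + r)) * t) (y0 + r))" if "t \<in> {0..1}" for t
          unfolding eq[symmetric] by (rule gF) (use that in \<open>simp add: img linepath_in_path\<close>)
      qed (use contseg r0 in \<open>auto simp: a3_def a4_def cmod_def sq\<close>)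
      show "ennreal (cmod (contour_integral (linepath a4 a1) g)) \<le> ennreal (2 / h) * A (x0 - r)"
        unfolding A_def
      proof (rule contour_integral_linepath_le_nn_integral[where k = "\<lambda>y. Complex (x0 - r) y"])
        show eq: "linepath a4 a1 t = Complex (x0 - r) (y0 + r + (y0 - r - (y0 + r)) * t)" for t
          by (simp add: a4_def a1_def lin)
        show "ennreal (cmod (g (linepath a4 a1 t)))
            \<le> ennreal (2 / h) * F (Complex (x0 - r) (y0 + r + (y0 - r - (y0 + r)) * t))" if "t \<in> {0..1}" for t
          unfolding eq[symmetric] by (rule gF) (use that in \<open>simp add: img linepath_in_path\<close>)
      qed (use contseg r0 in \<open>auto simp: a4_def a1_def cmod_def sq\<close>)
    qed
    also have "\<dots> = ennreal (2 / h) * (A (x0 + r) + A (x0 + (-1) * r) + (B (y0 + r) + B (y0 + (-1) * r)))"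
      by (simp add: distrib_left add_ac)
    finally show ?thesis .
  qed
  \<comment> \<open>The left side of \<open>sides\<close> is constant in r and is integrated over
    [h / 2, h]. On the right r may run over all reals; by translation and reflection each of the
    four terms then integrates to the area integral \<open>J\<close>.\<close>
  have "ennreal (2 * pi * cmod (f z)) * ennreal (h / 2)
      = (\<integral>\<^sup>+r. ennreal (2 * pi * cmod (f z)) * indicator {h / 2..h} r \<partial>lborel)"
    using h by (simp add: nn_integral_cmult)
  also have "\<dots> \<le> (\<integral>\<^sup>+r. ennreal (2 / h) * (A (x0 + r) + A (x0 + (-1) * r) + (B (y0 + r) + B (y0 + (-1) * r))) \<partial>lborel)"
  proof (rule nn_integral_mono)
    fix r :: real
    show "ennreal (2 * pi * cmod (f z)) * indicator {h / 2..h} r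
        \<le> ennreal (2 / h) * (A (x0 + r) + A (x0 + (-1) * r) + (B (y0 + r) + B (y0 + (-1) * r)))"
      using sides[of r] by (cases "r \<in> {h / 2..h}") auto
  qed
  also have "\<dots> = ennreal (2 / h) * ((\<integral>\<^sup>+r. A (x0 + r) \<partial>lborel) + (\<integral>\<^sup>+r. A (x0 + (-1) * r) \<partial>lborel)
      + ((\<integral>\<^sup>+r. B (y0 + r) \<partial>lborel) + (\<integral>\<^sup>+r. B (y0 + (-1) * r) \<partial>lborel)))"
    by (simp add: nn_integral_cmult nn_integral_add)
  also have "\<dots> = ennreal (2 / h) * (J + J + (J + J))"
    using nn_integral_real_affine[OF A_meas, of 1 x0] nn_integral_real_affine[OF A_meas, of "-1" x0]
      nn_integral_real_affine[OF B_meas, of 1 y0] nn_integral_real_affine[OF B_meas, of "-1" y0] AJ BJ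
    by simp
  also have "J + J + (J + J) = ennreal 4 * J"
  proof -
    have "J + J + (J + J) = (1 + 1 + (1 + 1)) * J"
      by (simp only: distrib_right mult_1)
    then show ?thesis
      by simp
  qed
  finally have main: "ennreal (2 * pi * cmod (f z)) * ennreal (h / 2) \<le> ennreal (2 / h) * (ennreal 4 * J)" .
  have "ennreal (cmod (f z)) = ennreal (1 / (pi * h)) * (ennreal (2 * pi * cmod (f z)) * ennreal (h / 2))"
    using h by (simp add: ennreal_mult[symmetric])
  also have "\<dots> \<le> ennreal (1 / (pi * h)) * (ennreal (2 / h) * (ennreal 4 * J))"
    by (intro mult_left_mono main) auto
  also have "\<dots> = ennreal (32 / (pi * R\<^sup>2)) * J"
    using R by (simp add: h_def ennreal_mult[symmetric] mult.assoc[symmetric] power2_eq_square divide_simps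
        del: ennreal_numeral)
  also have "\<dots> \<le> ennreal (16 / R\<^sup>2) * J"
  proof (intro mult_right_mono ennreal_leI)
    have "32 / (pi * R\<^sup>2) \<le> 32 / (2 * R\<^sup>2)"
      using R pi_ge_two by (intro divide_left_mono mult_right_mono mult_pos_pos) auto
    then show "32 / (pi * R\<^sup>2) \<le> 16 / R\<^sup>2"
      by simp
  qed auto
  also have "J \<le> (\<integral>\<^sup>+w. ennreal (cmod (f w)) * indicator (ball z R) w \<partial>lborel)"
    unfolding J_def F_def using Q_ball by (intro nn_integral_mono) (auto simp: indicator_def)
  finally show ?thesis
    by (simp add: mult_left_mono)
qed

text \<open>For \<open>t < 1\<close> there is no convexity argument. Instead, at a maximum point \<open>v\<close> of
  \<open>(R - dist z u) powr (2 / t) * cmod (f u)\<close> the function is bounded by a multiple of \<open>cmod (f v)\<close> on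
  half of the remaining disc, so that \<open>cmod (f u)\<close> may be traded for \<open>cmod (f u) powr t\<close> there.\<close>

lemma cmod_powr_le_area_mean:
  fixes z :: complex
  assumes f: "f holomorphic_on S" and S: "open S" "cball z R \<subseteq> S" and R: "0 < R"
    and t: "0 < t" "t \<le> 1" and J: "0 \<le> J"
    and le: "(\<integral>\<^sup>+w. ennreal (cmod (f w) powr t) * indicator (ball z R) w \<partial>lborel) \<le> ennreal J"
  shows "R\<^sup>2 * cmod (f z) powr t \<le> 64 * 2 powr (2 / t * (1 - t)) * J"
proof -
  \<comment> \<open>With the exponent 2 / t the power \<open>N u powr t\<close> is (R - |u - z|)^2
    |f u|^t, which scales like area.\<close>
  define N where "N u = (R - dist z u) powr (2 / t) * cmod (f u)" for u
  have cont: "continuous_on (cball z R) f"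
    using f S by (meson continuous_on_subset holomorphic_on_imp_continuous_on)
  have "continuous_on (cball z R) N"
    unfolding N_def using t by (intro continuous_intros continuous_on_powr' cont) auto
  then obtain v where v: "v \<in> cball z R" "\<And>u. u \<in> cball z R \<Longrightarrow> N u \<le> N v"
    using continuous_attains_sup[of "cball z R" N] R by auto
  define d where "d = R - dist z v"
  have RN: "R\<^sup>2 * cmod (f z) powr t \<le> N v powr t"
  proof -
    have "R\<^sup>2 * cmod (f z) powr t = (R powr (2 / t) * cmod (f z)) powr t"
      using R t by (simp add: powr_mult powr_powr)
    also have "\<dots> = N z powr t"
      by (simp add: N_def)
    also have "\<dots> \<le> N v powr t"
      using R t v(2)[of z] by (intro powr_mono2) (auto simp: N_def)
    finally show ?thesis .
  qed
  show ?thesis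
  proof (cases "N v = 0")
    case True
    then have "R\<^sup>2 * cmod (f z) powr t \<le> 0"
      using RN by simp
    then show ?thesis
      using J by (meson mult_nonneg_nonneg order_trans powr_ge_zero zero_le_numeral)
  next
    case False
    have d0: "0 \<le> d"
      using v(1) by (simp add: d_def)
    have d: "0 < d" and fv: "0 < cmod (f v)"
      using False d0 t by (auto simp: N_def d_def[symmetric] less_le)
    \<comment> \<open>Points within d / 2 of \<open>v\<close> keep distance at least d / 2 from the
      boundary circle, so maximality of \<open>N v\<close> bounds |f| there by this multiple of |f
      v|.\<close>
    define K where "K = 2 powr (2 / t) * cmod (f v)"
    have K: "0 < K"
      using fv by (simp add: K_def)
    have sub: "ball v (d / 2) \<subseteq> ball z R"
    proof
      fix u assume "u \<in> ball v (d / 2)"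
      then show "u \<in> ball z R"
        using dist_triangle[of z u v] d by (simp add: d_def)
    qed
    have fu: "cmod (f u) \<le> K" if u: "u \<in> ball v (d / 2)" for u
    proof -
      have "u \<in> cball z R"
        using sub u by auto
      have "d / 2 \<le> R - dist z u"
        using dist_triangle[of z u v] u by (simp add: d_def)
      then have "(d / 2) powr (2 / t) * cmod (f u) \<le> N u"
        unfolding N_def using d t by (intro mult_right_mono powr_mono2) auto
      also have "\<dots> \<le> N v"
        by (rule v(2)) fact
      also have "N v = d powr (2 / t) * cmod (f v)"
        by (simp add: N_def d_def)
      finally show ?thesis
        using d by (simp add: K_def powr_divide field_simps)
    qed
    have fu': "cmod (f u) \<le> K powr (1 - t) * cmod (f u) powr t" if u: "u \<in> ball v (d / 2)" for u
    proof (cases "f u = 0")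
      case False
      then have "cmod (f u) = cmod (f u) powr (1 - t) * cmod (f u) powr t"
        by (simp add: powr_add[symmetric])
      also have "\<dots> \<le> K powr (1 - t) * cmod (f u) powr t"
        using fu[OF u] t by (intro mult_right_mono powr_mono2) auto
      finally show ?thesis .
    qed simp
    have holo: "f holomorphic_on ball v (d / 2)"
      using f by (rule holomorphic_on_subset) (use sub S(2) ball_subset_cball in blast)
    have "ennreal (cmod (f v)) \<le> ennreal (16 / (d / 2)\<^sup>2) *
        (\<integral>\<^sup>+w. ennreal (cmod (f w)) * indicator (ball v (d / 2)) w \<partial>lborel)"
      by (rule cmod_le_area_mean[OF holo]) (use d in simp)
    also have "(\<integral>\<^sup>+w. ennreal (cmod (f w)) * indicator (ball v (d / 2)) w \<partial>lborel)
        \<le> (\<integral>\<^sup>+w. ennreal (K powr (1 - t)) * (ennreal (cmod (f w) powr t) * indicator (ball z R) w) \<partial>lborel)"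
    proof (rule nn_integral_mono)
      fix w
      show "ennreal (cmod (f w)) * indicator (ball v (d / 2)) w
          \<le> ennreal (K powr (1 - t)) * (ennreal (cmod (f w) powr t) * indicator (ball z R) w)"
        using fu'[of w] sub
        by (cases "w \<in> ball v (d / 2)") (auto simp: ennreal_mult[symmetric] ennreal_leI subset_iff)
    qed
    also have "\<dots> = ennreal (K powr (1 - t)) *
        (\<integral>\<^sup>+w. ennreal (cmod (f w) powr t) * indicator (ball z R) w \<partial>lborel)"
    proof (rule nn_integral_cmult)
      have "continuous_on (ball z R) (\<lambda>w. cmod (f w) powr t)"
        using t by (intro continuous_on_powr' continuous_intros continuous_on_subset[OF cont]) auto
      then have "(\<lambda>w. ennreal (indicator (ball z R) w *\<^sub>R (cmod (f w) powr t))) \<in> borel_measurable borel"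
        by (intro measurable_compose[OF _ measurable_ennreal] borel_measurable_continuous_on_indicator) auto
      also have "(\<lambda>w. ennreal (indicator (ball z R) w *\<^sub>R (cmod (f w) powr t)))
          = (\<lambda>w. ennreal (cmod (f w) powr t) * indicator (ball z R) w)"
        by (auto simp: indicator_def)
      finally show "(\<lambda>w. ennreal (cmod (f w) powr t) * indicator (ball z R) w) \<in> borel_measurable lborel"
        by simp
    qed
    also have "\<dots> \<le> ennreal (K powr (1 - t)) * ennreal J"
      by (intro mult_left_mono le) auto
    finally have "ennreal (cmod (f v)) \<le> ennreal (16 / (d / 2)\<^sup>2) * (ennreal (K powr (1 - t)) * ennreal J)"
      by (simp add: mult_left_mono)
    then have "ennreal (cmod (f v)) \<le> ennreal (16 / (d / 2)\<^sup>2 * (K powr (1 - t) * J))"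
      using J by (simp add: ennreal_mult[symmetric])
    then have "cmod (f v) \<le> 16 / (d / 2)\<^sup>2 * (K powr (1 - t) * J)"
      using J by (subst (asm) ennreal_le_iff) auto
    then have "d\<^sup>2 * cmod (f v) \<le> 64 * (K powr (1 - t) * J)"
      using d by (simp add: field_simps power2_eq_square)
    also have "K powr (1 - t) = 2 powr (2 / t * (1 - t)) * cmod (f v) powr (1 - t)"
      by (simp add: K_def powr_mult powr_powr)
    finally have *: "d\<^sup>2 * cmod (f v) \<le> 64 * 2 powr (2 / t * (1 - t)) * J * cmod (f v) powr (1 - t)"
      by (simp add: mult_ac)
    have "cmod (f v) = cmod (f v) powr t * cmod (f v) powr (1 - t)"
      using fv by (simp add: powr_add[symmetric])
    with * have "d\<^sup>2 * cmod (f v) powr t * cmod (f v) powr (1 - t)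
        \<le> 64 * 2 powr (2 / t * (1 - t)) * J * cmod (f v) powr (1 - t)"
      by (simp add: mult.assoc)
    then have "d\<^sup>2 * cmod (f v) powr t \<le> 64 * 2 powr (2 / t * (1 - t)) * J"
      using fv by (simp add: mult_le_cancel_right)
    moreover have "N v powr t = d\<^sup>2 * cmod (f v) powr t"
      using d t by (simp add: N_def d_def[symmetric] powr_mult powr_powr)
    ultimately show ?thesis
      using RN by linarith
  qed
qed

section \<open>Canonical products\<close>

text \<open>Normal convergence on compact subsets. The majorant is required only eventually, with a
  threshold depending on r, since finitely many factors may vanish or be far from 1.\<close>

definition normal_product :: "(nat \<Rightarrow> complex \<Rightarrow> complex) \<Rightarrow> bool" where
  "normal_product c \<longleftrightarrow> (\<forall>n. c n holomorphic_on unit_disc) \<and>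
     (\<forall>r<1. \<exists>M. summable M \<and> (\<forall>\<^sub>F n in sequentially. \<forall>z\<in>cball 0 r. cmod (c n z - 1) \<le> M n))"

lemma normal_product_uniform_limit:
  assumes c: "normal_product c" and r: "r < 1"
  shows "uniform_limit (cball 0 r) (\<lambda>N z. \<Prod>n<N. c n z) (\<lambda>z. \<Prod>n. c n z) sequentially"
proof -
  have holo: "c n holomorphic_on unit_disc" for n
    using c by (simp add: normal_product_def)
  obtain M where M: "summable M" "\<forall>\<^sub>F n in sequentially. \<forall>z\<in>cball 0 r. cmod (c n z - 1) \<le> M n"
    using c r by (auto simp: normal_product_def)
  have sub: "cball 0 r \<subseteq> unit_disc"
    using r by auto
  have "uniformly_convergent_on (cball 0 r) (\<lambda>N z. \<Prod>n<N. c n z)"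
  proof (rule uniformly_convergent_on_prod')
    show "continuous_on (cball 0 r) (c n)" for n
      using holo[of n] sub by (meson continuous_on_subset holomorphic_on_imp_continuous_on)
    show "uniformly_convergent_on (cball 0 r) (\<lambda>N z. \<Sum>n<N. norm (c n z - 1))"
      by (rule Weierstrass_m_test'_ev[OF _ M(1)]) (use M(2) in simp)
  qed auto
  then obtain g where g: "uniform_limit (cball 0 r) (\<lambda>N z. \<Prod>n<N. c n z) g sequentially"
    by (auto simp: uniformly_convergent_on_def)
  have "g z = (\<Prod>n. c n z)" if z: "z \<in> cball 0 r" for z
  proof -
    have "abs_convergent_prod (\<lambda>n. c n z)"
      unfolding abs_convergent_prod_conv_summable
      by (rule summable_comparison_test_ev[OF _ M(1)])
         (use M(2) z in \<open>auto elim!: eventually_mono\<close>)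
    \<comment> \<open>This limit concerns the products over n <= N, the uniform limit those over n <
      N; hence the shift by one that follows.\<close>
    then have "(\<lambda>N. \<Prod>n\<le>N. c n z) \<longlonglongrightarrow> (\<Prod>n. c n z)"
      by (intro convergent_prod_LIMSEQ abs_convergent_prod_imp_convergent_prod)
    moreover have "(\<lambda>N. \<Prod>n<Suc N. c n z) \<longlonglongrightarrow> g z"
      using tendsto_uniform_limitI[OF g z] by (rule LIMSEQ_Suc)
    ultimately show ?thesis
      unfolding lessThan_Suc_atMost by (rule LIMSEQ_unique[symmetric])
  qed
  then have "uniform_limit (cball 0 r) (\<lambda>N z. \<Prod>n<N. c n z) g sequentially \<longleftrightarrow> ?thesis"
    by (intro uniform_limit_cong') auto
  with g show ?thesis
    by simp
qed

lemma normal_product_abs_convergent: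
  assumes c: "normal_product c" and z: "z \<in> unit_disc"
  shows "abs_convergent_prod (\<lambda>n. c n z)"
proof -
  obtain M where M: "summable M" "\<forall>\<^sub>F n in sequentially. \<forall>w\<in>cball 0 (cmod z). cmod (c n w - 1) \<le> M n"
    using c z unfolding normal_product_def by auto
  show ?thesis
    unfolding abs_convergent_prod_conv_summable
    by (rule summable_comparison_test_ev[OF _ M(1)])
       (use M(2) in \<open>auto elim!: eventually_mono\<close>)
qed

lemma normal_product_LIMSEQ:
  assumes c: "normal_product c" and z: "z \<in> unit_disc"
  shows "(\<lambda>N. \<Prod>n<N. c n z) \<longlonglongrightarrow> (\<Prod>n. c n z)"
  using tendsto_uniform_limitI[OF normal_product_uniform_limit[OF c, of "cmod z"], of z] z by simp

lemma normal_product_nonzero: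
  assumes c: "normal_product c" and z: "z \<in> unit_disc" and nz: "\<And>n. c n z \<noteq> 0"
  shows "(\<Prod>n. c n z) \<noteq> 0"
  using has_prod_eq_0_iff[OF convergent_prod_has_prod[OF abs_convergent_prod_imp_convergent_prod[OF
      normal_product_abs_convergent[OF c z]]]] nz by auto

lemma ball_0_1_exhaust:
  assumes "z \<in> ball (0::complex) 1"
  obtains r d where "r < 1" "0 < d" "cball z d \<subseteq> cball 0 r"
proof
  show "(1 + cmod z) / 2 < 1" "0 < (1 - cmod z) / 2"
    using assms by auto
  show "cball z ((1 - cmod z) / 2) \<subseteq> cball 0 ((1 + cmod z) / 2)"
  proof
    fix w assume "w \<in> cball z ((1 - cmod z) / 2)"
    then have "cmod (w - z) \<le> (1 - cmod z) / 2"
      by (simp add: dist_norm norm_minus_commute)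
    then have "cmod w \<le> cmod z + (1 - cmod z) / 2"
      using norm_triangle_sub[of w z] by linarith
    also have "\<dots> = (1 + cmod z) / 2"
      by (simp add: field_simps)
    finally show "w \<in> cball 0 ((1 + cmod z) / 2)"
      by simp
  qed
qed

lemma holomorphic_on_disc_uniform_limit:
  assumes holo: "\<And>N. F N holomorphic_on unit_disc"
    and lim: "\<And>r. r < 1 \<Longrightarrow> uniform_limit (cball 0 r) F G sequentially"
  shows "G holomorphic_on unit_disc"
proof (rule holomorphic_uniform_sequence)
  fix z :: complex assume z: "z \<in> unit_disc"
  obtain r d where rd: "r < 1" "0 < d" "cball z d \<subseteq> cball 0 r"
    using ball_0_1_exhaust[OF z] by metis
  have "cball 0 r \<subseteq> unit_disc"
    using rd by auto
  then show "\<exists>d>0. cball z d \<subseteq> unit_disc \<and> uniform_limit (cball z d) F G sequentially"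
    using rd lim[OF rd(1)] by (meson order_trans uniform_limit_on_subset)
qed (use holo in auto)

lemma normal_product_holomorphic:
  assumes c: "normal_product c"
  shows "(\<lambda>z. \<Prod>n. c n z) holomorphic_on unit_disc"
proof (rule holomorphic_on_disc_uniform_limit)
  show "(\<lambda>z. \<Prod>n<N. c n z) holomorphic_on unit_disc" for N
    using c by (intro holomorphic_intros) (simp add: normal_product_def)
qed (rule normal_product_uniform_limit[OF c])

section \<open>A single canonical factor as a perturbed Weierstrass factor of genus one\<close>

definition phase :: "complex \<Rightarrow> complex" where
  "phase a = (if a = 0 then 1 else cnj a / of_real (cmod a))"

text \<open>The Herglotz kernel at cnj a z, scaled. Its real part (1 - |a|^2) (1 - |a z|^2) / (2 |1
  - cnj a z|^2) agrees with - ln |\<phi>_a(z)| up to second order in 1 - |a|, locally uniformly in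
  \<open>z\<close>.\<close>

definition herglotz_term :: "complex \<Rightarrow> complex \<Rightarrow> complex" where
  "herglotz_term a z = of_real ((1 - (cmod a)\<^sup>2) / 2) * ((1 + cnj a * z) / (1 - cnj a * z))"

text \<open>The exponential removes the term of first order in \<open>1 - cmod a\<close>, which leaves
  \<open>1 + O((1 - cmod a)\<^sup>2)\<close> on compact subsets of the disc; the product over a separated sequence
  therefore converges.\<close>

definition canonical_factor :: "complex \<Rightarrow> complex \<Rightarrow> complex" where
  "canonical_factor a z = phase a * disc_involution a z * exp (herglotz_term a z)"

lemma cmod_phase [simp]: "cmod (phase a) = 1"
  by (simp add: phase_def norm_divide)

lemma phase_mult_cmod: "phase a * of_real (cmod a) = cnj a"
  by (simp add: phase_def)

text \<open>This is the purpose of \<open>phase\<close>: as in Blaschke products it makes the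
  involution nonnegative at 0, so that the rotated involution tends to 1 as |a| tends to 1.\<close>

lemma phase_mult_self: "phase a * a = of_real (cmod a)"
  using complex_norm_square[of a] by (auto simp: phase_def power2_eq_square field_simps)

lemma one_minus_cnj_mult_ge:
  assumes "cmod a < 1" "cmod z \<le> r"
  shows "1 - r \<le> cmod (1 - cnj a * z)"
proof -
  have "cmod (cnj a * z) \<le> r"
    using assms mult_mono[of "cmod a" 1 "cmod z" r] by (simp add: norm_mult)
  then show ?thesis
    using norm_triangle_ineq2[of 1 "cnj a * z"] by simp
qed

lemma one_minus_cnj_mult_nonzero:
  assumes "cmod a < 1" "cmod z < 1"
  shows "1 - cnj a * z \<noteq> 0"
  using one_minus_cnj_mult_ge[of a z "cmod z"] assms by auto

text \<open>The rotated involution is 1 - y with y of first order in 1 - |a|, and the Weierstrass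
  factor (1 - y) exp y is 1 + O(y^2). The exponent \<open>herglotz_term\<close> differs from y by a
  term of second order only; it is preferred to y because its prefactor 1 - |a|^2 is the quantity
  that the hypothesis on \<open>b\<close> scales by \<gamma>.\<close>

lemma canonical_factor_eq_weierstrass:
  fixes a z :: complex
  defines "y \<equiv> of_real (1 - cmod a) * (1 + phase a * z) / (1 - cnj a * z)"
  assumes a: "cmod a < 1" and z: "cmod z < 1"
  shows "canonical_factor a z = weierstrass_factor 1 y * exp (herglotz_term a z - y)"
    and "herglotz_term a z - y = - of_real ((1 - cmod a)\<^sup>2) *
      (1 + phase a * z * of_real (2 + cmod a)) / (2 * (1 - cnj a * z))"
proof -
  have nz: "1 - cnj a * z \<noteq> 0"
    by (rule one_minus_cnj_mult_nonzero[OF a z])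
  have "phase a * disc_involution a z = (of_real (cmod a) - phase a * z) / (1 - cnj a * z)"
    by (simp add: disc_involution_def right_diff_distrib phase_mult_self)
  also have "\<dots> = 1 - y"
    using nz by (simp add: y_def field_simps phase_mult_cmod[symmetric])
  finally have "phase a * disc_involution a z = 1 - y" .
  then show "canonical_factor a z = weierstrass_factor 1 y * exp (herglotz_term a z - y)"
    by (simp add: canonical_factor_def weierstrass_factor_def exp_diff)
  have "herglotz_term a z - y = (of_real ((1 - (cmod a)\<^sup>2) / 2) * (1 + cnj a * z)
      - of_real (1 - cmod a) * (1 + phase a * z)) / (1 - cnj a * z)"
    by (simp add: herglotz_term_def y_def diff_divide_distrib)
  also have "of_real ((1 - (cmod a)\<^sup>2) / 2) * (1 + cnj a * z) - of_real (1 - cmod a) * (1 + phase a * z)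
      = - of_real ((1 - cmod a)\<^sup>2) * (1 + phase a * z * of_real (2 + cmod a)) / 2"
    unfolding phase_mult_cmod[symmetric]
    by (simp add: field_simps power2_eq_square)
  finally show "herglotz_term a z - y = - of_real ((1 - cmod a)\<^sup>2) *
      (1 + phase a * z * of_real (2 + cmod a)) / (2 * (1 - cnj a * z))"
    by simp
qed

text \<open>The smallness assumption puts \<open>y\<close> and \<open>w\<close> into the disc of
  radius 1/2, where the quadratic bound for the Weierstrass factor and the linear bound for exp w -
  1 hold. They contribute 3 * 4 * 7/4 = 21 and 3/2 * 2 = 3, together 24.\<close>

lemma canonical_factor_bound:
  assumes a: "cmod a < 1" and z: "cmod z \<le> r" and r: "r < 1"
    and small: "1 - cmod a \<le> (1 - r) / 4"
  shows "cmod (canonical_factor a z - 1) \<le> 24 / (1 - r)\<^sup>2 * (1 - cmod a)\<^sup>2"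
proof -
  define s where "s = 1 - cmod a"
  define y where "y = of_real (1 - cmod a) * (1 + phase a * z) / (1 - cnj a * z)"
  define w where "w = herglotz_term a z - y"
  have z1: "cmod z < 1"
    using z r by linarith
  have s: "0 < s" "s \<le> (1 - r) / 4" "s \<le> 1"
    using a small by (auto simp: s_def)
  have den: "1 - r \<le> cmod (1 - cnj a * z)" "0 < 1 - r"
    using one_minus_cnj_mult_ge[OF a z] r by auto
  have norm_s: "cmod (of_real (1 - cmod a)) = s"
    using s by (simp only: norm_of_real s_def[symmetric])
  have r0: "0 \<le> r"
    using z norm_ge_zero[of z] by linarith
  have "cmod (1 + phase a * z) \<le> 2"
    using norm_triangle_ineq[of 1 "phase a * z"] z1 by (simp add: norm_mult)
  then have "cmod y \<le> s * 2 / (1 - r)"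
    unfolding y_def norm_divide norm_mult norm_s using den s
    by (intro frac_le mult_mono) auto
  then have y: "cmod y \<le> 2 / (1 - r) * s"
    by (simp add: mult_ac)
  also have "\<dots> \<le> 2 / (1 - r) * ((1 - r) / 4)"
    using s den by (intro mult_left_mono) auto
  also have "\<dots> = 1 / 2"
    using den by (simp add: divide_simps)
  finally have y12: "cmod y \<le> 1 / 2" .
  have "cmod (1 + phase a * z * of_real (2 + cmod a)) \<le> 1 + 1 * 3"
  proof -
    have "cmod (phase a * z * of_real (2 + cmod a)) \<le> 1 * 3"
      unfolding norm_mult cmod_phase norm_of_real using z1 a by (intro mult_mono) auto
    then show ?thesis
      using norm_triangle_ineq[of 1 "phase a * z * of_real (2 + cmod a)"] by simp
  qed
  then have w': "cmod w \<le> s\<^sup>2 * 4 / (2 * (1 - r))"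
    unfolding w_def y_def canonical_factor_eq_weierstrass(2)[OF a z1] norm_divide norm_mult
      norm_minus_cancel of_real_power norm_power norm_s
    using den s by (intro frac_le mult_mono) auto
  have "s\<^sup>2 * 4 / (2 * (1 - r)) = 2 / (1 - r) * s\<^sup>2"
    using den by (simp add: divide_simps)
  then have w: "cmod w \<le> 2 / (1 - r) * s\<^sup>2"
    using w' by simp
  also have "2 / (1 - r) * s\<^sup>2 \<le> 2 / (1 - r) * (((1 - r) / 4) * 1)"
    unfolding power2_eq_square using s den by (intro mult_left_mono mult_mono) auto
  also have "\<dots> = 1 / 2"
    using den by (simp add: divide_simps)
  finally have w12: "cmod w \<le> 1 / 2" .
  have W: "cmod (weierstrass_factor 1 y - 1) \<le> 3 * (cmod y)\<^sup>2"
    using weierstrass_factor_bound[OF y12, of 1] by (simp add: power2_eq_square)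
  have E: "cmod (exp w - 1) \<le> 3 / 2 * cmod w"
    by (rule norm_exp_bounds(2)[OF w12])
  then have E': "cmod (exp w) \<le> 7 / 4"
    using norm_triangle_ineq[of "exp w - 1" 1] w12 by simp
  have "canonical_factor a z - 1 = (weierstrass_factor 1 y - 1) * exp w + (exp w - 1)"
    unfolding canonical_factor_eq_weierstrass(1)[OF a z1] w_def y_def by (simp add: algebra_simps)
  then have "cmod (canonical_factor a z - 1)
      \<le> cmod (weierstrass_factor 1 y - 1) * cmod (exp w) + cmod (exp w - 1)"
    by (metis norm_mult norm_triangle_ineq)
  also have "\<dots> \<le> 3 * (cmod y)\<^sup>2 * (7 / 4) + 3 / 2 * cmod w"
    using W E E' by (intro add_mono mult_mono) auto
  also have "\<dots> \<le> 3 * (2 / (1 - r) * s)\<^sup>2 * (7 / 4) + 3 / 2 * (2 / (1 - r) * s\<^sup>2)"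
    using y w by (intro add_mono mult_left_mono mult_right_mono power_mono) auto
  also have "\<dots> = (21 / (1 - r)\<^sup>2 + 3 / (1 - r)) * s\<^sup>2"
    by (simp add: algebra_simps power2_eq_square)
  also have "\<dots> \<le> (21 / (1 - r)\<^sup>2 + 3 / (1 - r)\<^sup>2) * s\<^sup>2"
  proof (intro mult_right_mono add_left_mono divide_left_mono)
    show "(1 - r)\<^sup>2 \<le> 1 - r"
      using r0 den by (simp add: power2_eq_square mult_left_le)
  qed (use den in auto)
  also have "\<dots> = 24 / (1 - r)\<^sup>2 * (1 - cmod a)\<^sup>2"
    by (simp add: s_def add_divide_distrib[symmetric])
  finally show ?thesis .
qed

lemma herglotz_term_holomorphic:
  assumes "cmod a < 1"
  shows "herglotz_term a holomorphic_on unit_disc"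
  unfolding herglotz_term_def using one_minus_cnj_mult_nonzero[OF assms]
  by (intro holomorphic_intros) auto

lemma canonical_factor_holomorphic:
  assumes "cmod a < 1"
  shows "canonical_factor a holomorphic_on unit_disc"
  unfolding canonical_factor_def disc_involution_def
  using one_minus_cnj_mult_nonzero[OF assms] herglotz_term_holomorphic[OF assms]
  by (intro holomorphic_intros) auto

lemma canonical_factor_nonzero:
  assumes "cmod a < 1" "cmod z < 1" "a \<noteq> z"
  shows "canonical_factor a z \<noteq> 0"
proof -
  have "phase a \<noteq> 0"
    by (metis cmod_phase norm_zero zero_neq_one)
  then show ?thesis
    using one_minus_cnj_mult_nonzero[OF assms(1,2)] assms(3)
    by (simp add: canonical_factor_def disc_involution_def)
qed

text \<open>The genus-one substitute for the Blaschke condition, which would ask for summability of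
  1 - |a_n| itself.\<close>

definition square_summable_zeros :: "nat set \<Rightarrow> (nat \<Rightarrow> complex) \<Rightarrow> bool" where
  "square_summable_zeros J a \<longleftrightarrow> (\<forall>n\<in>J. cmod (a n) < 1) \<and>
     summable (\<lambda>n. if n \<in> J then (1 - cmod (a n))\<^sup>2 else 0)"

lemma square_summable_zeros_subset:
  assumes "square_summable_zeros J a" "J' \<subseteq> J"
  shows "square_summable_zeros J' a"
proof -
  have "summable (\<lambda>n. if n \<in> J' then (1 - cmod (a n))\<^sup>2 else 0)"
    by (rule summable_comparison_test'[of "\<lambda>n. if n \<in> J then (1 - cmod (a n))\<^sup>2 else 0" 0])
       (use assms in \<open>auto simp: square_summable_zeros_def\<close>)
  then show ?thesis
    using assms by (auto simp: square_summable_zeros_def)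
qed

lemma square_summable_zeros_eventually:
  assumes J: "square_summable_zeros J a" and e: "0 < e"
  shows "\<forall>\<^sub>F n in sequentially. n \<in> J \<longrightarrow> 1 - cmod (a n) \<le> e"
proof -
  have "(\<lambda>n. if n \<in> J then (1 - cmod (a n))\<^sup>2 else 0) \<longlonglongrightarrow> 0"
    using J unfolding square_summable_zeros_def by (intro summable_LIMSEQ_zero) auto
  then have "\<forall>\<^sub>F n in sequentially. (if n \<in> J then (1 - cmod (a n))\<^sup>2 else 0) < e\<^sup>2"
    using e by (intro order_tendstoD) auto
  then show ?thesis
  proof eventually_elim
    case (elim n)
    then show ?case
      using e power_less_imp_less_base[of "1 - cmod (a n)" 2 e] by auto
  qed
qed

lemma square_summable_zeros_finite:
  assumes J: "square_summable_zeros J a" and w: "cmod w < 1"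
  shows "finite {n\<in>J. a n = w}"
proof -
  obtain N where N: "\<And>n. n \<ge> N \<Longrightarrow> n \<in> J \<Longrightarrow> 1 - cmod (a n) \<le> (1 - cmod w) / 2"
    using square_summable_zeros_eventually[OF J, of "(1 - cmod w) / 2"] w
    by (auto simp: eventually_sequentially)
  have "n < N" if "n \<in> J" "a n = w" for n
  proof (rule ccontr)
    assume "\<not> n < N"
    then show False
      using N[of n] that w by simp
  qed
  then have "{n\<in>J. a n = w} \<subseteq> {..<N}"
    by auto
  then show ?thesis
    using finite_subset by blast
qed

text \<open>The value 1 off \<open>J\<close> treats finite and infinite \<open>J\<close> alike and
  lets products over \<open>J\<close> and \<open>J - A\<close> be compared index by index.\<close>

definition canonical_seq :: "nat set \<Rightarrow> (nat \<Rightarrow> complex) \<Rightarrow> nat \<Rightarrow> complex \<Rightarrow> complex" where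
  "canonical_seq J a n z = (if n \<in> J then canonical_factor (a n) z else 1)"

definition canonical_product :: "nat set \<Rightarrow> (nat \<Rightarrow> complex) \<Rightarrow> complex \<Rightarrow> complex" where
  "canonical_product J a z = (\<Prod>n. canonical_seq J a n z)"

lemma normal_canonical_seq:
  assumes J: "square_summable_zeros J a"
  shows "normal_product (canonical_seq J a)"
  unfolding normal_product_def
proof (intro conjI allI impI)
  show "canonical_seq J a n holomorphic_on unit_disc" for n
    using J unfolding canonical_seq_def square_summable_zeros_def
    by (cases "n \<in> J") (auto intro: canonical_factor_holomorphic)
next
  fix r :: real assume r: "r < 1"
  let ?M = "\<lambda>n. 24 / (1 - r)\<^sup>2 * (if n \<in> J then (1 - cmod (a n))\<^sup>2 else 0)"
  have "\<forall>\<^sub>F n in sequentially. \<forall>z\<in>cball 0 r. cmod (canonical_seq J a n z - 1) \<le> ?M n"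
    using square_summable_zeros_eventually[OF J, of "(1 - r) / 4"] r
    by (auto elim!: eventually_mono simp: canonical_seq_def)
       (use J canonical_factor_bound in \<open>force simp: square_summable_zeros_def\<close>)
  moreover have "summable ?M"
    using J by (intro summable_mult) (simp add: square_summable_zeros_def)
  ultimately show "\<exists>M. summable M \<and>
      (\<forall>\<^sub>F n in sequentially. \<forall>z\<in>cball 0 r. cmod (canonical_seq J a n z - 1) \<le> M n)"
    by blast
qed

lemma canonical_product_LIMSEQ:
  assumes "square_summable_zeros J a" "z \<in> unit_disc"
  shows "(\<lambda>N. \<Prod>n<N. canonical_seq J a n z) \<longlonglongrightarrow> canonical_product J a z"
  unfolding canonical_product_def by (intro normal_product_LIMSEQ normal_canonical_seq assms)

lemma canonical_product_holomorphic:
  assumes "square_summable_zeros J a"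
  shows "canonical_product J a holomorphic_on unit_disc"
  using normal_product_holomorphic[OF normal_canonical_seq[OF assms]]
  by (simp add: canonical_product_def[abs_def])

lemma canonical_product_nonzero:
  assumes "square_summable_zeros J a" "z \<in> unit_disc" "\<And>n. n \<in> J \<Longrightarrow> a n \<noteq> z"
  shows "canonical_product J a z \<noteq> 0"
  unfolding canonical_product_def
proof (rule normal_product_nonzero[OF normal_canonical_seq])
  show "canonical_seq J a n z \<noteq> 0" for n
    using assms canonical_factor_nonzero[of "a n" z]
    by (auto simp: canonical_seq_def square_summable_zeros_def)
qed (use assms in auto)

text \<open>Needed in two places: to isolate the factors that vanish at a given point when its order
  is computed, and to remove the zeros close to \<open>z\<close> before the maximum principle.
  Partial products that contain \<open>A\<close> factor in this way, and the limit inherits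
  it.\<close>

lemma canonical_product_split:
  assumes J: "square_summable_zeros J a" and z: "z \<in> unit_disc" and A: "finite A" "A \<subseteq> J"
  shows "canonical_product J a z = (\<Prod>n\<in>A. canonical_factor (a n) z) * canonical_product (J - A) a z"
proof -
  have J': "square_summable_zeros (J - A) a"
    using J by (rule square_summable_zeros_subset) auto
  obtain N where N: "A \<subseteq> {..<N}"
    using A(1) finite_nat_iff_bounded by auto
  have eq: "(\<Prod>n<k. canonical_seq J a n z)
      = (\<Prod>n\<in>A. canonical_factor (a n) z) * (\<Prod>n<k. canonical_seq (J - A) a n z)" if k: "k \<ge> N" for k
  proof -
    have Ak: "{..<k} = A \<union> ({..<k} - A)"
      using N k by auto
    have "(\<Prod>n<k. canonical_seq J' a n z)
        = (\<Prod>n\<in>A. canonical_seq J' a n z) * (\<Prod>n\<in>{..<k} - A. canonical_seq J' a n z)" for J'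
      by (subst Ak, subst prod.union_disjoint) (use A in auto)
    note split = this
    have "(\<Prod>n\<in>A. canonical_seq J a n z) = (\<Prod>n\<in>A. canonical_factor (a n) z)"
      using A by (intro prod.cong) (auto simp: canonical_seq_def)
    moreover have "(\<Prod>n\<in>A. canonical_seq (J - A) a n z) = 1"
      by (intro prod.neutral) (auto simp: canonical_seq_def)
    moreover have "(\<Prod>n\<in>{..<k} - A. canonical_seq (J - A) a n z) = (\<Prod>n\<in>{..<k} - A. canonical_seq J a n z)"
      by (intro prod.cong) (auto simp: canonical_seq_def)
    ultimately show ?thesis
      using split[of J] split[of "J - A"] by simp
  qed
  have "(\<lambda>k. (\<Prod>n\<in>A. canonical_factor (a n) z) * (\<Prod>n<k. canonical_seq (J - A) a n z))
      \<longlonglongrightarrow> (\<Prod>n\<in>A. canonical_factor (a n) z) * canonical_product (J - A) a z"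
    by (intro tendsto_intros canonical_product_LIMSEQ J' z)
  then have "(\<lambda>k. \<Prod>n<k. canonical_seq J a n z)
      \<longlonglongrightarrow> (\<Prod>n\<in>A. canonical_factor (a n) z) * canonical_product (J - A) a z"
    by (rule Lim_transform_eventually) (rule eventually_sequentiallyI[of N], simp add: eq)
  with canonical_product_LIMSEQ[OF J z] show ?thesis
    by (rule LIMSEQ_unique)
qed

lemma zorder_canonical_product:
  assumes J: "square_summable_zeros J a" and w: "w \<in> unit_disc"
  shows "zorder (canonical_product J a) w = int (card {n\<in>J. a n = w})"
proof -
  define S where "S = {n\<in>J. a n = w}"
  have w1: "cmod w < 1"
    using w by simp
  have S: "finite S" "S \<subseteq> J"
    using square_summable_zeros_finite[OF J] w by (auto simp: S_def)
  have J': "square_summable_zeros (J - S) a"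
    using J by (rule square_summable_zeros_subset) auto
  \<comment> \<open>The cofactor of z - w in \<open>canonical_factor w z\<close>; it has no zero at
    \<open>w\<close>.\<close>
  define h where "h z = - phase w / (1 - cnj w * z) * exp (herglotz_term w z)" for z
  define g where "g z = h z ^ card S * canonical_product (J - S) a z" for z
  have "h holomorphic_on unit_disc"
    unfolding h_def using one_minus_cnj_mult_nonzero[OF w1] herglotz_term_holomorphic[OF w1]
    by (intro holomorphic_intros) auto
  then have g: "g holomorphic_on unit_disc"
    unfolding g_def by (intro holomorphic_intros canonical_product_holomorphic J')
  have "phase w \<noteq> 0"
    by (metis cmod_phase norm_zero zero_neq_one)
  then have "h w \<noteq> 0"
    using one_minus_cnj_mult_nonzero[OF w1 w1] by (simp add: h_def)
  moreover have "canonical_product (J - S) a w \<noteq> 0"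
    by (rule canonical_product_nonzero[OF J' w]) (auto simp: S_def)
  ultimately have gw: "g w \<noteq> 0"
    by (simp add: g_def)
  have "canonical_product J a z = g z * (z - w) powi int (card S)" if z: "z \<in> unit_disc" "z \<noteq> w" for z
  proof -
    have "canonical_product J a z = (\<Prod>n\<in>S. canonical_factor (a n) z) * canonical_product (J - S) a z"
      by (rule canonical_product_split[OF J z(1) S])
    also have "(\<Prod>n\<in>S. canonical_factor (a n) z) = (\<Prod>n\<in>S. canonical_factor w z)"
      by (intro prod.cong) (auto simp: S_def)
    also have "canonical_factor w z = h z * (z - w)"
      using one_minus_cnj_mult_nonzero[OF w1, of z] z
      by (simp add: canonical_factor_def h_def disc_involution_def field_simps)
    finally show ?thesis
      by (simp add: g_def power_mult_distrib)
  qed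
  then have "zorder (canonical_product J a) w = int (card S)"
    by (intro zorder_eqI[OF _ w g gw]) auto
  then show ?thesis
    by (simp add: S_def)
qed

section \<open>Perturbation of the zeros\<close>

text \<open>At z = 0 the kernel reduces to (1 - |a|^2)^2, so the uniform bound contains square
  summability.\<close>

lemma square_summable_zeros_of_kernel_bound:
  assumes disc: "\<And>n. n \<in> I \<Longrightarrow> cmod (a n) < 1"
    and C: "\<And>A z. \<lbrakk>finite A; A \<subseteq> I; z \<in> unit_disc\<rbrakk> \<Longrightarrow> (\<Sum>n\<in>A. sep_kernel (a n) z) \<le> C"
  shows "square_summable_zeros I a"
  unfolding square_summable_zeros_def
proof (intro conjI ballI)
  show "summable (\<lambda>n. if n \<in> I then (1 - cmod (a n))\<^sup>2 else 0)"
  proof (rule summableI_nonneg_bounded)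
    fix N :: nat
    have "(\<Sum>n<N. if n \<in> I then (1 - cmod (a n))\<^sup>2 else 0) = (\<Sum>n\<in>{n\<in>{..<N}. n \<in> I}. (1 - cmod (a n))\<^sup>2)"
      by (rule sum.inter_filter[symmetric]) simp
    also have "\<dots> \<le> (\<Sum>n\<in>{n\<in>{..<N}. n \<in> I}. sep_kernel (a n) 0)"
    proof (rule sum_mono)
      fix n assume "n \<in> {n\<in>{..<N}. n \<in> I}"
      then have "cmod (a n) < 1"
        using disc by auto
      then show "(1 - cmod (a n))\<^sup>2 \<le> sep_kernel (a n) 0"
        unfolding sep_kernel_def using one_minus_sq_bounds[of "cmod (a n)"]
        by (auto intro!: power_mono)
    qed
    also have "\<dots> \<le> C"
      by (rule C) auto
    finally show "(\<Sum>n<N. if n \<in> I then (1 - cmod (a n))\<^sup>2 else 0) \<le> C" .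
  qed auto
qed (use disc in auto)

lemma holomorphic_eq_0_iff_zorder:
  assumes "f holomorphic_on unit_disc" "\<exists>z\<in>unit_disc. f z \<noteq> 0" "z \<in> unit_disc"
  shows "f z = 0 \<longleftrightarrow> zorder f z \<noteq> 0"
proof -
  obtain \<beta> where \<beta>: "\<beta> \<in> unit_disc" "f \<beta> \<noteq> 0"
    using assms by blast
  have "\<forall>\<^sub>F w in at z. f w \<noteq> 0 \<and> w \<in> unit_disc"
    by (rule non_zero_neighbour_alt[OF assms(1) _ _ assms(3) \<beta>]) auto
  then have "\<exists>\<^sub>F w in at z. f w \<noteq> 0"
    by (intro eventually_frequently) (auto elim: eventually_mono)
  moreover have "f analytic_on {z}"
    using assms analytic_at[of f z] open_ball by blast
  ultimately show ?thesis
    using zorder_eq_0_iff by blast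
qed

text \<open>A countable family of zeros cannot fill the disc.\<close>

lemma canonical_product_not_all_zero:
  assumes "square_summable_zeros J a"
  shows "\<exists>z\<in>unit_disc. canonical_product J a z \<noteq> 0"
proof -
  have "\<not> unit_disc \<subseteq> range a"
    using uncountable_ball[of 1 "0::complex"] countable_subset by auto
  then obtain z where z: "z \<in> unit_disc" "z \<notin> range a"
    by blast
  then have "canonical_product J a z \<noteq> 0"
    by (intro canonical_product_nonzero[OF assms]) auto
  with z show ?thesis
    by blast
qed

lemma factor_canonical_product:
  assumes f: "f holomorphic_on unit_disc" "\<exists>z\<in>unit_disc. f z \<noteq> 0"
    and zeros: "zero_sequence_of f I a" and I: "square_summable_zeros I a"
  obtains g where "g holomorphic_on unit_disc"
    "\<And>z. z \<in> unit_disc \<Longrightarrow> f z = exp (g z) * canonical_product I a z"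
proof -
  have zorder: "zorder (canonical_product I a) z = zorder f z" if "z \<in> unit_disc" for z
    using zeros that zorder_canonical_product[OF I that] by (simp add: zero_sequence_of_def)
  have zero: "canonical_product I a z = 0 \<longleftrightarrow> f z = 0" if "z \<in> unit_disc" for z
    using zorder[OF that] holomorphic_eq_0_iff_zorder[OF f that]
      holomorphic_eq_0_iff_zorder[OF canonical_product_holomorphic[OF I]
        canonical_product_not_all_zero[OF I] that]
    by simp
  obtain h where h: "h holomorphic_on unit_disc" "\<And>z. z \<in> unit_disc \<Longrightarrow> h z \<noteq> 0"
    "\<And>z. z \<in> unit_disc \<Longrightarrow> f z = h z * canonical_product I a z"
    using holomorphic_zorder_factorization[OF f(1) open_ball connected_ball
        canonical_product_holomorphic[OF I] zero zorder] by blast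
  have "(0::complex) \<in> unit_disc"
    by simp
  then obtain g where "g holomorphic_on unit_disc" "\<And>z. z \<in> unit_disc \<Longrightarrow> exp (g z) = h z"
    using holomorphic_logarithm_exists[OF convex_ball open_ball h(1,2)] by blast
  then show ?thesis
    using h(3) by (intro that[of g]) simp_all
qed

text \<open>The correction for the exponentials of the canonical factors: multiplied by its
  exponential, the quotient of |canonical_factor b| by |canonical_factor a|^\<gamma> becomes
  |\<phi>_b| / |\<phi>_a|^\<gamma> exactly. The difference is formed termwise because the two series
  need not converge separately.\<close>

definition herglotz_diff :: "real \<Rightarrow> nat set \<Rightarrow> (nat \<Rightarrow> complex) \<Rightarrow> (nat \<Rightarrow> complex) \<Rightarrow> nat \<Rightarrow> complex \<Rightarrow> complex"
  where "herglotz_diff \<gamma> I a b n z =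
    (if n \<in> I then of_real \<gamma> * herglotz_term (a n) z - herglotz_term (b n) z else 0)"

text \<open>By the hypothesis on \<open>b\<close> both terms share the prefactor \<gamma> (1 -
  |a|^2) / 2. The difference of the remaining kernels is proportional to cnj (a - b), which supplies
  the second factor 1 - |a|^2.\<close>

lemma herglotz_term_diff_le:
  assumes a: "cmod a < 1" and b: "cmod b < 1"
    and \<gamma>: "1 - (cmod b)\<^sup>2 = \<gamma> * (1 - (cmod a)\<^sup>2)" "0 \<le> \<gamma>"
    and \<kappa>: "cmod (a - b) \<le> \<kappa> * (1 - (cmod a)\<^sup>2)" and z: "cmod z \<le> r" and r: "r < 1"
  shows "cmod (of_real \<gamma> * herglotz_term a z - herglotz_term b z)
    \<le> 4 * \<gamma> * \<kappa> / (1 - r)\<^sup>2 * (1 - cmod a)\<^sup>2"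
proof -
  have z1: "cmod z < 1"
    using z r by linarith
  have nz: "1 - cnj a * z \<noteq> 0" "1 - cnj b * z \<noteq> 0"
    using one_minus_cnj_mult_nonzero a b z1 by auto
  have den: "1 - r \<le> cmod (1 - cnj a * z)" "1 - r \<le> cmod (1 - cnj b * z)"
    using one_minus_cnj_mult_ge a b z by auto
  have "0 < 1 - (cmod a)\<^sup>2"
    using one_minus_sq_pos[OF a] .
  moreover have "0 \<le> \<kappa> * (1 - (cmod a)\<^sup>2)"
    using \<kappa> norm_ge_zero[of "a - b"] by linarith
  ultimately have \<kappa>0: "0 \<le> \<kappa>"
    by (simp add: zero_le_mult_iff)
  have "of_real \<gamma> * herglotz_term a z - herglotz_term b z
      = of_real (\<gamma> * (1 - (cmod a)\<^sup>2) / 2) *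
          ((1 + cnj a * z) / (1 - cnj a * z) - (1 + cnj b * z) / (1 - cnj b * z))"
    unfolding herglotz_term_def \<gamma> by (simp add: algebra_simps)
  also have "(1 + cnj a * z) / (1 - cnj a * z) - (1 + cnj b * z) / (1 - cnj b * z)
      = 2 * (cnj (a - b) * z) / ((1 - cnj a * z) * (1 - cnj b * z))"
    using nz by (simp add: divide_simps) (simp add: algebra_simps)
  finally have "cmod (of_real \<gamma> * herglotz_term a z - herglotz_term b z)
      = \<gamma> * (1 - (cmod a)\<^sup>2) / 2 * (2 * (cmod (a - b) * cmod z)
        / (cmod (1 - cnj a * z) * cmod (1 - cnj b * z)))"
    using \<gamma> one_minus_sq_pos[OF a] by (simp only: norm_mult norm_divide norm_of_real complex_mod_cnj) simp
  also have "\<dots> \<le> \<gamma> * (1 - (cmod a)\<^sup>2) / 2 * (2 * (\<kappa> * (1 - (cmod a)\<^sup>2) * 1) / ((1 - r) * (1 - r)))"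
    using \<gamma> one_minus_sq_pos[OF a] den r z1 \<kappa> \<kappa>0
    by (intro mult_left_mono frac_le mult_mono mult_nonneg_nonneg mult_pos_pos) auto
  also have "\<dots> = \<gamma> * \<kappa> / (1 - r)\<^sup>2 * (1 - (cmod a)\<^sup>2)\<^sup>2"
    by (simp add: power2_eq_square)
  also have "\<dots> \<le> \<gamma> * \<kappa> / (1 - r)\<^sup>2 * (2 * (1 - cmod a))\<^sup>2"
    using \<gamma> \<kappa>0 one_minus_sq_bounds[of "cmod a"] one_minus_sq_pos[OF a] a
    by (intro mult_left_mono power_mono) auto
  also have "\<dots> = 4 * \<gamma> * \<kappa> / (1 - r)\<^sup>2 * (1 - cmod a)\<^sup>2"
    by (simp only: power_mult_distrib) simp
  finally show ?thesis .
qed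

lemma herglotz_diff_uniform_limit:
  assumes I: "square_summable_zeros I a" and b: "\<And>n. n \<in> I \<Longrightarrow> cmod (b n) < 1"
    and \<gamma>: "\<And>n. n \<in> I \<Longrightarrow> 1 - (cmod (b n))\<^sup>2 = \<gamma> * (1 - (cmod (a n))\<^sup>2)" "0 \<le> \<gamma>"
    and \<kappa>: "\<And>n. n \<in> I \<Longrightarrow> cmod (a n - b n) \<le> \<kappa> * (1 - (cmod (a n))\<^sup>2)" and r: "r < 1"
  shows "uniform_limit (cball 0 r) (\<lambda>N z. \<Sum>n<N. herglotz_diff \<gamma> I a b n z)
    (\<lambda>z. \<Sum>n. herglotz_diff \<gamma> I a b n z) sequentially"
proof (rule Weierstrass_m_test)
  let ?M = "\<lambda>n. 4 * \<gamma> * \<kappa> / (1 - r)\<^sup>2 * (if n \<in> I then (1 - cmod (a n))\<^sup>2 else 0)"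
  show "summable ?M"
    using I by (intro summable_mult) (simp add: square_summable_zeros_def)
  show "cmod (herglotz_diff \<gamma> I a b n z) \<le> ?M n" if "z \<in> cball 0 r" for n z
    using I that b \<gamma> \<kappa> r herglotz_term_diff_le[of "a n" "b n" \<gamma> \<kappa> z r]
    by (auto simp: herglotz_diff_def square_summable_zeros_def)
qed

text \<open>At each \<open>z\<close>, |F(z)| is first compared with |H(z)|^\<gamma>, where
  \<open>H\<close> is \<open>f\<close> without the zeros close to \<open>z\<close>; then |H(z)| is
  at most the maximum of |H| on a circle that avoids these zeros, and there |H| is a bounded
  multiple of |f|. The constant does not depend on \<open>z\<close> because the number of removed
  zeros is bounded by \<open>M\<close>.\<close>

lemma perturbed_zeros_function:
  assumes f: "f holomorphic_on unit_disc" "\<exists>z\<in>unit_disc. f z \<noteq> 0"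
    and zeros: "zero_sequence_of f I a" and sep: "finite_union_of_separated I a"
    and \<gamma>: "0 < \<gamma>" "\<gamma> < 1" and b: "\<And>n. n \<in> I \<Longrightarrow> cmod (b n) < 1"
    and ab: "\<And>n. n \<in> I \<Longrightarrow> 1 - (cmod (b n))\<^sup>2 = \<gamma> * (1 - (cmod (a n))\<^sup>2)"
    and \<delta>: "\<And>n. n \<in> I \<Longrightarrow> pseudohyperbolic_dist (a n) (b n) \<le> \<delta>" "\<delta> < 1"
  obtains F C where "F holomorphic_on unit_disc" "\<exists>z\<in>unit_disc. F z \<noteq> 0" "zero_sequence_of F I b"
    "\<And>z. z \<in> unit_disc \<Longrightarrow> \<exists>u. cmod (u - z) = (1 - cmod z) / 8 \<and> cmod (F z) \<le> C * cmod (f u) powr \<gamma>"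
proof -
  obtain C0 where C0: "\<And>A z. \<lbrakk>finite A; A \<subseteq> I; z \<in> unit_disc\<rbrakk> \<Longrightarrow> (\<Sum>n\<in>A. sep_kernel (a n) z) \<le> C0"
    using finite_union_sum_kernel_le[OF sep] by blast
  have a: "cmod (a n) < 1" if "n \<in> I" for n
    using zeros that by (auto simp: zero_sequence_of_def)
  have Ia: "square_summable_zeros I a"
    using a C0 by (rule square_summable_zeros_of_kernel_bound)
  have Ib: "square_summable_zeros I b"
    unfolding square_summable_zeros_def
  proof (intro conjI ballI)
    show "summable (\<lambda>n. if n \<in> I then (1 - cmod (b n))\<^sup>2 else 0)"
    proof (rule summable_comparison_test')
      show "summable (\<lambda>n. 4 * (if n \<in> I then (1 - cmod (a n))\<^sup>2 else 0))"
        using Ia by (intro summable_mult) (simp add: square_summable_zeros_def)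
      fix n :: nat
      have "(1 - cmod (b n))\<^sup>2 \<le> (2 * (1 - cmod (a n)))\<^sup>2" if n: "n \<in> I"
      proof (rule power_mono)
        have "1 - cmod (b n) \<le> \<gamma> * (1 - (cmod (a n))\<^sup>2)"
          using ab[OF n] b[OF n] one_minus_sq_bounds[of "cmod (b n)"] by simp
        also have "\<dots> \<le> 1 * (1 - (cmod (a n))\<^sup>2)"
          using \<gamma> one_minus_sq_pos[OF a[OF n]] by (intro mult_right_mono) auto
        finally show "1 - cmod (b n) \<le> 2 * (1 - cmod (a n))"
          using a[OF n] one_minus_sq_bounds[of "cmod (a n)"] by simp
      qed (use b[OF n] in auto)
      also have "(2 * (1 - cmod (a n)))\<^sup>2 = 4 * (1 - cmod (a n))\<^sup>2"
        by (simp only: power_mult_distrib) simp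
      finally show "norm (if n \<in> I then (1 - cmod (b n))\<^sup>2 else 0)
          \<le> 4 * (if n \<in> I then (1 - cmod (a n))\<^sup>2 else 0)"
        by auto
    qed
  qed (use b in auto)
  define \<kappa> where "\<kappa> = sqrt (\<gamma> / (1 - \<delta>\<^sup>2))"
  have \<kappa>: "cmod (a n - b n) \<le> \<kappa> * (1 - (cmod (a n))\<^sup>2)" if "n \<in> I" for n
    unfolding \<kappa>_def by (rule dist_le_of_pseudohyperbolic_dist_le) (use a b ab \<delta> that in auto)
  define u where "u z = (\<Sum>n. herglotz_diff \<gamma> I a b n z)" for z
  have u_lim: "uniform_limit (cball 0 r) (\<lambda>N z. \<Sum>n<N. herglotz_diff \<gamma> I a b n z) u sequentially"
    if "r < 1" for r
    using herglotz_diff_uniform_limit[OF Ia b ab _ \<kappa> that] \<gamma> by (simp add: u_def[abs_def])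
  have u_holo: "u holomorphic_on unit_disc"
  proof (rule holomorphic_on_disc_uniform_limit[OF _ u_lim])
    have "herglotz_diff \<gamma> I a b n holomorphic_on unit_disc" for n
      unfolding herglotz_diff_def using a b herglotz_term_holomorphic
      by (cases "n \<in> I") (auto intro!: holomorphic_intros)
    then show "(\<lambda>z. \<Sum>n<N. herglotz_diff \<gamma> I a b n z) holomorphic_on unit_disc" for N
      by (intro holomorphic_intros)
  qed
  obtain g where g: "g holomorphic_on unit_disc"
    "\<And>z. z \<in> unit_disc \<Longrightarrow> f z = exp (g z) * canonical_product I a z"
    using factor_canonical_product[OF f zeros Ia] by blast
  \<comment> \<open>\<open>E\<close> is chosen such that \<open>\<bar>F\<bar>\<close> is \<open>\<bar>f\<bar> powr \<gamma>\<close> times the product of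
    \<open>pseudohyperbolic_dist (b n) z / pseudohyperbolic_dist (a n) z powr \<gamma>\<close>.\<close>
  define E where "E z = exp (u z + of_real \<gamma> * g z)" for z
  define F where "F z = E z * canonical_product I b z" for z
  have E: "E holomorphic_on unit_disc"
    unfolding E_def by (intro holomorphic_intros u_holo g)
  have F: "F holomorphic_on unit_disc"
    unfolding F_def by (intro holomorphic_intros E canonical_product_holomorphic Ib)
  have Fnz: "\<exists>z\<in>unit_disc. F z \<noteq> 0"
    using canonical_product_not_all_zero[OF Ib] by (auto simp: F_def E_def)
  have "zorder F w = int (card {n\<in>I. b n = w})" if w: "w \<in> unit_disc" for w
  proof -
    have an: "E analytic_on {w}" "canonical_product I b analytic_on {w}"
      using E canonical_product_holomorphic[OF Ib] w open_ball by (meson analytic_at)+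
    obtain \<beta> where \<beta>: "\<beta> \<in> unit_disc" "F \<beta> \<noteq> 0"
      using Fnz by blast
    have "\<forall>\<^sub>F z in at w. F z \<noteq> 0 \<and> z \<in> unit_disc"
      by (rule non_zero_neighbour_alt[OF F _ _ w \<beta>]) auto
    then have "\<forall>\<^sub>F z in at w. E z * canonical_product I b z \<noteq> 0"
      by (auto elim!: eventually_mono simp: F_def)
    then have "zorder F w = zorder E w + zorder (canonical_product I b) w"
      unfolding F_def[abs_def] by (rule zorder_times_analytic[OF an])
    moreover have "zorder E w = 0"
      by (rule zorder_eq_0I[OF an(1)]) (simp add: E_def)
    ultimately show ?thesis
      by (simp add: zorder_canonical_product[OF Ib w])
  qed
  then have F_zeros: "zero_sequence_of F I b"
    using b square_summable_zeros_finite[OF Ib] by (auto simp: zero_sequence_of_def)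
  \<comment> \<open>The threshold 1/40 is that of \<open>pseudohyperbolic_near_circle\<close>:
    beyond it factors are compared one by one, below it the maximum principle takes over.\<close>
  obtain K where K: "\<And>a b z. \<lbrakk>cmod a < 1; cmod b < 1; cmod z < 1; 1 - (cmod b)\<^sup>2 = \<gamma> * (1 - (cmod a)\<^sup>2);
      pseudohyperbolic_dist a b \<le> \<delta>; 1 / 40 \<le> pseudohyperbolic_dist a z\<rbrakk> \<Longrightarrow>
      pseudohyperbolic_dist b z \<le> exp (K * sep_kernel a z) * pseudohyperbolic_dist a z powr \<gamma>"
    using involution_quotient_bound[OF \<gamma> \<delta>(2), of "1 / 40"] by auto
  define K' where "K' = max K 0"
  \<comment> \<open>A zero with \<rho> < 1/40 has (1 - \<rho>^2)^2 >= 1/4 and so contributes at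
    least 1/8 to the kernel sum, which is at most \<open>C0\<close>.\<close>
  define M where "M = nat \<lceil>8 * C0\<rceil>"
  define C where "C = exp (K' * C0) * (48 ^ M) powr \<gamma>"
  have bound: "\<exists>v. cmod (v - z) = (1 - cmod z) / 8 \<and> cmod (F z) \<le> C * cmod (f v) powr \<gamma>"
    if z: "z \<in> unit_disc" for z
  proof -
    have z1: "cmod z < 1"
      using z by simp
    define A where "A = {n\<in>I. pseudohyperbolic_dist (a n) z < 1 / 40}"
    \<comment> \<open>\<open>A\<close> is not yet known to be finite, so its finite subsets are
      counted.\<close>
    have "card G \<le> M" if G: "G \<subseteq> A" "finite G" for G
    proof -
      have "real (card G) * (1 / 8) = (\<Sum>n\<in>G. 1 / 8)"
        by simp
      also have "\<dots> \<le> (\<Sum>n\<in>G. sep_kernel (a n) z)"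
      proof (rule sum_mono)
        fix n assume "n \<in> G"
        then have n: "n \<in> I" "pseudohyperbolic_dist (a n) z < 1 / 40"
          using G by (auto simp: A_def)
        have "(pseudohyperbolic_dist (a n) z)\<^sup>2 \<le> (1 / 40)\<^sup>2"
          using n by (intro power_mono) (auto simp: pseudohyperbolic_dist_def)
        then have "1 / 2 \<le> 1 - (pseudohyperbolic_dist (a n) z)\<^sup>2"
          by (simp add: power2_eq_square)
        then have "(1 / 2)\<^sup>2 \<le> (1 - (pseudohyperbolic_dist (a n) z)\<^sup>2)\<^sup>2"
          by (intro power_mono) auto
        then show "1 / 8 \<le> sep_kernel (a n) z"
          using sep_kernel_ge_dist[OF a[OF n(1)] z1] by (simp add: power2_eq_square)
      qed
      also have "\<dots> \<le> C0"
        using G z by (intro C0) (auto simp: A_def)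
      finally have "real (card G) \<le> 8 * C0"
        by simp
      then show ?thesis
        unfolding M_def by linarith
    qed
    then have A: "finite A" "card A \<le> M"
      using finite_if_finite_subsets_card_bdd[of A M] by auto
    have AI: "A \<subseteq> I"
      by (auto simp: A_def)
    have IA: "square_summable_zeros (I - A) a"
      using Ia by (rule square_summable_zeros_subset) auto
    \<comment> \<open>\<open>H\<close> is \<open>f\<close> with the zeros close to \<open>z\<close> divided out.\<close>
    define H where "H w = canonical_product (I - A) a w *
      (\<Prod>n\<in>A. phase (a n) * exp (herglotz_term (a n) w)) * exp (g w)" for w
    have H: "H holomorphic_on unit_disc"
      unfolding H_def using a AI
      by (intro holomorphic_intros canonical_product_holomorphic IA g herglotz_term_holomorphic) auto
    have f_eq: "f w = H w * (\<Prod>n\<in>A. disc_involution (a n) w)" if "w \<in> unit_disc" for w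
      unfolding g(2)[OF that] canonical_product_split[OF Ia that A(1) AI] H_def canonical_factor_def
      by (simp add: prod.distrib)
    have FH: "cmod (F z) \<le> exp (K' * C0) * cmod (H z) powr \<gamma>"
    proof -
      \<comment> \<open>\<open>d n\<close> is the share of a close zero that \<open>H\<close>
        retains: the exponential without the involution. \<open>e n\<close> collects the cost of
        exchanging a distant zero.\<close>
      define d where "d n = (if n \<in> A then exp (\<gamma> * Re (herglotz_term (a n) z)) else 1)" for n
      define e where "e n = (if n \<in> I - A then exp (K' * sep_kernel (a n) z) else 1)" for n
      have factor: "cmod (canonical_seq I b n z) * exp (Re (herglotz_diff \<gamma> I a b n z))
          \<le> e n * cmod (canonical_seq (I - A) a n z) powr \<gamma> * d n" for n
      proof (cases "n \<in> I")
        case False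
        then show ?thesis
          using AI by (auto simp: canonical_seq_def herglotz_diff_def e_def d_def)
      next
        case True
        have "cmod (canonical_seq I b n z) * exp (Re (herglotz_diff \<gamma> I a b n z))
            = pseudohyperbolic_dist (b n) z * exp (\<gamma> * Re (herglotz_term (a n) z))"
          using True by (simp add: canonical_seq_def canonical_factor_def herglotz_diff_def
              norm_mult pseudohyperbolic_dist_def exp_diff)
        also have "\<dots> \<le> e n * cmod (canonical_seq (I - A) a n z) powr \<gamma> * d n"
        proof (cases "n \<in> A")
          case True
          \<comment> \<open>For a close zero |\<phi>_b| <= 1 is enough, because the possibly tiny
            |\<phi>_a| does not occur in \<open>H\<close>.\<close>
          have "0 \<le> 1 - (pseudohyperbolic_dist (b n) z)\<^sup>2"
            unfolding one_minus_pseudohyperbolic_dist_sq[OF b[OF \<open>n \<in> I\<close>] z1]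
            using one_minus_sq_pos[OF b[OF \<open>n \<in> I\<close>]] one_minus_sq_pos[OF z1]
            by (intro divide_nonneg_nonneg mult_nonneg_nonneg) auto
          then have "(pseudohyperbolic_dist (b n) z)\<^sup>2 \<le> 1\<^sup>2"
            by simp
          then have "pseudohyperbolic_dist (b n) z \<le> 1"
            by (rule power2_le_imp_le) simp
          then show ?thesis
            using True by (simp add: e_def d_def canonical_seq_def mult_left_le_one_le
                pseudohyperbolic_dist_def)
        next
          case False
          then have far: "1 / 40 \<le> pseudohyperbolic_dist (a n) z"
            using True by (auto simp: A_def)
          have "pseudohyperbolic_dist (b n) z
              \<le> exp (K * sep_kernel (a n) z) * pseudohyperbolic_dist (a n) z powr \<gamma>"
            by (rule K) (use True a b ab \<delta> z1 far in auto)
          also have "\<dots> \<le> exp (K' * sep_kernel (a n) z) * pseudohyperbolic_dist (a n) z powr \<gamma>"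
            using sep_kernel_nonneg[OF a[OF True] z1]
            by (intro mult_right_mono) (auto simp: K'_def intro!: mult_right_mono)
          finally have "pseudohyperbolic_dist (b n) z * exp (\<gamma> * Re (herglotz_term (a n) z))
              \<le> exp (K' * sep_kernel (a n) z) *
                (pseudohyperbolic_dist (a n) z powr \<gamma> * exp (\<gamma> * Re (herglotz_term (a n) z)))"
            by (simp add: mult_right_mono mult.assoc[symmetric])
          also have "pseudohyperbolic_dist (a n) z powr \<gamma> * exp (\<gamma> * Re (herglotz_term (a n) z))
              = cmod (canonical_seq (I - A) a n z) powr \<gamma>"
            using True False by (simp add: canonical_seq_def canonical_factor_def norm_mult
                pseudohyperbolic_dist_def powr_mult exp_powr_real mult.commute)
          finally show ?thesis
            using True False by (simp add: e_def d_def)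
        qed
        finally show ?thesis .
      qed
      \<comment> \<open>Since the products may vanish at \<open>z\<close>, logarithms are avoided:
        the inequality is proved for partial products and passes to the limit. The kernel sums enter
        only through finite subsets of \<open>I\<close>, so \<open>C0\<close> bounds the product of
        the \<open>e n\<close> for every N.\<close>
      have partial: "(\<Prod>n<N. cmod (canonical_seq I b n z)) * exp (Re (\<Sum>n<N. herglotz_diff \<gamma> I a b n z))
          \<le> exp (K' * C0) * (\<Prod>n<N. cmod (canonical_seq (I - A) a n z)) powr \<gamma> * (\<Prod>n<N. d n)" for N
      proof -
        have "(\<Prod>n<N. cmod (canonical_seq I b n z)) * exp (Re (\<Sum>n<N. herglotz_diff \<gamma> I a b n z))
            = (\<Prod>n<N. cmod (canonical_seq I b n z) * exp (Re (herglotz_diff \<gamma> I a b n z)))"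
          by (simp add: prod.distrib exp_sum)
        also have "\<dots> \<le> (\<Prod>n<N. e n * cmod (canonical_seq (I - A) a n z) powr \<gamma> * d n)"
          by (intro prod_mono conjI factor) auto
        also have "\<dots> = (\<Prod>n<N. e n) * (\<Prod>n<N. cmod (canonical_seq (I - A) a n z)) powr \<gamma> * (\<Prod>n<N. d n)"
          by (simp add: prod.distrib prod_powr_distrib)
        also have "\<dots> \<le> exp (K' * C0) * (\<Prod>n<N. cmod (canonical_seq (I - A) a n z)) powr \<gamma> * (\<Prod>n<N. d n)"
        proof (intro mult_right_mono)
          have "(\<Prod>n<N. e n) = (\<Prod>n\<in>{n\<in>{..<N}. n \<in> I - A}. exp (K' * sep_kernel (a n) z))"
            unfolding e_def by (rule prod.inter_filter[symmetric]) simp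
          also have "\<dots> = exp (K' * (\<Sum>n\<in>{n\<in>{..<N}. n \<in> I - A}. sep_kernel (a n) z))"
            by (simp add: exp_sum sum_distrib_left)
          also have "\<dots> \<le> exp (K' * C0)"
          proof -
            have "(\<Sum>n\<in>{n\<in>{..<N}. n \<in> I - A}. sep_kernel (a n) z) \<le> C0"
              using z by (intro C0) auto
            then show ?thesis
              by (simp add: K'_def mult_left_mono)
          qed
          finally show "(\<Prod>n<N. e n) \<le> exp (K' * C0)" .
        qed (auto simp: d_def intro!: prod_nonneg)
        finally show ?thesis .
      qed
      have lim1: "(\<lambda>N. (\<Prod>n<N. cmod (canonical_seq I b n z)) * exp (Re (\<Sum>n<N. herglotz_diff \<gamma> I a b n z)))
          \<longlonglongrightarrow> cmod (canonical_product I b z) * exp (Re (u z))"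
      proof (intro tendsto_intros)
        show "(\<lambda>N. \<Sum>n<N. herglotz_diff \<gamma> I a b n z) \<longlonglongrightarrow> u z"
          using tendsto_uniform_limitI[OF u_lim[OF z1], of z] by simp
        show "(\<lambda>N. \<Prod>n<N. cmod (canonical_seq I b n z)) \<longlonglongrightarrow> cmod (canonical_product I b z)"
          using tendsto_norm[OF canonical_product_LIMSEQ[OF Ib z]] by (simp add: prod_norm)
      qed
      obtain N0 where N0: "A \<subseteq> {..<N0}"
        using A(1) finite_nat_iff_bounded by auto
      have prod_d: "(\<Prod>n<N. d n) = (\<Prod>n\<in>A. exp (\<gamma> * Re (herglotz_term (a n) z)))" if "N0 \<le> N" for N
      proof -
        have "(\<Prod>n<N. d n) = (\<Prod>n\<in>{n\<in>{..<N}. n \<in> A}. exp (\<gamma> * Re (herglotz_term (a n) z)))"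
          unfolding d_def by (rule prod.inter_filter[symmetric]) simp
        also have "{n\<in>{..<N}. n \<in> A} = A"
          using N0 that by auto
        finally show ?thesis .
      qed
      have "(\<lambda>N. \<Prod>n<N. d n) \<longlonglongrightarrow> (\<Prod>n\<in>A. exp (\<gamma> * Re (herglotz_term (a n) z)))"
        by (rule tendsto_eventually, rule eventually_sequentiallyI[of N0]) (rule prod_d)
      moreover have "(\<lambda>N. \<Prod>n<N. cmod (canonical_seq (I - A) a n z)) \<longlonglongrightarrow> cmod (canonical_product (I - A) a z)"
        using tendsto_norm[OF canonical_product_LIMSEQ[OF IA z]] by (simp add: prod_norm)
      then have "(\<lambda>N. (\<Prod>n<N. cmod (canonical_seq (I - A) a n z)) powr \<gamma>)
          \<longlonglongrightarrow> cmod (canonical_product (I - A) a z) powr \<gamma>"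
        using \<gamma> by (intro tendsto_powr' tendsto_const) (auto intro!: always_eventually prod_nonneg)
      ultimately have lim2: "(\<lambda>N. exp (K' * C0) * (\<Prod>n<N. cmod (canonical_seq (I - A) a n z)) powr \<gamma> * (\<Prod>n<N. d n))
          \<longlonglongrightarrow> exp (K' * C0) * cmod (canonical_product (I - A) a z) powr \<gamma> *
            (\<Prod>n\<in>A. exp (\<gamma> * Re (herglotz_term (a n) z)))"
        by (intro tendsto_mult tendsto_const)
      have le: "cmod (canonical_product I b z) * exp (Re (u z))
          \<le> exp (K' * C0) * cmod (canonical_product (I - A) a z) powr \<gamma> *
            (\<Prod>n\<in>A. exp (\<gamma> * Re (herglotz_term (a n) z)))"
        by (rule LIMSEQ_le[OF lim1 lim2]) (use partial in blast)
      have "cmod (F z) = cmod (canonical_product I b z) * exp (Re (u z)) * exp (\<gamma> * Re (g z))"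
        by (simp add: F_def E_def norm_mult exp_add)
      also have "\<dots> \<le> exp (K' * C0) * cmod (canonical_product (I - A) a z) powr \<gamma> *
            (\<Prod>n\<in>A. exp (\<gamma> * Re (herglotz_term (a n) z))) * exp (\<gamma> * Re (g z))"
        by (rule mult_right_mono[OF le]) simp
      also have "\<dots> = exp (K' * C0) * cmod (H z) powr \<gamma>"
        by (simp add: H_def norm_mult prod_norm[symmetric] powr_mult prod_powr_distrib prod_nonneg
            exp_powr_real mult.commute[of \<gamma>])
      finally show ?thesis .
    qed
    define s where "s = (1 - cmod z) / 8"
    have s: "0 < s" "cmod z + s < 1"
      using z1 by (simp_all add: s_def field_simps)
    have sub: "cball z s \<subseteq> unit_disc"
    proof
      fix w assume "w \<in> cball z s"
      then have "cmod (w - z) \<le> s"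
        by (simp add: dist_norm norm_minus_commute)
      then show "w \<in> unit_disc"
        using norm_triangle_sub[of w z] s by simp
    qed
    have cont: "continuous_on (cball z s) H"
      using H sub by (meson continuous_on_subset holomorphic_on_imp_continuous_on)
    have "compact (sphere z s)" "sphere z s \<noteq> {}"
      using s by auto
    moreover have "continuous_on (sphere z s) (\<lambda>w. cmod (H w))"
      using cont by (intro continuous_intros) (rule continuous_on_subset, auto)
    ultimately obtain v where v: "v \<in> sphere z s" "\<And>w. w \<in> sphere z s \<Longrightarrow> cmod (H w) \<le> cmod (H v)"
      using continuous_attains_sup by metis
    have "cmod (H z) \<le> cmod (H v)"
    proof (rule maximum_modulus_frontier[of H "cball z s"])
      show "H holomorphic_on interior (cball z s)"
        using H sub by (meson holomorphic_on_subset interior_subset order_trans)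
    qed (use cont v s in auto)
    moreover have "cmod (H v) \<le> 48 ^ M * cmod (f v)"
    proof -
      have v1: "v \<in> unit_disc"
        using v sub sphere_cball by blast
      have "(1 / 48) ^ card A = (\<Prod>n\<in>A. 1 / 48 :: real)"
        by simp
      also have "\<dots> \<le> (\<Prod>n\<in>A. pseudohyperbolic_dist (a n) v)"
      proof (intro prod_mono conjI)
        fix n assume "n \<in> A"
        then show "1 / 48 \<le> pseudohyperbolic_dist (a n) v"
          using pseudohyperbolic_near_circle[of "a n" z v] a z1 v
          by (auto simp: A_def s_def dist_norm norm_minus_commute)
      qed auto
      also have "\<dots> = cmod (\<Prod>n\<in>A. disc_involution (a n) v)"
        by (simp add: pseudohyperbolic_dist_def prod_norm)
      finally have "cmod (H v) * (1 / 48) ^ card A \<le> cmod (f v)"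
        unfolding f_eq[OF v1] norm_mult by (intro mult_left_mono) auto
      then have "cmod (H v) \<le> 48 ^ card A * cmod (f v)"
        by (simp add: power_one_over field_simps)
      also have "\<dots> \<le> 48 ^ M * cmod (f v)"
        using A by (intro mult_right_mono power_increasing) auto
      finally show ?thesis .
    qed
    ultimately have "cmod (H z) \<le> 48 ^ M * cmod (f v)"
      by linarith
    then have "cmod (H z) powr \<gamma> \<le> (48 ^ M * cmod (f v)) powr \<gamma>"
      using \<gamma> by (intro powr_mono2) auto
    then have "cmod (F z) \<le> exp (K' * C0) * (48 ^ M * cmod (f v)) powr \<gamma>"
      using FH by (meson exp_ge_zero mult_left_mono order_trans)
    then have "cmod (F z) \<le> C * cmod (f v) powr \<gamma>"
      by (simp add: C_def powr_mult)
    moreover have "cmod (v - z) = (1 - cmod z) / 8"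
      using v by (simp add: s_def dist_norm norm_minus_commute)
    ultimately show ?thesis
      by blast
  qed
  show ?thesis
    by (rule that[OF F Fnz F_zeros bound])
qed

section \<open>Weights on hyperbolic discs\<close>

lemma space_disc_measure [simp]: "space disc_measure = unit_disc"
  by (simp add: disc_measure_def space_restrict_space)

lemma sets_disc_measure: "sets disc_measure = sets (lebesgue_on unit_disc)"
  by (simp add: disc_measure_def)

lemma borel_measurable_disc_measure_continuous:
  assumes "continuous_on unit_disc (f :: complex \<Rightarrow> 'a::euclidean_space)"
  shows "f \<in> borel_measurable disc_measure"
proof -
  have "f \<in> borel_measurable (lebesgue_on unit_disc)"
    using assms by (intro continuous_imp_measurable_on_sets_lebesgue) auto
  then show ?thesis
    by (simp add: disc_measure_def)
qed

lemma measurable_ident_disc_measure [measurable]: "(\<lambda>z. z) \<in> borel_measurable disc_measure"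
  by (rule borel_measurable_disc_measure_continuous) (rule continuous_on_id)

lemma nn_integral_disc_measure:
  assumes "g \<in> borel_measurable disc_measure"
  shows "(\<integral>\<^sup>+z. g z \<partial>disc_measure) = ennreal (1 / pi) * (\<integral>\<^sup>+z. g z * indicator unit_disc z \<partial>lborel)"
proof -
  have g: "g \<in> borel_measurable (lebesgue_on unit_disc)"
    using assms by (simp add: disc_measure_def)
  have "(\<integral>\<^sup>+z. g z \<partial>disc_measure) = (\<integral>\<^sup>+z. ennreal (1 / pi) * g z \<partial>lebesgue_on unit_disc)"
    unfolding disc_measure_def using g by (intro nn_integral_density) auto
  also have "\<dots> = ennreal (1 / pi) * (\<integral>\<^sup>+z. g z \<partial>lebesgue_on unit_disc)"
    using g by (rule nn_integral_cmult)
  also have "(\<integral>\<^sup>+z. g z \<partial>lebesgue_on unit_disc) = (\<integral>\<^sup>+z. g z * indicator unit_disc z \<partial>lebesgue)"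
    by (rule nn_integral_restrict_space) simp
  also have "\<dots> = (\<integral>\<^sup>+z. g z * indicator unit_disc z \<partial>lborel)"
    by (rule nn_integral_completion)
  finally show ?thesis .
qed

lemma emeasure_disc_measure_ball:
  assumes "ball z R \<subseteq> unit_disc" "0 \<le> R"
  shows "emeasure disc_measure (ball z R) = ennreal (R\<^sup>2)"
proof -
  have sets: "ball z R \<in> sets disc_measure"
    using assms by (auto simp: sets_disc_measure sets_restrict_space_iff)
  have "emeasure disc_measure (ball z R) = (\<integral>\<^sup>+w. indicator (ball z R) w \<partial>disc_measure)"
    using sets by simp
  also have "\<dots> = ennreal (1 / pi) * (\<integral>\<^sup>+w. indicator (ball z R) w * indicator unit_disc w \<partial>lborel)"
    using sets by (intro nn_integral_disc_measure) auto
  also have "(\<lambda>w. indicator (ball z R) w * indicator unit_disc w :: ennreal) = indicator (ball z R)"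
    using assms by (auto simp: indicator_def fun_eq_iff)
  also have "ennreal (1 / pi) * (\<integral>\<^sup>+w. indicator (ball z R) w \<partial>lborel) = ennreal (1 / pi) * ennreal (pi * R\<^sup>2)"
    using assms emeasure_ball[of R z] by (simp add: unit_ball_vol_2)
  also have "\<dots> = ennreal (R\<^sup>2)"
    by (simp add: ennreal_mult[symmetric])
  finally show ?thesis .
qed

interpretation disc_measure: finite_measure disc_measure
  by (rule finite_measureI) (use emeasure_disc_measure_ball[of 0 1] in simp)

interpretation disc_pair: pair_sigma_finite disc_measure disc_measure ..

section \<open>Geometry of Carleson squares\<close>

lemma carleson_square_iff:
  assumes c: "0 < cmod c" "cmod c < 1"
  shows "w \<in> carleson_square c \<longleftrightarrow>
    cmod c < cmod w \<and> cmod w < 1 \<and> \<bar>Arg (c * cnj w)\<bar> < (1 - cmod c) / 2"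
proof
  assume "w \<in> carleson_square c"
  then obtain r \<theta> where w: "w = of_real r * cis \<theta>" "cmod c < r" "r < 1"
    "\<bar>Arg (c * cis (- \<theta>))\<bar> < (1 - cmod c) / 2"
    by (auto simp: carleson_square_def)
  have r: "0 < r"
    using w c by linarith
  have "c * cnj w = of_real r * (c * cis (- \<theta>))"
    by (simp add: w cis_cnj)
  then have "Arg (c * cnj w) = Arg (c * cis (- \<theta>))"
    using r by (simp only: Arg_times_of_real)
  moreover have "cmod w = r"
    using r by (simp add: w norm_mult)
  ultimately show "cmod c < cmod w \<and> cmod w < 1 \<and> \<bar>Arg (c * cnj w)\<bar> < (1 - cmod c) / 2"
    using w by simp
next
  assume w: "cmod c < cmod w \<and> cmod w < 1 \<and> \<bar>Arg (c * cnj w)\<bar> < (1 - cmod c) / 2"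
  have polar: "w = of_real (cmod w) * cis (Arg w)"
    using rcis_cmod_Arg[of w] by (simp add: rcis_def)
  have "c * cnj w = of_real (cmod w) * (c * cis (- Arg w))"
    by (subst polar) (simp add: cis_cnj)
  moreover have "0 < cmod w"
    using w c by linarith
  ultimately have "Arg (c * cnj w) = Arg (c * cis (- Arg w))"
    by (simp only: Arg_times_of_real)
  then show "w \<in> carleson_square c"
    using w polar unfolding carleson_square_def by (intro CollectI exI[of _ "cmod w"] exI[of _ "Arg w"]) auto
qed

text \<open>\<open>Arg\<close> jumps along the negative axis. The cosine form is a strict inequality
  between continuous functions, so Carleson squares are seen to be open.\<close>

lemma abs_Arg_less_iff:
  assumes "x \<noteq> 0" "0 < t" "t < pi"
  shows "\<bar>Arg x\<bar> < t \<longleftrightarrow> cmod x * cos t < Re x"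
proof -
  have "x = of_real (cmod x) * cis (Arg x)"
    using rcis_cmod_Arg[of x] by (simp add: rcis_def)
  then have "Re x = cmod x * cos (Arg x)"
    by (metis Re_rcis rcis_def)
  then have re: "Re x = cmod x * cos \<bar>Arg x\<bar>"
    by simp
  have "\<bar>Arg x\<bar> \<le> pi"
    using mpi_less_Arg[of x] Arg_le_pi[of x] by linarith
  then have "cos t < cos \<bar>Arg x\<bar> \<longleftrightarrow> \<bar>Arg x\<bar> < t"
    using assms by (intro cos_mono_less_eq) auto
  then show ?thesis
    using assms by (simp add: re)
qed

lemma carleson_square_eq:
  assumes c: "0 < cmod c" "cmod c < 1"
  shows "carleson_square c = {w. cmod c < cmod w \<and> cmod w < 1 \<and>
    cmod (c * cnj w) * cos ((1 - cmod c) / 2) < Re (c * cnj w)}"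
proof -
  have "1 - cmod c < 2"
    using c by linarith
  then have "(1 - cmod c) / 2 < 1"
    by simp
  then have t2: "(1 - cmod c) / 2 < pi"
    by (rule less_trans) (use pi_ge_two in linarith)
  have t: "0 < (1 - cmod c) / 2"
    using c by simp
  show ?thesis
  proof (rule set_eqI)
    fix w
    show "w \<in> carleson_square c \<longleftrightarrow> w \<in> {w. cmod c < cmod w \<and> cmod w < 1 \<and>
        cmod (c * cnj w) * cos ((1 - cmod c) / 2) < Re (c * cnj w)}"
    proof (cases "cmod c < cmod w")
      case True
      then have "c * cnj w \<noteq> 0"
        using c by auto
      then show ?thesis
        unfolding carleson_square_iff[OF c] mem_Collect_eq using abs_Arg_less_iff[OF _ t t2] by blast
    next
      case False
      then show ?thesis
        unfolding carleson_square_iff[OF c] mem_Collect_eq by blast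
    qed
  qed
qed

lemma carleson_square_open:
  assumes c: "0 < cmod c" "cmod c < 1"
  shows "open (carleson_square c)"
proof -
  have "open {w. cmod c < cmod w}" "open {w. cmod w < (1::real)}"
    "open {w. cmod (c * cnj w) * cos ((1 - cmod c) / 2) < Re (c * cnj w)}"
    by (intro open_Collect_less continuous_intros)+
  then have "open ({w. cmod c < cmod w} \<inter> {w. cmod w < 1} \<inter>
      {w. cmod (c * cnj w) * cos ((1 - cmod c) / 2) < Re (c * cnj w)})"
    by (intro open_Int)
  then show ?thesis
    by (simp add: carleson_square_eq[OF c] Collect_conj_eq Int_assoc)
qed

text \<open>The law of cosines with cos t >= 1 - t^2 / 2. It yields the upper bound for the area of
  the square.\<close>

lemma carleson_square_subset_ball:
  assumes c: "0 < cmod c" "cmod c < 1"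
  shows "carleson_square c \<subseteq> ball c (2 * (1 - cmod c))"
proof
  fix w assume "w \<in> carleson_square c"
  then have w: "cmod c < cmod w" "cmod w < 1" "cmod c * cmod w * cos ((1 - cmod c) / 2) < Re (c * cnj w)"
    by (auto simp: carleson_square_eq[OF c] norm_mult)
  define t where "t = (1 - cmod c) / 2"
  have t: "0 < t"
    using c by (simp add: t_def)
  have "cos t = 1 - 2 * (sin (t / 2))\<^sup>2"
    using cos_double_sin[of "t / 2"] by simp
  moreover have "(sin (t / 2))\<^sup>2 \<le> (t / 2)\<^sup>2"
    using abs_sin_x_le_abs_x[of "t / 2"] unfolding abs_le_square_iff .
  ultimately have cos: "1 - t\<^sup>2 / 2 \<le> cos t"
    by (simp add: power_divide)
  have "(cmod (w - c))\<^sup>2 = (cmod w)\<^sup>2 + (cmod c)\<^sup>2 - 2 * Re (c * cnj w)"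
    unfolding cmod_power2 by (simp add: power2_eq_square algebra_simps)
  also have "\<dots> \<le> (cmod w)\<^sup>2 + (cmod c)\<^sup>2 - 2 * (cmod c * cmod w * (1 - t\<^sup>2 / 2))"
  proof -
    have "cmod c * cmod w * (1 - t\<^sup>2 / 2) \<le> cmod c * cmod w * cos t"
      using cos by (intro mult_left_mono) auto
    then show ?thesis
      using w(3) by (simp add: t_def)
  qed
  also have "\<dots> = (cmod w - cmod c)\<^sup>2 + cmod c * cmod w * t\<^sup>2"
    by (simp add: power2_eq_square algebra_simps)
  also have "\<dots> \<le> (1 - cmod c)\<^sup>2 + 1 * 1 * t\<^sup>2"
    using w c t by (intro add_mono power_mono mult_mono) auto
  also have "\<dots> < (2 * (1 - cmod c))\<^sup>2"
  proof -
    have "(1 - cmod c)\<^sup>2 = 4 * t\<^sup>2" "(2 * (1 - cmod c))\<^sup>2 = 16 * t\<^sup>2"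
      by (simp_all add: t_def power2_eq_square field_simps)
    then show ?thesis
      using t by simp
  qed
  finally have "cmod (w - c) < 2 * (1 - cmod c)"
    using c by (simp add: power_less_imp_less_base)
  then show "w \<in> ball c (2 * (1 - cmod c))"
    by (simp add: dist_norm norm_minus_commute)
qed

text \<open>The vertex \<open>c\<close> lies on the ray of \<open>u\<close>, eight times as far from
  the circle. The half opening 4 s of the square then exceeds 4/3 s, which bounds |Arg (u * cnj w)|
  by |Im| / Re. The condition |u| >= 15/16 keeps |c| >= 1/2 and |u| - 2/3 s >= 1/2.\<close>

lemma ball_subset_carleson_square:
  assumes u: "cmod u < 1" "15 / 16 \<le> cmod u"
  defines "s \<equiv> 1 - cmod u"
  defines "c \<equiv> of_real ((1 - 8 * s) / cmod u) * u"
  shows "cmod c = 1 - 8 * s" "ball u (2 / 3 * s) \<subseteq> carleson_square c"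
proof -
  have s: "0 < s" "s \<le> 1 / 16" and u0: "0 < cmod u"
    using u by (auto simp: s_def)
  have "cmod c = \<bar>(1 - 8 * s) / cmod u\<bar> * cmod u"
    unfolding c_def by (simp only: norm_mult norm_of_real)
  then show cc: "cmod c = 1 - 8 * s"
    using s u0 by (simp add: abs_divide)
  have c: "0 < cmod c" "cmod c < 1"
    unfolding cc using s by auto
  show "ball u (2 / 3 * s) \<subseteq> carleson_square c"
  proof
    fix w assume "w \<in> ball u (2 / 3 * s)"
    then have wu: "cmod (w - u) < 2 / 3 * s"
      by (simp add: dist_norm norm_minus_commute)
    have "\<bar>cmod w - cmod u\<bar> < 2 / 3 * s"
      using norm_triangle_ineq3[of w u] wu by linarith
    then have w_bounds: "cmod w - cmod u < 2 / 3 * s" "cmod u - cmod w < 2 / 3 * s"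
      unfolding abs_less_iff by auto
    have w1: "cmod c < cmod w"
      unfolding cc using w_bounds(2) s s_def by linarith
    have w2: "cmod w < 1"
      using w_bounds(1) s s_def by linarith
    define y where "y = u * cnj w"
    have y: "y = of_real ((cmod u)\<^sup>2) + u * cnj (w - u)"
      unfolding y_def complex_norm_square by (simp add: algebra_simps)
    have small: "cmod (u * cnj (w - u)) \<le> cmod u * (2 / 3 * s)"
      unfolding norm_mult complex_mod_cnj using wu by (intro mult_left_mono) auto
    have "Re y = (cmod u)\<^sup>2 + Re (u * cnj (w - u))" "Im y = Im (u * cnj (w - u))"
      unfolding y by (simp_all only: plus_complex.sel Re_complex_of_real Im_complex_of_real add_0)
    then have Re: "(cmod u)\<^sup>2 - cmod u * (2 / 3 * s) \<le> Re y" and Im: "\<bar>Im y\<bar> \<le> cmod u * (2 / 3 * s)"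
      using small abs_Re_le_cmod[of "u * cnj (w - u)"] abs_Im_le_cmod[of "u * cnj (w - u)"] by linarith+
    have "cmod u * (1 / 2) \<le> cmod u * (cmod u - 2 / 3 * s)"
      using u s by (intro mult_left_mono) auto
    then have Re': "cmod u * (1 / 2) \<le> Re y"
      using Re by (simp add: power2_eq_square algebra_simps)
    then have Rpos: "0 < Re y"
      using u0 by linarith
    have "y \<noteq> 0"
      using Rpos by auto
    then have "Arg y = arctan (Im y / Re y)"
      using Rpos by (simp add: Arg_eq_Im_Ln Im_Ln_eq)
    then have "\<bar>Arg y\<bar> \<le> \<bar>Im y / Re y\<bar>"
      using abs_arctan_le[of "Im y / Re y"] by (simp only:)
    also have "\<dots> = \<bar>Im y\<bar> / Re y"
      using Rpos by simp
    also have "\<dots> \<le> (cmod u * (2 / 3 * s)) / (cmod u * (1 / 2))"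
      using Im Re' u0 Rpos s by (intro frac_le) auto
    also have "\<dots> = 4 / 3 * s"
      using u0 by simp
    also have "\<dots> < (1 - cmod c) / 2"
      unfolding cc using s by simp
    finally have "\<bar>Arg y\<bar> < (1 - cmod c) / 2" .
    moreover have "c * cnj w = of_real ((1 - 8 * s) / cmod u) * y"
      by (simp add: c_def y_def mult.assoc)
    then have "Arg (c * cnj w) = Arg y"
      using s u0 by (simp only: Arg_times_of_real divide_pos_pos)
    ultimately show "w \<in> carleson_square c"
      using w1 w2 by (simp add: carleson_square_iff[OF c])
  qed
qed

lemma ball_subset_unit_disc:
  assumes "cmod u + r \<le> 1"
  shows "ball u r \<subseteq> unit_disc"
proof
  fix w assume "w \<in> ball u r"
  then have "cmod (w - u) < r"
    by (simp add: dist_norm norm_minus_commute)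
  then show "w \<in> unit_disc"
    using norm_triangle_sub[of w u] assms by simp
qed

text \<open>The ball lies in a Carleson square of area at most \<pi> (16 s)^2, and 1 - |z|^2 >= s /
  3 on it. The B_q condition gives |S|^(2q), of order s^(4q); dividing out the factor (1 -
  |z|^2)^(2q) leaves s^(2q). This is the usual A_q condition for a ball of radius comparable to
  s.\<close>

lemma B_class_ball_bound:
  assumes \<omega>: "\<omega> \<in> B_class q" and q: "1 < q"
  obtains C where "0 \<le> C"
    "\<And>u. \<lbrakk>cmod u < 1; 15 / 16 \<le> cmod u\<rbrakk> \<Longrightarrow>
      set_integrable disc_measure (ball u (2 / 3 * (1 - cmod u))) (\<lambda>z. \<omega> z powr (- (1 / (q - 1))))"
    "\<And>u. \<lbrakk>cmod u < 1; 15 / 16 \<le> cmod u\<rbrakk> \<Longrightarrow>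
      (LINT z:ball u (2 / 3 * (1 - cmod u))|disc_measure. \<omega> z) *
      (LINT z:ball u (2 / 3 * (1 - cmod u))|disc_measure. \<omega> z powr (- (1 / (q - 1)))) powr (q - 1)
      \<le> C * (1 - cmod u) powr (2 * q)"
proof -
  define \<sigma> where "\<sigma> z = \<omega> z powr (- (1 / (q - 1)))" for z
  have w0: "\<And>z. z \<in> unit_disc \<Longrightarrow> 0 \<le> \<omega> z" and w_int: "integrable disc_measure \<omega>"
    using \<omega> by (auto simp: B_class_def weight_def)
  have [measurable]: "\<omega> \<in> borel_measurable disc_measure"
    using w_int by auto
  have \<sigma>_int: "set_integrable disc_measure (carleson_square c) \<sigma>" if "c \<in> unit_disc - {0}" for c
    using \<omega> that by (simp add: B_class_def \<sigma>_def[abs_def])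
  define X where "X S = (LINT z:S|disc_measure. \<omega> z * (1 - (cmod z)\<^sup>2) powr (2 * q))" for S
  define Y where "Y S = (LINT z:S|disc_measure. \<sigma> z)" for S
  have "bdd_above ((\<lambda>S. (1 / (measure lebesgue S)\<^sup>2 * X S) * (1 / (measure lebesgue S)\<^sup>2 * Y S) powr (q - 1))
      ` carleson_square ` (unit_disc - {0}))"
    using \<omega> unfolding B_class_def mem_Collect_eq X_def Y_def \<sigma>_def by (elim conjE)
  then obtain K0 where K0: "\<And>c. c \<in> unit_disc - {0} \<Longrightarrow>
      (1 / (measure lebesgue (carleson_square c))\<^sup>2 * X (carleson_square c)) *
      (1 / (measure lebesgue (carleson_square c))\<^sup>2 * Y (carleson_square c)) powr (q - 1) \<le> K0"
    unfolding bdd_above_def by blast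
  define K where "K = max K0 0"
  define C where "C = K * 3 powr (2 * q) * (256 * pi) powr (2 * q)"
  have main: "set_integrable disc_measure (ball u (2 / 3 * (1 - cmod u))) \<sigma> \<and>
      (LINT z:ball u (2 / 3 * (1 - cmod u))|disc_measure. \<omega> z) *
      (LINT z:ball u (2 / 3 * (1 - cmod u))|disc_measure. \<sigma> z) powr (q - 1) \<le> C * (1 - cmod u) powr (2 * q)"
    if u: "cmod u < 1" "15 / 16 \<le> cmod u" for u
  proof -
    define s where "s = 1 - cmod u"
    define c where "c = of_real ((1 - 8 * s) / cmod u) * u"
    define S where "S = carleson_square c"
    define G where "G = ball u (2 / 3 * s)"
    have s: "0 < s" "s \<le> 1 / 16"
      using u by (auto simp: s_def)
    have cc: "cmod c = 1 - 8 * s" and GS: "G \<subseteq> S"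
      using ball_subset_carleson_square[OF u] by (simp_all add: c_def s_def S_def G_def)
    have c: "0 < cmod c" "cmod c < 1"
      unfolding cc using s by auto
    then have cD: "c \<in> unit_disc - {0}"
      by simp
    have S_disc: "S \<subseteq> unit_disc"
    proof
      fix w assume "w \<in> S"
      then show "w \<in> unit_disc"
        using carleson_square_iff[OF c, of w] by (simp add: S_def)
    qed
    have S_open: "open S"
      unfolding S_def by (rule carleson_square_open[OF c])
    have meas_sets: "A \<in> sets disc_measure" if "open A" "A \<subseteq> unit_disc" for A
      using that by (auto simp: sets_disc_measure sets_restrict_space_iff)
    have [measurable]: "S \<in> sets disc_measure" "G \<in> sets disc_measure"
      using meas_sets S_open S_disc GS by (auto simp: G_def)
    have S_ball: "S \<subseteq> ball c (16 * s)"
      using carleson_square_subset_ball[OF c] by (simp add: S_def cc)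
    have S_fin: "S \<in> lmeasurable"
      using S_open S_ball by (intro lmeasurable_open) (auto intro: bounded_subset)
    have S_le: "measure lebesgue S \<le> pi * (16 * s)\<^sup>2"
    proof -
      have "measure lebesgue S \<le> measure lebesgue (ball c (16 * s))"
        using S_ball S_fin by (intro measure_mono_fmeasurable) (auto simp: fmeasurableD)
      also have "\<dots> = pi * (16 * s)\<^sup>2"
        using s content_ball[of "16 * s" c] by (simp add: unit_ball_vol_2)
      finally show ?thesis .
    qed
    have S_pos: "0 < measure lebesgue S"
    proof -
      have "0 < pi * (2 / 3 * s)\<^sup>2"
        using s by simp
      also have "\<dots> = measure lebesgue G"
        unfolding G_def using s content_ball[of "2 / 3 * s" u] by (simp add: unit_ball_vol_2)
      also have "\<dots> \<le> measure lebesgue S"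
        using GS S_fin by (intro measure_mono_fmeasurable) (auto simp: G_def)
      finally show ?thesis .
    qed
    have \<sigma>S: "set_integrable disc_measure S \<sigma>"
      unfolding S_def by (rule \<sigma>_int[OF cD])
    have \<sigma>G: "set_integrable disc_measure G \<sigma>"
      by (rule set_integrable_subset[OF \<sigma>S _ GS]) measurable
    have YGS: "Y G \<le> Y S" "0 \<le> Y G"
    proof -
      have "(LINT z|disc_measure. indicator G z *\<^sub>R \<sigma> z) \<le> (LINT z|disc_measure. indicator S z *\<^sub>R \<sigma> z)"
        using \<sigma>S \<sigma>G GS unfolding set_integrable_def
        by (intro integral_mono) (auto simp: indicator_def \<sigma>_def)
      then show "Y G \<le> Y S"
        by (simp add: Y_def set_lebesgue_integral_def)
      show "0 \<le> Y G"
        unfolding Y_def set_lebesgue_integral_def by (intro integral_nonneg_AE) (auto simp: \<sigma>_def)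
    qed
    have wG: "set_integrable disc_measure G \<omega>"
      unfolding set_integrable_def using w_int by (intro integrable_mult_indicator) auto
    have [measurable]: "(\<lambda>z. \<omega> z * (1 - (cmod z)\<^sup>2) powr (2 * q)) \<in> borel_measurable disc_measure"
      by measurable
    have wt_int: "integrable disc_measure (\<lambda>z. \<omega> z * (1 - (cmod z)\<^sup>2) powr (2 * q))"
    proof (rule Bochner_Integration.integrable_bound[OF w_int])
      show "AE z in disc_measure. norm (\<omega> z * (1 - (cmod z)\<^sup>2) powr (2 * q)) \<le> norm (\<omega> z)"
      proof (rule AE_I2)
        fix z assume "z \<in> space disc_measure"
        then have z: "cmod z < 1"
          by simp
        then have "(cmod z)\<^sup>2 \<le> 1"
          by (simp add: power_le_one)
        then have "(1 - (cmod z)\<^sup>2) powr (2 * q) \<le> 1"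
          using q by (intro powr_le1) auto
        then show "norm (\<omega> z * (1 - (cmod z)\<^sup>2) powr (2 * q)) \<le> norm (\<omega> z)"
          by (simp add: abs_mult mult_left_le)
      qed
    qed measurable
    have X_le: "(s / 3) powr (2 * q) * (LINT z:G|disc_measure. \<omega> z) \<le> X S"
    proof -
      have "(s / 3) powr (2 * q) * (LINT z:G|disc_measure. \<omega> z)
          = (LINT z|disc_measure. indicator G z *\<^sub>R ((s / 3) powr (2 * q) * \<omega> z))"
        unfolding set_lebesgue_integral_def integral_mult_right_zero[symmetric]
        by (simp add: mult_ac)
      also have "\<dots> \<le> (LINT z|disc_measure. indicator S z *\<^sub>R (\<omega> z * (1 - (cmod z)\<^sup>2) powr (2 * q)))"
      proof (rule integral_mono)
        show "integrable disc_measure (\<lambda>z. indicator G z *\<^sub>R ((s / 3) powr (2 * q) * \<omega> z))"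
          using w_int by (intro integrable_mult_indicator) auto
        show "integrable disc_measure (\<lambda>z. indicator S z *\<^sub>R (\<omega> z * (1 - (cmod z)\<^sup>2) powr (2 * q)))"
          using wt_int by (intro integrable_mult_indicator) auto
        fix z assume "z \<in> space disc_measure"
        then have z: "cmod z < 1" "0 \<le> \<omega> z"
          using w0 by auto
        show "indicator G z *\<^sub>R ((s / 3) powr (2 * q) * \<omega> z)
            \<le> indicator S z *\<^sub>R (\<omega> z * (1 - (cmod z)\<^sup>2) powr (2 * q))"
        proof (cases "z \<in> G")
          case True
          then have "cmod (z - u) < 2 / 3 * s"
            by (simp add: G_def dist_norm norm_minus_commute)
          then have "s / 3 \<le> 1 - cmod z"
            using norm_triangle_sub[of z u] by (simp add: s_def)
          also have "\<dots> \<le> 1 - (cmod z)\<^sup>2"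
            using z by (simp add: power2_eq_square mult_left_le)
          finally have "(s / 3) powr (2 * q) \<le> (1 - (cmod z)\<^sup>2) powr (2 * q)"
            using s q by (intro powr_mono2) auto
          then show ?thesis
            using True GS z by (auto simp: mult.commute mult_left_mono)
        next
          case False
          then show ?thesis
            using z by (auto simp: indicator_def)
        qed
      qed
      finally show ?thesis
        by (simp add: X_def set_lebesgue_integral_def)
    qed
    let ?m = "measure lebesgue S"
    let ?W = "LINT z:G|disc_measure. \<omega> z"
    have W0: "0 \<le> ?W"
      unfolding set_lebesgue_integral_def using w0
      by (intro integral_nonneg_AE) (auto simp: indicator_def)
    have X0: "0 \<le> X S"
      using X_le W0 by (meson mult_nonneg_nonneg order_trans powr_ge_zero)
    \<comment> \<open>The two normalising factors together give |S|^(-2) |S|^(-2(q-1)) =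
      |S|^(-2q).\<close>
    have "X S * Y S powr (q - 1) = ?m powr (2 * q) *
        ((1 / ?m\<^sup>2 * X S) * (1 / ?m\<^sup>2 * Y S) powr (q - 1))"
    proof -
      have "(1 / ?m\<^sup>2 * Y S) powr (q - 1) = (1 / ?m\<^sup>2) powr (q - 1) * Y S powr (q - 1)"
        using YGS by (intro powr_mult)
      moreover have "(1 / ?m\<^sup>2) powr (q - 1) = ?m powr (- 2 * (q - 1))"
      proof -
        have "1 / ?m\<^sup>2 = ?m powr (- 2)"
          using S_pos by (simp add: powr_minus_divide)
        then show ?thesis
          by (simp only: powr_powr)
      qed
      moreover have "1 / ?m\<^sup>2 = ?m powr (- 2)"
        using S_pos by (simp add: powr_minus_divide)
      ultimately have "?m powr (2 * q) * ((1 / ?m\<^sup>2 * X S) * (1 / ?m\<^sup>2 * Y S) powr (q - 1))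
          = (?m powr (2 * q) * ?m powr (- 2) * ?m powr (- 2 * (q - 1))) * (X S * Y S powr (q - 1))"
        by (simp only: mult_ac)
      also have "?m powr (2 * q) * ?m powr (- 2) * ?m powr (- 2 * (q - 1)) = 1"
        using S_pos by (simp add: powr_add[symmetric] algebra_simps)
      finally show ?thesis
        by simp
    qed
    also have "\<dots> \<le> ?m powr (2 * q) * K"
    proof (rule mult_left_mono)
      show "1 / ?m\<^sup>2 * X S * (1 / ?m\<^sup>2 * Y S) powr (q - 1) \<le> K"
        using K0[OF cD] by (simp add: K_def S_def)
    qed simp
    also have "\<dots> \<le> (pi * (16 * s)\<^sup>2) powr (2 * q) * K"
      using S_le S_pos q by (intro mult_right_mono powr_mono2) (auto simp: K_def)
    finally have XY: "X S * Y S powr (q - 1) \<le> (pi * (16 * s)\<^sup>2) powr (2 * q) * K" .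
    have "(s / 3) powr (2 * q) * (?W * Y G powr (q - 1))
        = ((s / 3) powr (2 * q) * ?W) * Y G powr (q - 1)"
      by simp
    also have "\<dots> \<le> X S * Y S powr (q - 1)"
      using X_le YGS q X0 by (intro mult_mono powr_mono2) auto
    also have "\<dots> \<le> (pi * (16 * s)\<^sup>2) powr (2 * q) * K"
      by (rule XY)
    also have "(pi * (16 * s)\<^sup>2) powr (2 * q) = (s / 3) powr (2 * q) * (3 powr (2 * q) * (256 * pi) powr (2 * q) * s powr (2 * q))"
    proof -
      have eq: "pi * (16 * s)\<^sup>2 = (s / 3) * (3 * (256 * pi) * s)"
        by (simp add: power2_eq_square)
      show ?thesis
        unfolding eq by (simp only: powr_mult)
    qed
    finally have "(s / 3) powr (2 * q) * (?W * Y G powr (q - 1)) \<le> (s / 3) powr (2 * q) * (C * s powr (2 * q))"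
      by (simp add: C_def mult_ac)
    then have "?W * Y G powr (q - 1) \<le> C * s powr (2 * q)"
      using s by (simp add: mult_le_cancel_left)
    then show ?thesis
      using \<sigma>G by (simp add: G_def s_def Y_def)
  qed
  have "0 \<le> C"
    by (simp add: C_def K_def)
  then show ?thesis
    using main that unfolding \<sigma>_def by blast
qed

text \<open>A crude three-term Young inequality: the number 1 takes up the missing exponent 1 -
  \<alpha> - \<beta>.\<close>

lemma powr_mult_powr_le:
  fixes x y :: real
  assumes "0 \<le> x" "0 \<le> y" "0 \<le> \<alpha>" "0 \<le> \<beta>" "\<alpha> + \<beta> \<le> 1"
  shows "x powr \<alpha> * y powr \<beta> \<le> x + y + 1"
proof -
  define m where "m = max 1 (max x y)"
  have "x powr \<alpha> * y powr \<beta> \<le> m powr \<alpha> * m powr \<beta>"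
    using assms by (intro mult_mono powr_mono2) (auto simp: m_def)
  also have "\<dots> = m powr (\<alpha> + \<beta>)"
    by (simp add: powr_add)
  also have "\<dots> \<le> m powr 1"
    using assms by (intro powr_mono) (auto simp: m_def)
  also have "\<dots> \<le> x + y + 1"
    using assms by (auto simp: m_def)
  finally show ?thesis .
qed

text \<open>Hoelder's inequality in the form of Young's inequality under the integral: a small power
  |f|^t is a product of powers of |f|^p \<omega> and of the dual weight, in which \<omega> cancels.
  The area mean for |f|^t gives a bound of order \<open>k\<close>, and raising it to the power
  \<open>Q\<close> recovers |f|^p.\<close>

lemma weighted_pointwise_bound_pos:
  assumes p: "0 < p" and q: "1 < q"
  obtains C where "0 \<le> C"
    "\<And>f \<omega> u z R \<Phi> \<Sigma>. \<lbrakk>f holomorphic_on unit_disc; 0 < R; ball u R \<subseteq> ball z (2 * R); cball u R \<subseteq> unit_disc;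
      ball z (2 * R) \<subseteq> unit_disc; 0 < \<Phi>; 0 < \<Sigma>; \<omega> \<in> borel_measurable disc_measure;
      AE w in disc_measure. 0 < \<omega> w;
      (\<integral>\<^sup>+w. ennreal (cmod (f w) powr p * \<omega> w) * indicator (ball z (2 * R)) w \<partial>disc_measure) \<le> ennreal \<Phi>;
      (\<integral>\<^sup>+w. ennreal (\<omega> w powr (- (1 / (q - 1)))) * indicator (ball z (2 * R)) w \<partial>disc_measure) \<le> ennreal \<Sigma>\<rbrakk>
      \<Longrightarrow> cmod (f u) powr p \<le> C * ((\<Phi> / R\<^sup>2) * (\<Sigma> / R\<^sup>2) powr (q - 1))"
proof -
  \<comment> \<open>\<open>Q\<close> exceeds both p and q, so that t = p / Q <= 1, as the area mean
    requires, and \<alpha> + \<beta> = q / Q <= 1, as Young's inequality requires.\<close>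
  define Q where "Q = max p q + 1"
  have Q: "0 < Q" "p < Q" "q < Q"
    using p q by (auto simp: Q_def)
  define t where "t = p / Q"
  define \<alpha> where "\<alpha> = 1 / Q"
  define \<beta> where "\<beta> = (q - 1) / Q"
  have t: "0 < t" "t \<le> 1"
    using p Q by (auto simp: t_def)
  have ab: "0 \<le> \<alpha>" "0 \<le> \<beta>" "\<alpha> + \<beta> \<le> 1"
    using Q q by (auto simp: \<alpha>_def \<beta>_def field_simps)
  define Ct where "Ct = 64 * 2 powr (2 / t * (1 - t))"
  define C where "C = (6 * pi * Ct) powr Q"
  have "cmod (f u) powr p \<le> C * ((\<Phi> / R\<^sup>2) * (\<Sigma> / R\<^sup>2) powr (q - 1))"
    if f: "f holomorphic_on unit_disc" and R: "0 < R"
      and sub: "ball u R \<subseteq> ball z (2 * R)" "cball u R \<subseteq> unit_disc" "ball z (2 * R) \<subseteq> unit_disc"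
      and pos: "0 < \<Phi>" "0 < \<Sigma>" and \<omega>: "\<omega> \<in> borel_measurable disc_measure" "AE w in disc_measure. 0 < \<omega> w"
      and \<Phi>: "(\<integral>\<^sup>+w. ennreal (cmod (f w) powr p * \<omega> w) * indicator (ball z (2 * R)) w \<partial>disc_measure) \<le> ennreal \<Phi>"
      and \<Sigma>: "(\<integral>\<^sup>+w. ennreal (\<omega> w powr (- (1 / (q - 1)))) * indicator (ball z (2 * R)) w \<partial>disc_measure) \<le> ennreal \<Sigma>"
    for f \<omega> u z R \<Phi> \<Sigma>
  proof -
    note [measurable] = \<omega>(1)
    have [measurable]: "f \<in> borel_measurable disc_measure"
      using f by (intro borel_measurable_disc_measure_continuous holomorphic_on_imp_continuous_on)
    let ?B = "ball z (2 * R)"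
    have B [measurable]: "?B \<in> sets disc_measure"
      using sub by (auto simp: sets_disc_measure sets_restrict_space_iff)
    define \<sigma> where "\<sigma> w = \<omega> w powr (- (1 / (q - 1)))" for w
    have [measurable]: "\<sigma> \<in> borel_measurable disc_measure"
      unfolding \<sigma>_def by measurable
    \<comment> \<open>Chosen so that |f|^t = k x^\<alpha> y^\<beta> with densities x and y whose
      integrals over the large ball are at most R^2. Together with the area 4 R^2 from the summand 1
      this makes 6 k R^2.\<close>
    define k where "k = (\<Phi> / R\<^sup>2) powr \<alpha> * (\<Sigma> / R\<^sup>2) powr \<beta>"
    have k: "0 \<le> k"
      by (simp add: k_def)
    have pt: "cmod (f w) powr t \<le> k * (R\<^sup>2 / \<Phi> * (cmod (f w) powr p * \<omega> w) + R\<^sup>2 / \<Sigma> * \<sigma> w + 1)"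
      if w: "0 < \<omega> w" for w
    proof -
      define x where "x = R\<^sup>2 / \<Phi> * (cmod (f w) powr p * \<omega> w)"
      define y where "y = R\<^sup>2 / \<Sigma> * \<sigma> w"
      have "x powr \<alpha> = (R\<^sup>2 / \<Phi>) powr \<alpha> * (cmod (f w) powr t * \<omega> w powr \<alpha>)"
        unfolding x_def powr_mult powr_powr t_def \<alpha>_def by simp
      moreover have "y powr \<beta> = (R\<^sup>2 / \<Sigma>) powr \<beta> * \<omega> w powr (- \<alpha>)"
        unfolding y_def \<sigma>_def powr_mult powr_powr \<alpha>_def \<beta>_def using q by simp
      ultimately have "k * (x powr \<alpha> * y powr \<beta>) = ((\<Phi> / R\<^sup>2) powr \<alpha> * (R\<^sup>2 / \<Phi>) powr \<alpha>) *
          ((\<Sigma> / R\<^sup>2) powr \<beta> * (R\<^sup>2 / \<Sigma>) powr \<beta>) * (\<omega> w powr \<alpha> * \<omega> w powr (- \<alpha>)) * cmod (f w) powr t"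
        by (simp add: k_def mult_ac)
      also have "(\<Phi> / R\<^sup>2) powr \<alpha> * (R\<^sup>2 / \<Phi>) powr \<alpha> = 1"
        using pos R by (subst powr_mult[symmetric]) auto
      also have "(\<Sigma> / R\<^sup>2) powr \<beta> * (R\<^sup>2 / \<Sigma>) powr \<beta> = 1"
        using pos R by (subst powr_mult[symmetric]) auto
      also have "\<omega> w powr \<alpha> * \<omega> w powr (- \<alpha>) = 1"
        using w by (simp add: powr_add[symmetric])
      finally have "cmod (f w) powr t = k * (x powr \<alpha> * y powr \<beta>)"
        by simp
      also have "\<dots> \<le> k * (x + y + 1)"
        using k w pos ab by (intro mult_left_mono powr_mult_powr_le) (auto simp: x_def y_def \<sigma>_def)
      finally show ?thesis
        by (simp add: x_def y_def)
    qed
    have "(\<integral>\<^sup>+w. ennreal (cmod (f w) powr t) * indicator (ball u R) w \<partial>disc_measure)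
        \<le> (\<integral>\<^sup>+w. ennreal k * (ennreal (R\<^sup>2 / \<Phi>) * (ennreal (cmod (f w) powr p * \<omega> w) * indicator ?B w)
          + ennreal (R\<^sup>2 / \<Sigma>) * (ennreal (\<sigma> w) * indicator ?B w) + indicator ?B w) \<partial>disc_measure)"
    proof (rule nn_integral_mono_AE)
      show "AE w in disc_measure. ennreal (cmod (f w) powr t) * indicator (ball u R) w
          \<le> ennreal k * (ennreal (R\<^sup>2 / \<Phi>) * (ennreal (cmod (f w) powr p * \<omega> w) * indicator ?B w)
            + ennreal (R\<^sup>2 / \<Sigma>) * (ennreal (\<sigma> w) * indicator ?B w) + indicator ?B w)"
        using \<omega>(2)
      proof eventually_elim
        case (elim w)
        show ?case
        proof (cases "w \<in> ball u R")
          case True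
          have "ennreal (cmod (f w) powr t)
              \<le> ennreal (k * (R\<^sup>2 / \<Phi> * (cmod (f w) powr p * \<omega> w) + R\<^sup>2 / \<Sigma> * \<sigma> w + 1))"
            by (rule ennreal_leI[OF pt[OF elim]])
          also have "\<dots> = ennreal k * (ennreal (R\<^sup>2 / \<Phi>) * ennreal (cmod (f w) powr p * \<omega> w)
              + ennreal (R\<^sup>2 / \<Sigma>) * ennreal (\<sigma> w) + 1)"
          proof -
            have "ennreal (k * (a * x + b * y + 1)) = ennreal k * (ennreal a * ennreal x + ennreal b * ennreal y + 1)"
              if "0 \<le> a" "0 \<le> x" "0 \<le> b" "0 \<le> y" for a b x y
              using that k by (simp add: ennreal_mult ennreal_plus)
            then show ?thesis
              using pos elim by (simp add: \<sigma>_def del: times_divide_eq_left)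
          qed
          finally show ?thesis
            using True sub(1) by (auto simp: indicator_def)
        qed simp
      qed
    qed
    also have "\<dots> = ennreal k * (ennreal (R\<^sup>2 / \<Phi>) *
          (\<integral>\<^sup>+w. ennreal (cmod (f w) powr p * \<omega> w) * indicator ?B w \<partial>disc_measure)
        + ennreal (R\<^sup>2 / \<Sigma>) * (\<integral>\<^sup>+w. ennreal (\<sigma> w) * indicator ?B w \<partial>disc_measure)
        + emeasure disc_measure ?B)"
      by (simp add: nn_integral_cmult nn_integral_add)
    also have "\<dots> \<le> ennreal k * (ennreal (R\<^sup>2 / \<Phi>) * ennreal \<Phi> + ennreal (R\<^sup>2 / \<Sigma>) * ennreal \<Sigma> + ennreal ((2 * R)\<^sup>2))"
      using \<Phi> \<Sigma> emeasure_disc_measure_ball[OF sub(3)] R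
      by (intro mult_left_mono add_mono) (auto simp: \<sigma>_def)
    also have "\<dots> = ennreal (6 * k * R\<^sup>2)"
      using k pos by (simp add: ennreal_mult[symmetric] ennreal_plus[symmetric] power2_eq_square
          del: ennreal_plus)
    finally have int1: "(\<integral>\<^sup>+w. ennreal (cmod (f w) powr t) * indicator (ball u R) w \<partial>disc_measure)
        \<le> ennreal (6 * k * R\<^sup>2)" .
    have bu: "ball u R \<in> sets disc_measure"
      using sub by (auto simp: sets_disc_measure sets_restrict_space_iff)
    have "(\<integral>\<^sup>+w. ennreal (cmod (f w) powr t) * indicator (ball u R) w \<partial>lborel)
        = (\<integral>\<^sup>+w. ennreal (cmod (f w) powr t) * indicator (ball u R) w * indicator unit_disc w \<partial>lborel)"
      using order_trans[OF ball_subset_cball sub(2)]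
      by (intro nn_integral_cong) (auto simp: indicator_def subset_iff)
    also have "\<dots> = ennreal pi * (ennreal (1 / pi) *
        (\<integral>\<^sup>+w. ennreal (cmod (f w) powr t) * indicator (ball u R) w * indicator unit_disc w \<partial>lborel))"
      by (simp add: mult.assoc[symmetric] ennreal_mult[symmetric])
    also have "\<dots> = ennreal pi * (\<integral>\<^sup>+w. ennreal (cmod (f w) powr t) * indicator (ball u R) w \<partial>disc_measure)"
      using bu by (subst nn_integral_disc_measure) auto
    also have "\<dots> \<le> ennreal pi * ennreal (6 * k * R\<^sup>2)"
      by (intro mult_left_mono int1) simp
    also have "\<dots> = ennreal (6 * pi * k * R\<^sup>2)"
      using k by (simp add: ennreal_mult[symmetric] mult_ac)
    finally have int2: "(\<integral>\<^sup>+w. ennreal (cmod (f w) powr t) * indicator (ball u R) w \<partial>lborel)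
        \<le> ennreal (6 * pi * k * R\<^sup>2)" .
    have "R\<^sup>2 * cmod (f u) powr t \<le> Ct * (6 * pi * k * R\<^sup>2)"
      unfolding Ct_def using k
      by (intro cmod_powr_le_area_mean[OF f open_ball sub(2) R t _ int2]) simp
    then have "cmod (f u) powr t \<le> 6 * pi * Ct * k"
      using R by (simp add: field_simps)
    then have "(cmod (f u) powr t) powr Q \<le> (6 * pi * Ct * k) powr Q"
      using Q by (intro powr_mono2) auto
    also have "(cmod (f u) powr t) powr Q = cmod (f u) powr p"
      using Q by (simp add: powr_powr t_def)
    also have "(6 * pi * Ct * k) powr Q = C * k powr Q"
      unfolding C_def by (rule powr_mult)
    also have "k powr Q = (\<Phi> / R\<^sup>2) * (\<Sigma> / R\<^sup>2) powr (q - 1)"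
      using pos R Q by (simp add: k_def powr_mult powr_powr \<alpha>_def \<beta>_def)
    finally show ?thesis .
  qed
  moreover have "0 \<le> C"
    by (simp add: C_def)
  ultimately show ?thesis
    using that by blast
qed

text \<open>Dividing by \<Phi> and \<Sigma> required them to be positive; the bounds are enlarged by
  e n, which tends to 0. The limit is harmless also at \<Sigma> = 0, because the exponent q - 1 is
  positive.\<close>

lemma weighted_pointwise_bound:
  assumes p: "0 < p" and q: "1 < q"
  obtains C where "0 \<le> C"
    "\<And>f \<omega> u z R \<Phi> \<Sigma>. \<lbrakk>f holomorphic_on unit_disc; 0 < R; ball u R \<subseteq> ball z (2 * R); cball u R \<subseteq> unit_disc;
      ball z (2 * R) \<subseteq> unit_disc; 0 \<le> \<Phi>; 0 \<le> \<Sigma>; \<omega> \<in> borel_measurable disc_measure;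
      AE w in disc_measure. 0 < \<omega> w;
      (\<integral>\<^sup>+w. ennreal (cmod (f w) powr p * \<omega> w) * indicator (ball z (2 * R)) w \<partial>disc_measure) \<le> ennreal \<Phi>;
      (\<integral>\<^sup>+w. ennreal (\<omega> w powr (- (1 / (q - 1)))) * indicator (ball z (2 * R)) w \<partial>disc_measure) \<le> ennreal \<Sigma>\<rbrakk>
      \<Longrightarrow> cmod (f u) powr p \<le> C * ((\<Phi> / R\<^sup>2) * (\<Sigma> / R\<^sup>2) powr (q - 1))"
proof (rule weighted_pointwise_bound_pos[OF p q])
  fix C :: real
  assume C: "0 \<le> C" and bound:
    "\<And>f \<omega> u z R \<Phi> \<Sigma>. \<lbrakk>f holomorphic_on unit_disc; 0 < R; ball u R \<subseteq> ball z (2 * R); cball u R \<subseteq> unit_disc;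
      ball z (2 * R) \<subseteq> unit_disc; 0 < \<Phi>; 0 < \<Sigma>; \<omega> \<in> borel_measurable disc_measure;
      AE w in disc_measure. 0 < \<omega> w;
      (\<integral>\<^sup>+w. ennreal (cmod (f w) powr p * \<omega> w) * indicator (ball z (2 * R)) w \<partial>disc_measure) \<le> ennreal \<Phi>;
      (\<integral>\<^sup>+w. ennreal (\<omega> w powr (- (1 / (q - 1)))) * indicator (ball z (2 * R)) w \<partial>disc_measure) \<le> ennreal \<Sigma>\<rbrakk>
      \<Longrightarrow> cmod (f u) powr p \<le> C * ((\<Phi> / R\<^sup>2) * (\<Sigma> / R\<^sup>2) powr (q - 1))"
  show thesis
  proof (rule that[OF C])
    fix f \<omega> u z R \<Phi> \<Sigma>
    assume h: "f holomorphic_on unit_disc" "0 < R" "ball u R \<subseteq> ball z (2 * R)" "cball u R \<subseteq> unit_disc"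
      "ball z (2 * R) \<subseteq> unit_disc" "0 \<le> \<Phi>" "0 \<le> \<Sigma>" "\<omega> \<in> borel_measurable disc_measure"
      "AE w in disc_measure. 0 < \<omega> w"
      "(\<integral>\<^sup>+w. ennreal (cmod (f w) powr p * \<omega> w) * indicator (ball z (2 * R)) w \<partial>disc_measure) \<le> ennreal \<Phi>"
      "(\<integral>\<^sup>+w. ennreal (\<omega> w powr (- (1 / (q - 1)))) * indicator (ball z (2 * R)) w \<partial>disc_measure) \<le> ennreal \<Sigma>"
    define e where "e n = inverse (real (Suc n))" for n
    have e: "e \<longlonglongrightarrow> 0" and e0: "\<And>n. 0 < e n"
      using LIMSEQ_inverse_real_of_nat by (auto simp: e_def[abs_def])
    have le: "cmod (f u) powr p \<le> C * (((\<Phi> + e n) / R\<^sup>2) * ((\<Sigma> + e n) / R\<^sup>2) powr (q - 1))" for n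
    proof (rule bound[OF h(1-5) _ _ h(8,9)])
      show "0 < \<Phi> + e n" "0 < \<Sigma> + e n"
        using h e0[of n] by auto
      show "(\<integral>\<^sup>+w. ennreal (cmod (f w) powr p * \<omega> w) * indicator (ball z (2 * R)) w \<partial>disc_measure) \<le> ennreal (\<Phi> + e n)"
        by (rule order_trans[OF h(10)]) (use e0[of n] in \<open>simp add: ennreal_leI\<close>)
      show "(\<integral>\<^sup>+w. ennreal (\<omega> w powr (- (1 / (q - 1)))) * indicator (ball z (2 * R)) w \<partial>disc_measure) \<le> ennreal (\<Sigma> + e n)"
        by (rule order_trans[OF h(11)]) (use e0[of n] in \<open>simp add: ennreal_leI\<close>)
    qed
    have "(\<lambda>n. ((\<Sigma> + e n) / R\<^sup>2) powr (q - 1)) \<longlonglongrightarrow> ((\<Sigma> + 0) / R\<^sup>2) powr (q - 1)"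
      using q h e0 by (intro tendsto_powr' tendsto_intros e) (auto intro!: always_eventually add_nonneg_nonneg less_imp_le)
    then have "(\<lambda>n. C * (((\<Phi> + e n) / R\<^sup>2) * ((\<Sigma> + e n) / R\<^sup>2) powr (q - 1)))
        \<longlonglongrightarrow> C * (((\<Phi> + 0) / R\<^sup>2) * ((\<Sigma> + 0) / R\<^sup>2) powr (q - 1))"
      using h(2) by (intro tendsto_mult tendsto_const tendsto_divide tendsto_add e) auto
    then show "cmod (f u) powr p \<le> C * ((\<Phi> / R\<^sup>2) * (\<Sigma> / R\<^sup>2) powr (q - 1))"
      using LIMSEQ_le_const[of _ _ "cmod (f u) powr p"] le by auto
  qed
qed

section \<open>Integration against the weight\<close>

text \<open>Source of the constant 2/3: points of the ball about \<open>z\<close> are less than s /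
  2 away from \<open>u\<close>, s = 1 - |z|, and s <= 4/3 (1 - |u|).\<close>

lemma whitney_ball_comparable:
  assumes z: "cmod z < 1" and u: "cmod (u - z) < (1 - cmod z) / 4"
  shows "4 * (1 - cmod u) \<le> 5 * (1 - cmod z)" "3 * (1 - cmod z) \<le> 4 * (1 - cmod u)"
    "z \<in> ball u (2 / 3 * (1 - cmod u))" "ball z ((1 - cmod z) / 4) \<subseteq> ball u (2 / 3 * (1 - cmod u))"
proof -
  define s where "s = 1 - cmod z"
  define r where "r = 1 - cmod u"
  have s: "0 < s" "4 * cmod (u - z) < s"
    using z u by (simp_all add: s_def)
  have "\<bar>cmod u - cmod z\<bar> \<le> cmod (u - z)"
    by (rule norm_triangle_ineq3)
  then have "\<bar>r - s\<bar> \<le> cmod (u - z)"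
    unfolding r_def s_def by (simp add: abs_minus_commute)
  then have rs: "r - s \<le> cmod (u - z)" "s - r \<le> cmod (u - z)"
    by (simp_all add: abs_le_iff)
  have cmp: "4 * r \<le> 5 * s" "3 * s \<le> 4 * r"
    using rs s by simp_all
  then show "4 * (1 - cmod u) \<le> 5 * (1 - cmod z)" "3 * (1 - cmod z) \<le> 4 * (1 - cmod u)"
    by (simp_all add: r_def s_def)
  have "cmod (u - z) < 2 / 3 * r"
    using cmp s by simp
  then show "z \<in> ball u (2 / 3 * (1 - cmod u))"
    by (simp add: dist_norm r_def)
  show "ball z ((1 - cmod z) / 4) \<subseteq> ball u (2 / 3 * (1 - cmod u))"
  proof
    fix w assume "w \<in> ball z ((1 - cmod z) / 4)"
    then have "4 * dist z w < s"
      by (simp add: s_def)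
    moreover have "dist u w \<le> dist u z + dist z w"
      by (rule dist_triangle)
    moreover have "dist u z = cmod (u - z)"
      by (rule dist_norm)
    ultimately have "dist u w < 2 / 3 * r"
      using s cmp by simp
    then show "w \<in> ball u (2 / 3 * (1 - cmod u))"
      by (simp add: r_def)
  qed
qed

lemma set_integral_eq_nn_integral_ball:
  assumes "set_integrable disc_measure A g" "\<And>w. w \<in> unit_disc \<Longrightarrow> 0 \<le> g w"
  shows "(\<integral>\<^sup>+w. ennreal (g w) * indicator A w \<partial>disc_measure) = ennreal (LINT w:A|disc_measure. g w)"
proof -
  have "(\<integral>\<^sup>+w. ennreal (g w) * indicator A w \<partial>disc_measure)
      = (\<integral>\<^sup>+w. ennreal (indicator A w *\<^sub>R g w) \<partial>disc_measure)"
    by (intro nn_integral_cong) (auto simp: indicator_def)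
  also have "\<dots> = ennreal (LINT w|disc_measure. indicator A w *\<^sub>R g w)"
    using assms by (intro nn_integral_eq_integral AE_I2) (auto simp: set_integrable_def indicator_def)
  finally show ?thesis
    by (simp add: set_lebesgue_integral_def)
qed

text \<open>On an outer annulus |F|^r \<omega> is at most \<open>A z\<close> times the integral of
  \<open>m\<close> over \<open>B z\<close>. After Tonelli it remains to bound the integral of
  \<open>A\<close> over the \<open>z\<close> near a fixed \<open>u\<close>, and this is where the
  A_q estimate on balls is used. On the compact remainder F is bounded and \<omega> is
  integrable.\<close>

lemma bergman_of_whitney_bound:
  assumes p: "0 < p" and q: "1 < q" and \<omega>: "\<omega> \<in> B_class q"
    and f: "f \<in> bergman p \<omega>" and F: "F holomorphic_on unit_disc" and r: "0 < r"
    and bound: "\<And>z. z \<in> unit_disc \<Longrightarrow>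
      \<exists>u. cmod (u - z) = (1 - cmod z) / 8 \<and> cmod (F z) powr r \<le> C * cmod (f u) powr p"
    and C: "0 \<le> C"
  shows "F \<in> bergman r \<omega>"
proof -
  define \<sigma> where "\<sigma> z = \<omega> z powr (- (1 / (q - 1)))" for z
  have w0: "\<And>z. z \<in> unit_disc \<Longrightarrow> 0 \<le> \<omega> z" and w_int: "integrable disc_measure \<omega>"
    and w_pos: "AE z in disc_measure. 0 < \<omega> z"
    using \<omega> by (auto simp: B_class_def weight_def)
  have [measurable]: "\<omega> \<in> borel_measurable disc_measure"
    using w_int by auto
  have [measurable]: "\<sigma> \<in> borel_measurable disc_measure"
    unfolding \<sigma>_def by measurable
  have f_holo: "f holomorphic_on unit_disc" and m_int: "integrable disc_measure (\<lambda>z. cmod (f z) powr p * \<omega> z)"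
    using f by (auto simp: bergman_def)
  have [measurable]: "f \<in> borel_measurable disc_measure" "F \<in> borel_measurable disc_measure"
    using f_holo F
    by (simp_all add: borel_measurable_disc_measure_continuous holomorphic_on_imp_continuous_on)
  define m where "m u = cmod (f u) powr p * \<omega> u" for u
  have m0: "\<And>u. u \<in> unit_disc \<Longrightarrow> 0 \<le> m u"
    using w0 by (simp add: m_def)
  have [measurable]: "m \<in> borel_measurable disc_measure"
    unfolding m_def by measurable
  obtain CB where CB: "0 \<le> CB"
    "\<And>u. \<lbrakk>cmod u < 1; 15 / 16 \<le> cmod u\<rbrakk> \<Longrightarrow>
      set_integrable disc_measure (ball u (2 / 3 * (1 - cmod u))) \<sigma>"
    "\<And>u. \<lbrakk>cmod u < 1; 15 / 16 \<le> cmod u\<rbrakk> \<Longrightarrow>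
      (LINT z:ball u (2 / 3 * (1 - cmod u))|disc_measure. \<omega> z) *
      (LINT z:ball u (2 / 3 * (1 - cmod u))|disc_measure. \<sigma> z) powr (q - 1) \<le> CB * (1 - cmod u) powr (2 * q)"
    using B_class_ball_bound[OF \<omega> q] unfolding \<sigma>_def by blast
  obtain CW where CW: "0 \<le> CW"
    "\<And>f \<omega> u z R \<Phi> \<Sigma>. \<lbrakk>f holomorphic_on unit_disc; 0 < R; ball u R \<subseteq> ball z (2 * R); cball u R \<subseteq> unit_disc;
      ball z (2 * R) \<subseteq> unit_disc; 0 \<le> \<Phi>; 0 \<le> \<Sigma>; \<omega> \<in> borel_measurable disc_measure;
      AE w in disc_measure. 0 < \<omega> w;
      (\<integral>\<^sup>+w. ennreal (cmod (f w) powr p * \<omega> w) * indicator (ball z (2 * R)) w \<partial>disc_measure) \<le> ennreal \<Phi>;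
      (\<integral>\<^sup>+w. ennreal (\<omega> w powr (- (1 / (q - 1)))) * indicator (ball z (2 * R)) w \<partial>disc_measure) \<le> ennreal \<Sigma>\<rbrakk>
      \<Longrightarrow> cmod (f u) powr p \<le> CW * ((\<Phi> / R\<^sup>2) * (\<Sigma> / R\<^sup>2) powr (q - 1))"
    using weighted_pointwise_bound[OF p q] by blast
  define B where "B z = ball z ((1 - cmod z) / 4)" for z :: complex
  \<comment> \<open>The ball is written as a condition on the pair of z and w, so that measurability
    in \<open>z\<close> follows from that of a parameter integral.\<close>
  define \<Sigma> where "\<Sigma> z = (LINT w|disc_measure. of_bool (cmod (w - z) < (1 - cmod z) / 4) * \<sigma> w)" for z
  have [measurable]: "\<Sigma> \<in> borel_measurable disc_measure"
    unfolding \<Sigma>_def of_bool_def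
    by (rule disc_measure.borel_measurable_lebesgue_integral) measurable
  have \<Sigma>_eq: "\<Sigma> z = (LINT w:B z|disc_measure. \<sigma> w)" for z
    unfolding \<Sigma>_def set_lebesgue_integral_def B_def
    by (intro Bochner_Integration.integral_cong) (auto simp: indicator_def dist_norm norm_minus_commute)
  have \<Sigma>0: "0 \<le> \<Sigma> z" for z
    unfolding \<Sigma>_def by (intro integral_nonneg_AE AE_I2) (auto simp: \<sigma>_def)
  define K where "K = C * CW * 64 powr q"
  have K: "0 \<le> K"
    using C CW by (simp add: K_def)
  \<comment> \<open>\<open>cmod (F z) powr r * \<omega> z\<close> will be at most \<open>A z\<close> times the integral of \<open>m\<close> over \<open>B z\<close>.\<close>
  define A where "A z = K * (1 - cmod z) powr (- 2 * q) * \<Sigma> z powr (q - 1) * \<omega> z" for z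
  have [measurable]: "A \<in> borel_measurable disc_measure"
    unfolding A_def by measurable
  have A0: "\<And>z. z \<in> unit_disc \<Longrightarrow> 0 \<le> A z"
    using K w0 by (simp add: A_def)
  \<comment> \<open>The bound 31/32 ensures |u| >= 15/16, the range of the estimate on balls: 1 -
    |u| <= 5/4 * 1/32 < 1/16.\<close>
  define near where "near z u \<longleftrightarrow> 31 / 32 \<le> cmod z \<and> cmod (u - z) < (1 - cmod z) / 4" for z u :: complex
  have [measurable]: "(\<lambda>u. of_bool (near z u) :: ennreal) \<in> borel_measurable disc_measure"
      "(\<lambda>z. of_bool (near z u) :: ennreal) \<in> borel_measurable disc_measure" for z u
    unfolding near_def of_bool_def by measurable
  have [measurable]: "(\<lambda>x. of_bool (near (fst x) (snd x)) :: ennreal)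
      \<in> borel_measurable (disc_measure \<Otimes>\<^sub>M disc_measure)"
    unfolding near_def of_bool_def by measurable
  have near_u: "15 / 16 \<le> cmod u" if "near z u" "cmod z < 1" for z u
  proof -
    have "4 * (1 - cmod u) \<le> 5 * (1 - cmod z)" "31 / 32 \<le> cmod z"
      using whitney_ball_comparable(1)[OF that(2), of u] that(1) by (simp_all add: near_def)
    then show ?thesis
      by simp
  qed
  have B_disc: "B z \<subseteq> unit_disc" if "z \<in> unit_disc" for z
    unfolding B_def by (rule ball_subset_unit_disc) (use that in \<open>simp add: field_simps\<close>)
  have B_sets [measurable]: "B z \<in> sets disc_measure" if "z \<in> unit_disc" for z
    using B_disc[OF that] by (auto simp: B_def sets_disc_measure sets_restrict_space_iff)
  have pointwise: "ennreal (cmod (F z) powr r * \<omega> z)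
      \<le> ennreal (A z) * (\<integral>\<^sup>+u. of_bool (near z u) * ennreal (m u) \<partial>disc_measure)"
    if z: "z \<in> unit_disc" and zbig: "31 / 32 \<le> cmod z" for z
  proof -
    define s where "s = 1 - cmod z"
    \<comment> \<open>Also the distance of \<open>u\<close> from \<open>z\<close>, so that the ball
      of radius R about \<open>u\<close> fits into \<open>B z\<close>, the ball of radius 2 R about
      \<open>z\<close>.\<close>
    define R where "R = s / 8"
    have z1: "cmod z < 1"
      using z by simp
    have s: "0 < s" and R: "0 < R"
      using z1 by (auto simp: s_def R_def)
    have "2 * R = (1 - cmod z) / 4"
      by (simp add: R_def s_def field_simps)
    then have B2R: "B z = ball z (2 * R)"
      by (simp only: B_def)
    obtain u where u: "cmod (u - z) = (1 - cmod z) / 8" "cmod (F z) powr r \<le> C * cmod (f u) powr p"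
      using bound[OF z] by blast
    have dist_uz: "dist u z = R"
      using u(1) by (simp add: dist_norm R_def s_def)
    have uR: "ball u R \<subseteq> ball z (2 * R)"
    proof
      fix w assume "w \<in> ball u R"
      then show "w \<in> ball z (2 * R)"
        using dist_triangle[of z w u] dist_uz by (simp add: dist_commute)
    qed
    have uR': "cball u R \<subseteq> unit_disc"
    proof
      fix w assume "w \<in> cball u R"
      then have "dist z w \<le> 2 * R"
        using dist_triangle[of z w u] dist_uz by (simp add: dist_commute)
      moreover have "cmod w \<le> cmod z + dist z w"
        using norm_triangle_sub[of w z] by (simp add: dist_norm norm_minus_commute)
      moreover have "2 * R < s"
        using s by (simp add: R_def)
      ultimately show "w \<in> unit_disc"
        by (simp add: s_def)
    qed
    have \<sigma>B: "set_integrable disc_measure (B z) \<sigma>"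
    proof (rule set_integrable_subset)
      show "set_integrable disc_measure (ball z (2 / 3 * (1 - cmod z))) \<sigma>"
        using z1 zbig by (intro CB(2)) auto
      show "B z \<subseteq> ball z (2 / 3 * (1 - cmod z))"
        using z1 by (auto simp: B_def)
    qed (rule B_sets[OF z])
    have mB: "set_integrable disc_measure (B z) m"
      unfolding set_integrable_def m_def using m_int B_sets[OF z] by (intro integrable_mult_indicator)
    define \<Phi> where "\<Phi> = (LINT w:B z|disc_measure. m w)"
    have \<Phi>0: "0 \<le> \<Phi>"
      unfolding \<Phi>_def set_lebesgue_integral_def
      by (intro integral_nonneg_AE AE_I2) (auto simp: indicator_def m0)
    have \<Phi>_nn: "(\<integral>\<^sup>+w. ennreal (m w) * indicator (B z) w \<partial>disc_measure) = ennreal \<Phi>"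
      unfolding \<Phi>_def by (rule set_integral_eq_nn_integral_ball[OF mB m0])
    have \<Sigma>_nn: "(\<integral>\<^sup>+w. ennreal (\<sigma> w) * indicator (B z) w \<partial>disc_measure) = ennreal (\<Sigma> z)"
      unfolding \<Sigma>_eq by (rule set_integral_eq_nn_integral_ball[OF \<sigma>B]) (simp add: \<sigma>_def)
    have fu: "cmod (f u) powr p \<le> CW * ((\<Phi> / R\<^sup>2) * (\<Sigma> z / R\<^sup>2) powr (q - 1))"
    proof (rule CW(2)[OF f_holo R uR uR' _ \<Phi>0 \<Sigma>0 _ w_pos])
      show "ball z (2 * R) \<subseteq> unit_disc"
        using B_disc[OF z] by (simp add: B2R)
      show "(\<integral>\<^sup>+w. ennreal (cmod (f w) powr p * \<omega> w) * indicator (ball z (2 * R)) w \<partial>disc_measure) \<le> ennreal \<Phi>"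
        using \<Phi>_nn by (simp add: m_def B2R)
      show "(\<integral>\<^sup>+w. ennreal (\<omega> w powr (- (1 / (q - 1)))) * indicator (ball z (2 * R)) w \<partial>disc_measure) \<le> ennreal (\<Sigma> z)"
        using \<Sigma>_nn by (simp add: \<sigma>_def B2R)
    qed measurable
    have R_powr: "1 / R\<^sup>2 * (1 / R\<^sup>2) powr (q - 1) = 64 powr q * s powr (- 2 * q)"
    proof -
      have "1 / R\<^sup>2 * (1 / R\<^sup>2) powr (q - 1) = (1 / R\<^sup>2) powr q"
        using R by (simp add: powr_diff)
      also have "\<dots> = (64 * s powr (- 2)) powr q"
        using s by (simp add: R_def powr_minus_divide power2_eq_square)
      also have "\<dots> = 64 powr q * s powr (- 2 * q)"
        by (simp only: powr_mult powr_powr)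
      finally show ?thesis .
    qed
    have "cmod (F z) powr r \<le> C * (CW * ((\<Phi> / R\<^sup>2) * (\<Sigma> z / R\<^sup>2) powr (q - 1)))"
      using u(2) mult_left_mono[OF fu C] by linarith
    also have "(\<Sigma> z / R\<^sup>2) powr (q - 1) = \<Sigma> z powr (q - 1) * (1 / R\<^sup>2) powr (q - 1)"
      using powr_mult[of "\<Sigma> z" "1 / R\<^sup>2" "q - 1"] \<Sigma>0 by simp
    also have "C * (CW * ((\<Phi> / R\<^sup>2) * (\<Sigma> z powr (q - 1) * (1 / R\<^sup>2) powr (q - 1))))
        = C * CW * (1 / R\<^sup>2 * (1 / R\<^sup>2) powr (q - 1)) * \<Sigma> z powr (q - 1) * \<Phi>"
      by (simp add: mult_ac)
    also have "\<dots> = K * s powr (- 2 * q) * \<Sigma> z powr (q - 1) * \<Phi>"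
      unfolding R_powr by (simp add: K_def mult_ac)
    finally have "cmod (F z) powr r * \<omega> z \<le> K * s powr (- 2 * q) * \<Sigma> z powr (q - 1) * \<Phi> * \<omega> z"
      using w0[OF z] by (rule mult_right_mono)
    also have "\<dots> = A z * \<Phi>"
      by (simp add: A_def s_def mult_ac)
    finally have "ennreal (cmod (F z) powr r * \<omega> z) \<le> ennreal (A z * \<Phi>)"
      by (rule ennreal_leI)
    also have "\<dots> = ennreal (A z) * ennreal \<Phi>"
      using A0[OF z] \<Phi>0 by (rule ennreal_mult)
    also have "ennreal \<Phi> = (\<integral>\<^sup>+u. of_bool (near z u) * ennreal (m u) \<partial>disc_measure)"
      unfolding \<Phi>_nn[symmetric] using zbig
      by (intro nn_integral_cong) (auto simp: near_def B_def indicator_def dist_norm norm_minus_commute)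
    finally show ?thesis .
  qed
  \<comment> \<open>The power of 5/4 comes from 1 - |z| >= 4/5 (1 - |u|); the powers of 1 - |u|
    cancel against those in the bound \<open>CB\<close>.\<close>
  define D where "D = K * (5 / 4) powr (2 * q) * CB"
  have inner: "(\<integral>\<^sup>+z. ennreal (A z) * of_bool (near z u) \<partial>disc_measure) \<le> ennreal D" if u: "u \<in> unit_disc" for u
  proof (cases "15 / 16 \<le> cmod u")
    case False
    have "(\<integral>\<^sup>+z. ennreal (A z) * of_bool (near z u) \<partial>disc_measure) = (\<integral>\<^sup>+z. 0 \<partial>disc_measure)"
      using near_u False by (intro nn_integral_cong) auto
    then show ?thesis
      by simp
  next
    case True
    define s where "s = 1 - cmod u"
    define G where "G = ball u (2 / 3 * s)"
    define Y where "Y = (LINT w:G|disc_measure. \<sigma> w)"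
    define X where "X = (LINT w:G|disc_measure. \<omega> w)"
    have s: "0 < s"
      using u by (simp add: s_def)
    have G_disc: "G \<subseteq> unit_disc"
      unfolding G_def by (rule ball_subset_unit_disc) (use s in \<open>simp add: s_def field_simps\<close>)
    then have [measurable]: "G \<in> sets disc_measure"
      by (auto simp: G_def sets_disc_measure sets_restrict_space_iff)
    have \<sigma>G: "set_integrable disc_measure G \<sigma>"
      unfolding G_def s_def using u True by (intro CB(2)) auto
    have wG: "set_integrable disc_measure G \<omega>"
      unfolding set_integrable_def using w_int by (intro integrable_mult_indicator) auto
    have XY: "X * Y powr (q - 1) \<le> CB * s powr (2 * q)"
      unfolding X_def Y_def G_def s_def using u True by (intro CB(3)) auto
    have Y0: "0 \<le> Y"
      unfolding Y_def set_lebesgue_integral_def by (intro integral_nonneg_AE AE_I2) (auto simp: \<sigma>_def)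
    have X0: "0 \<le> X"
      unfolding X_def set_lebesgue_integral_def
      by (intro integral_nonneg_AE AE_I2) (auto simp: indicator_def w0)
    define L where "L = K * ((5 / 4) powr (2 * q) * s powr (- 2 * q)) * Y powr (q - 1)"
    have L0: "0 \<le> L"
      using K by (simp add: L_def)
    have "(\<integral>\<^sup>+z. ennreal (A z) * of_bool (near z u) \<partial>disc_measure)
        \<le> (\<integral>\<^sup>+z. ennreal L * (ennreal (\<omega> z) * indicator G z) \<partial>disc_measure)"
    proof (rule nn_integral_mono)
      fix z assume "z \<in> space disc_measure"
      then have z: "z \<in> unit_disc"
        by simp
      show "ennreal (A z) * of_bool (near z u) \<le> ennreal L * (ennreal (\<omega> z) * indicator G z)"
      proof (cases "near z u")
        case True
        have z1: "cmod z < 1"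
          using z by simp
        have uz: "cmod (u - z) < (1 - cmod z) / 4"
          using True by (simp add: near_def)
        note cmp = whitney_ball_comparable[OF z1 uz]
        have zG: "z \<in> G"
          using cmp(3) by (simp add: G_def s_def)
        have BG: "B z \<subseteq> G"
          using cmp(4) by (simp add: B_def G_def s_def)
        have "4 / 5 * s \<le> 1 - cmod z"
          using cmp(1) by (simp add: s_def)
        then have "(1 - cmod z) powr (- 2 * q) \<le> (4 / 5 * s) powr (- 2 * q)"
          using s q by (intro powr_mono2') auto
        also have "\<dots> = (5 / 4) powr (2 * q) * s powr (- 2 * q)"
        proof -
          have "(4 / 5 :: real) powr (- 2 * q) = (5 / 4) powr (2 * q)"
            by (simp add: powr_minus_divide powr_divide)
          then show ?thesis
            by (simp only: powr_mult)
        qed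
        finally have 1: "(1 - cmod z) powr (- 2 * q) \<le> (5 / 4) powr (2 * q) * s powr (- 2 * q)" .
        have "(LINT w|disc_measure. indicator (B z) w *\<^sub>R \<sigma> w) \<le> (LINT w|disc_measure. indicator G w *\<^sub>R \<sigma> w)"
        proof (rule integral_mono)
          show "integrable disc_measure (\<lambda>w. indicator (B z) w *\<^sub>R \<sigma> w)"
            using set_integrable_subset[OF \<sigma>G B_sets[OF z] BG] by (simp add: set_integrable_def)
          show "integrable disc_measure (\<lambda>w. indicator G w *\<^sub>R \<sigma> w)"
            using \<sigma>G by (simp add: set_integrable_def)
        qed (use BG in \<open>auto simp: indicator_def \<sigma>_def\<close>)
        then have "\<Sigma> z \<le> Y"
          by (simp add: \<Sigma>_eq Y_def set_lebesgue_integral_def)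
        then have 2: "\<Sigma> z powr (q - 1) \<le> Y powr (q - 1)"
          using \<Sigma>0 q by (intro powr_mono2) auto
        have "A z \<le> L * \<omega> z"
          unfolding A_def L_def using 1 2 K w0[OF z]
          by (intro mult_right_mono mult_mono mult_left_mono) auto
        then have "ennreal (A z) \<le> ennreal L * ennreal (\<omega> z)"
          using L0 w0[OF z] by (simp add: ennreal_mult[symmetric] ennreal_leI)
        then show ?thesis
          using True zG by simp
      qed simp
    qed
    also have "\<dots> = ennreal L * (\<integral>\<^sup>+z. ennreal (\<omega> z) * indicator G z \<partial>disc_measure)"
      by (rule nn_integral_cmult) measurable
    also have "(\<integral>\<^sup>+z. ennreal (\<omega> z) * indicator G z \<partial>disc_measure) = ennreal X"
      unfolding X_def by (rule set_integral_eq_nn_integral_ball[OF wG w0])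
    also have "ennreal L * ennreal X = ennreal (L * X)"
      using L0 X0 by (rule ennreal_mult[symmetric])
    also have "\<dots> \<le> ennreal D"
    proof (rule ennreal_leI)
      have "L * X = K * (5 / 4) powr (2 * q) * s powr (- 2 * q) * (X * Y powr (q - 1))"
        by (simp add: L_def mult_ac)
      also have "\<dots> \<le> K * (5 / 4) powr (2 * q) * s powr (- 2 * q) * (CB * s powr (2 * q))"
        using K by (intro mult_left_mono XY) auto
      also have "\<dots> = D * (s powr (- 2 * q) * s powr (2 * q))"
        by (simp add: D_def mult_ac)
      also have "s powr (- 2 * q) * s powr (2 * q) = 1"
        using s by (simp add: powr_add[symmetric])
      finally show "L * X \<le> D"
        by simp
    qed
    finally show ?thesis .
  qed
  have cont: "continuous_on (cball 0 (31 / 32)) F"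
    using F by (rule holomorphic_on_imp_continuous_on[OF holomorphic_on_subset]) auto
  have "bounded (F ` cball 0 (31 / 32))"
    by (intro compact_imp_bounded compact_continuous_image cont) simp
  then obtain b where "\<forall>z\<in>cball 0 (31 / 32). cmod (F z) \<le> b"
    unfolding bounded_iff by auto
  then have b: "cmod (F z) \<le> b" if "cmod z \<le> 31 / 32" for z
    using that by simp
  \<comment> \<open>The bounds for the inner disc and the annulus are added, so that no splitting of
    the domain is needed.\<close>
  have "(\<integral>\<^sup>+z. ennreal (cmod (F z) powr r * \<omega> z) \<partial>disc_measure)
      \<le> (\<integral>\<^sup>+z. ennreal (b powr r) * ennreal (\<omega> z)
        + (\<integral>\<^sup>+u. ennreal (A z) * (of_bool (near z u) * ennreal (m u)) \<partial>disc_measure) \<partial>disc_measure)"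
  proof (rule nn_integral_mono)
    fix z assume "z \<in> space disc_measure"
    then have z: "z \<in> unit_disc"
      by simp
    show "ennreal (cmod (F z) powr r * \<omega> z) \<le> ennreal (b powr r) * ennreal (\<omega> z)
        + (\<integral>\<^sup>+u. ennreal (A z) * (of_bool (near z u) * ennreal (m u)) \<partial>disc_measure)"
    proof (cases "31 / 32 \<le> cmod z")
      case True
      have "(\<integral>\<^sup>+u. ennreal (A z) * (of_bool (near z u) * ennreal (m u)) \<partial>disc_measure)
          = ennreal (A z) * (\<integral>\<^sup>+u. of_bool (near z u) * ennreal (m u) \<partial>disc_measure)"
        by (rule nn_integral_cmult) measurable
      then show ?thesis
        using pointwise[OF z True] by (simp add: add_increasing)
    next
      case False
      then have "cmod (F z) powr r * \<omega> z \<le> b powr r * \<omega> z"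
        using b[of z] w0[OF z] r by (intro mult_right_mono powr_mono2) auto
      then have "ennreal (cmod (F z) powr r * \<omega> z) \<le> ennreal (b powr r) * ennreal (\<omega> z)"
        using w0[OF z] by (simp add: ennreal_mult[symmetric] ennreal_leI)
      then show ?thesis
        by (rule order_trans) simp
    qed
  qed
  also have "\<dots> = ennreal (b powr r) * (\<integral>\<^sup>+z. ennreal (\<omega> z) \<partial>disc_measure)
      + (\<integral>\<^sup>+z. \<integral>\<^sup>+u. ennreal (A z) * (of_bool (near z u) * ennreal (m u)) \<partial>disc_measure \<partial>disc_measure)"
    by (subst nn_integral_add) (auto simp: nn_integral_cmult)
  also have "(\<integral>\<^sup>+z. \<integral>\<^sup>+u. ennreal (A z) * (of_bool (near z u) * ennreal (m u)) \<partial>disc_measure \<partial>disc_measure)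
      = (\<integral>\<^sup>+u. \<integral>\<^sup>+z. ennreal (A z) * (of_bool (near z u) * ennreal (m u)) \<partial>disc_measure \<partial>disc_measure)"
    by (rule disc_pair.Fubini'[symmetric]) (unfold case_prod_unfold, measurable)
  also have "\<dots> \<le> (\<integral>\<^sup>+u. ennreal D * ennreal (m u) \<partial>disc_measure)"
  proof (rule nn_integral_mono)
    fix u assume "u \<in> space disc_measure"
    then have u: "u \<in> unit_disc"
      by simp
    have "(\<integral>\<^sup>+z. ennreal (A z) * (of_bool (near z u) * ennreal (m u)) \<partial>disc_measure)
        = (\<integral>\<^sup>+z. ennreal (A z) * of_bool (near z u) * ennreal (m u) \<partial>disc_measure)"
      by (simp add: mult.assoc)
    also have "\<dots> = (\<integral>\<^sup>+z. ennreal (A z) * of_bool (near z u) \<partial>disc_measure) * ennreal (m u)"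
      by (rule nn_integral_multc) measurable
    also have "\<dots> \<le> ennreal D * ennreal (m u)"
      by (intro mult_right_mono inner u) simp
    finally show "(\<integral>\<^sup>+z. ennreal (A z) * (of_bool (near z u) * ennreal (m u)) \<partial>disc_measure)
        \<le> ennreal D * ennreal (m u)" .
  qed
  also have "(\<integral>\<^sup>+u. ennreal D * ennreal (m u) \<partial>disc_measure) = ennreal D * (\<integral>\<^sup>+u. ennreal (m u) \<partial>disc_measure)"
    by (rule nn_integral_cmult) measurable
  also have "ennreal (b powr r) * (\<integral>\<^sup>+z. ennreal (\<omega> z) \<partial>disc_measure)
      + ennreal D * (\<integral>\<^sup>+u. ennreal (m u) \<partial>disc_measure) < \<infinity>"
  proof -
    have "(\<integral>\<^sup>+z. ennreal (\<omega> z) \<partial>disc_measure) = ennreal (LINT z|disc_measure. \<omega> z)"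
      by (rule nn_integral_eq_integral[OF w_int AE_I2]) (simp add: w0)
    moreover have "(\<integral>\<^sup>+z. ennreal (m z) \<partial>disc_measure) = ennreal (LINT z|disc_measure. m z)"
      unfolding m_def by (rule nn_integral_eq_integral[OF m_int AE_I2]) (simp add: w0)
    ultimately show ?thesis
      by (simp add: ennreal_mult_less_top)
  qed
  finally have fin: "(\<integral>\<^sup>+z. ennreal (cmod (F z) powr r * \<omega> z) \<partial>disc_measure) < \<infinity>"
    by (simp add: add_left_mono)
  have "integrable disc_measure (\<lambda>z. cmod (F z) powr r * \<omega> z)"
  proof (rule integrableI_nonneg)
    show "AE z in disc_measure. 0 \<le> cmod (F z) powr r * \<omega> z"
      using w0 by (intro AE_I2) simp
  qed (use fin in measurable)
  with F show ?thesis
    by (simp add: bergman_def)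
qed

theorem corollary3:
  fixes p \<gamma> :: real
    and \<omega> :: "complex \<Rightarrow> real"
    and I I' :: "nat set"
    and a b :: "nat \<Rightarrow> complex"
    and \<sigma> :: "nat \<Rightarrow> nat"
  assumes "0 < p"
    and "\<omega> \<in> B_infinity"
    and "bergman_zero_set p \<omega> I a"
    and "finite_union_of_separated I a"
    and "0 < \<gamma>" and "\<gamma> < 1"
    and "\<forall>m\<in>I'. b m \<in> unit_disc"
    and "bij_betw \<sigma> I I'"
    and "\<forall>n\<in>I. 1 - (cmod (b (\<sigma> n)))\<^sup>2 = \<gamma> * (1 - (cmod (a n))\<^sup>2)"
    and "\<exists>\<delta><1. \<forall>n\<in>I. pseudohyperbolic_dist (a n) (b (\<sigma> n)) \<le> \<delta>"
  shows "bergman_zero_set (p / \<gamma>) \<omega> I' b"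
proof -
  obtain q where q: "1 < q" "\<omega> \<in> B_class q"
    using assms(2) by (auto simp: B_infinity_def)
  obtain f where f: "f \<in> bergman p \<omega>" "\<exists>z\<in>unit_disc. f z \<noteq> 0" "zero_sequence_of f I a"
    using assms(3) by (auto simp: bergman_zero_set_def)
  have f_holo: "f holomorphic_on unit_disc"
    using f(1) by (simp add: bergman_def)
  obtain \<delta> where \<delta>: "\<delta> < 1" "\<And>n. n \<in> I \<Longrightarrow> pseudohyperbolic_dist (a n) ((b \<circ> \<sigma>) n) \<le> \<delta>"
    using assms(10) by auto
  have b1: "cmod ((b \<circ> \<sigma>) n) < 1" if "n \<in> I" for n
    using assms(7,8) that by (auto simp: bij_betw_def)
  have ab: "1 - (cmod ((b \<circ> \<sigma>) n))\<^sup>2 = \<gamma> * (1 - (cmod (a n))\<^sup>2)" if "n \<in> I" for n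
    using assms(9) that by simp
  obtain F C where F: "F holomorphic_on unit_disc" "\<exists>z\<in>unit_disc. F z \<noteq> 0" "zero_sequence_of F I (b \<circ> \<sigma>)"
    and FC: "\<And>z. z \<in> unit_disc \<Longrightarrow>
      \<exists>u. cmod (u - z) = (1 - cmod z) / 8 \<and> cmod (F z) \<le> C * cmod (f u) powr \<gamma>"
    using perturbed_zeros_function[OF f_holo f(2,3) assms(4-6) b1 ab \<delta>(2,1)] by blast
  have "F \<in> bergman (p / \<gamma>) \<omega>"
  proof (rule bergman_of_whitney_bound[OF assms(1) q f(1) F(1)])
    fix z :: complex assume "z \<in> unit_disc"
    then obtain u where u: "cmod (u - z) = (1 - cmod z) / 8" "cmod (F z) \<le> C * cmod (f u) powr \<gamma>"
      using FC by blast
    \<comment> \<open>The sign of \<open>C\<close> is not part of what was obtained, and a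
      nonnegative constant is wanted. The exponent p / \<gamma> is the one that turns |f|^\<gamma>
      into |f|^p.\<close>
    have "C * cmod (f u) powr \<gamma> \<le> max C 0 * cmod (f u) powr \<gamma>"
      by (intro mult_right_mono) auto
    then have "cmod (F z) powr (p / \<gamma>) \<le> (max C 0 * cmod (f u) powr \<gamma>) powr (p / \<gamma>)"
      using u(2) assms(1,5) by (intro powr_mono2) auto
    also have "\<dots> = max C 0 powr (p / \<gamma>) * cmod (f u) powr p"
      using assms(5) by (simp add: powr_mult powr_powr)
    finally show "\<exists>u. cmod (u - z) = (1 - cmod z) / 8 \<and>
        cmod (F z) powr (p / \<gamma>) \<le> max C 0 powr (p / \<gamma>) * cmod (f u) powr p"
      using u(1) by blast
  qed (use assms(1,5) in auto)
  moreover have "zero_sequence_of F I' b"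
    unfolding zero_sequence_of_def
  proof (intro conjI ballI)
    fix w :: complex assume w: "w \<in> unit_disc"
    \<comment> \<open>The zeros of \<open>F\<close> are listed by \<open>b \<circ> \<sigma>\<close>
      over \<open>I\<close>; the bijection of indices carries the multiplicities over to
      \<open>b\<close> on \<open>I'\<close>, also where \<sigma> relates distinct indices with equal
      points.\<close>
    have I': "I' = \<sigma> ` I" and inj: "inj_on \<sigma> I"
      using assms(8) by (auto simp: bij_betw_def)
    have eq: "{m\<in>I'. b m = w} = \<sigma> ` {n\<in>I. (b \<circ> \<sigma>) n = w}"
      unfolding I' by auto
    have "card {m\<in>I'. b m = w} = card {n\<in>I. (b \<circ> \<sigma>) n = w}"
      unfolding eq by (intro card_image inj_on_subset[OF inj]) auto
    then show "int (card {m\<in>I'. b m = w}) = zorder F w"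
      using F(3) w by (simp add: zero_sequence_of_def)
    show "finite {m\<in>I'. b m = w}"
      unfolding eq using F(3) w by (intro finite_imageI) (simp add: zero_sequence_of_def)
  qed (use assms(7) in auto)
  ultimately show ?thesis
    using F(2) by (auto simp: bergman_zero_set_def)
qed

end
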